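(* Let $1<p<\infty$ and let $\phi\in GL^\infty(\mathbb{T})$. The operator $M(\phi)$ is invertible on $H^p(\mathbb{T})$ if and only if $\phi$ admits an asymmetric factorization in $L^p(\mathbb{T})$ with the index $\kappa=0$.
   Context: $\mathbb{T}$ is the complex unit circle, $1<p<\infty$, $p^{-1}+q^{-1}=1$. $H^p(\mathbb{T})$ is the Hardy space of functions in $L^p(\mathbb{T})$ whose Fourier coefficients with negative index vanish; $\overline{H^p(\mathbb{T})}$ is the set of functions whose complex conjugate belongs to $H^p(\mathbb{T})$. $P:\sum_{n\in\mathbb{Z}} f_nt^n\mapsto\sum_{n\ge 0}f_nt^n$ is the Riesz projection, bounded on $L^p(\mathbb{T})$ with image $H^p(\mathbb{T})$. $J$ is the flip operator $(Jf)(t)=t^{-1}f(t^{-1})$. $I$ is the identity. $L(\phi):f\mapsto\phi f$ denotes multiplication by $\phi$. $GL^\infty(\mathbb{T})$ is the group of invertible elements of the algebra $L^\infty(\mathbb{T})$. For $\phi\in L^\infty(\mathbb{T})$, $M(\phi)=T(\phi)+H(\phi)$ is the bounded operator on $H^p(\mathbb{T})$ given by $T(\phi)f=P(\phi f)$, $H(\phi)f=P(\phi\,(Jf))$. $L^p_{\rm even}(\mathbb{T})$ is the set of $f\in L^p(\mathbb{T})$ with $f(t)=f(t^{-1})$ a.e. $L^p_J(\mathbb{T})$ is the image of the projection $P_J=(I+J)/2$ on $L^p(\mathbb{T})$, i.e. $\{f\in L^p(\mathbb{T}):Jf=f\}$. $\mathcal{R}$ is the space of all trigonometric polynomials. A function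 $\phi\in GL^\infty(\mathbb{T})$ is said to admit an asymmetric factorization in $L^p(\mathbb{T})$ (with index $\kappa$) if it admits a representation $\phi(t)=\phi_-(t)t^{\kappa}\phi_0(t)$, $t\in\mathbb{T}$, with $\kappa\in\mathbb{Z}$ and (i) $(1+t^{-1})\phi_-\in\overline{H^p(\mathbb{T})}$, $(1-t^{-1})\phi_-^{-1}\in\overline{H^q(\mathbb{T})}$; (ii) $|1-t|\phi_0\in L^q_{\rm even}(\mathbb{T})$, $|1+t|\phi_0^{-1}\in L^p_{\rm even}(\mathbb{T})$; (iii) the linear operator $B=L(\phi_0^{-1})(I+J)PL(\phi_-^{-1})$ acting from $X_1$ into $X_2$ extends to a linear bounded operator from $L^p(\mathbb{T})$ into $L^p_J(\mathbb{T})$, where $X_1=\{(1-t^{-1})f(t):f\in\mathcal{R}\}$ (dense in $L^p(\mathbb{T})$) and $X_2=\{(1+t^{-1})\phi_0^{-1}(t)f(t):f\in\mathcal{R},\ f(t)=f(t^{-1})\}\subseteq L^p_J(\mathbb{T})$. *)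

theory Defs
  imports "HOL-Analysis.Analysis"
begin

text \<open>
  Normalized arc length on the unit circle. Elements of the Lebesgue spaces are represented by
  functions \<open>complex \<Rightarrow> complex\<close>, of which only the restriction to the circle matters; identities
  between such elements are stated almost everywhere with respect to this measure.
\<close>

definition circle_measure :: "complex measure" where
  "circle_measure =
     distr (uniform_measure lborel {0..<2 * pi}) (restrict_space borel (sphere 0 1)) cis"

definition ae_eq :: "(complex \<Rightarrow> complex) \<Rightarrow> (complex \<Rightarrow> complex) \<Rightarrow> bool" where
  "ae_eq f g \<longleftrightarrow> (AE t in circle_measure. f t = g t)"

definition Lp :: "real \<Rightarrow> (complex \<Rightarrow> complex) set" where
  "Lp p = {f \<in> borel_measurable circle_measure.
             integrable circle_measure (\<lambda>t. norm (f t) powr p)}"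

definition Lp_norm :: "real \<Rightarrow> (complex \<Rightarrow> complex) \<Rightarrow> real" where
  "Lp_norm p f = (LINT t|circle_measure. norm (f t) powr p) powr (1 / p)"

definition Linf :: "(complex \<Rightarrow> complex) set" where
  "Linf = {f \<in> borel_measurable circle_measure.
             \<exists>C. AE t in circle_measure. norm (f t) \<le> C}"

definition GLinf :: "(complex \<Rightarrow> complex) set" where
  "GLinf = {f \<in> Linf. \<exists>g\<in>Linf. ae_eq (\<lambda>t. f t * g t) (\<lambda>t. 1)}"

definition fourier_coeff :: "(complex \<Rightarrow> complex) \<Rightarrow> int \<Rightarrow> complex" where
  "fourier_coeff f n = (LINT t|circle_measure. f t * t powi (- n))"

definition Hp :: "real \<Rightarrow> (complex \<Rightarrow> complex) set" where
  "Hp p = {f \<in> Lp p. \<forall>n<0. fourier_coeff f n = 0}"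

definition cnj_Hp :: "real \<Rightarrow> (complex \<Rightarrow> complex) set" where
  "cnj_Hp p = {f. (\<lambda>t. cnj (f t)) \<in> Hp p}"

text \<open>
  The Riesz projection is given by its action on Fourier coefficients. An integrable function is
  determined almost everywhere by its Fourier coefficients, so the choice below is unique up to null
  sets, and it does not depend on the exponent of the space in which \<open>f\<close> is considered. Existence is
  the theorem of M. Riesz when \<open>f\<close> is in \<open>Lp p\<close> with \<open>1 < p\<close>; for other \<open>f\<close> the value
  may be meaningless.
\<close>

definition riesz_proj :: "(complex \<Rightarrow> complex) \<Rightarrow> complex \<Rightarrow> complex" where
  "riesz_proj f = (SOME g. integrable circle_measure g \<and>
     (\<forall>n. fourier_coeff g n = (if n \<ge> 0 then fourier_coeff f n else 0)))"

definition flip :: "(complex \<Rightarrow> complex) \<Rightarrow> complex \<Rightarrow> complex" where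
  "flip f = (\<lambda>t. inverse t * f (inverse t))"

definition toeplitz :: "(complex \<Rightarrow> complex) \<Rightarrow> (complex \<Rightarrow> complex) \<Rightarrow> complex \<Rightarrow> complex" where
  "toeplitz \<phi> f = riesz_proj (\<lambda>t. \<phi> t * f t)"

definition hankel :: "(complex \<Rightarrow> complex) \<Rightarrow> (complex \<Rightarrow> complex) \<Rightarrow> complex \<Rightarrow> complex" where
  "hankel \<phi> f = riesz_proj (\<lambda>t. \<phi> t * flip f t)"

definition toeplitz_plus_hankel ::
  "(complex \<Rightarrow> complex) \<Rightarrow> (complex \<Rightarrow> complex) \<Rightarrow> complex \<Rightarrow> complex" where
  "toeplitz_plus_hankel \<phi> f = (\<lambda>t. toeplitz \<phi> f t + hankel \<phi> f t)"

text \<open>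
  Bounded linear operators between subspaces \<open>U\<close> and \<open>V\<close> of \<open>Lp p\<close>. Linearity up to null sets
  together with the norm bound forces the operator to respect almost everywhere equality.
\<close>

definition bounded_operator ::
  "real \<Rightarrow> (complex \<Rightarrow> complex) set \<Rightarrow> (complex \<Rightarrow> complex) set \<Rightarrow>
   ((complex \<Rightarrow> complex) \<Rightarrow> complex \<Rightarrow> complex) \<Rightarrow> bool" where
  "bounded_operator p U V A \<longleftrightarrow>
     (\<forall>f\<in>U. A f \<in> V) \<and>
     (\<forall>f\<in>U. \<forall>g\<in>U. ae_eq (A (\<lambda>t. f t + g t)) (\<lambda>t. A f t + A g t)) \<and>
     (\<forall>f\<in>U. \<forall>c. ae_eq (A (\<lambda>t. c * f t)) (\<lambda>t. c * A f t)) \<and>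
     (\<exists>C. \<forall>f\<in>U. Lp_norm p (A f) \<le> C * Lp_norm p f)"

definition invertible_operator ::
  "real \<Rightarrow> (complex \<Rightarrow> complex) set \<Rightarrow>
   ((complex \<Rightarrow> complex) \<Rightarrow> complex \<Rightarrow> complex) \<Rightarrow> bool" where
  "invertible_operator p U A \<longleftrightarrow>
     bounded_operator p U U A \<and>
     (\<exists>S. bounded_operator p U U S \<and> (\<forall>f\<in>U. ae_eq (S (A f)) f \<and> ae_eq (A (S f)) f))"

definition Lp_even :: "real \<Rightarrow> (complex \<Rightarrow> complex) set" where
  "Lp_even p = {f \<in> Lp p. ae_eq f (\<lambda>t. f (inverse t))}"

definition Lp_J :: "real \<Rightarrow> (complex \<Rightarrow> complex) set" where
  "Lp_J p = {f \<in> Lp p. ae_eq (flip f) f}"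

definition trig_polys :: "(complex \<Rightarrow> complex) set" where
  "trig_polys = {f. \<exists>(N :: int set) c. finite N \<and> f = (\<lambda>t. \<Sum>n\<in>N. c n * t powi n)}"

definition X1 :: "(complex \<Rightarrow> complex) set" where
  "X1 = {(\<lambda>t. (1 - inverse t) * f t) | f. f \<in> trig_polys}"

definition X2 :: "(complex \<Rightarrow> complex) \<Rightarrow> (complex \<Rightarrow> complex) set" where
  "X2 \<phi>\<^sub>0 = {(\<lambda>t. (1 + inverse t) * inverse (\<phi>\<^sub>0 t) * f t) | f.
      f \<in> trig_polys \<and> (\<forall>t\<in>sphere 0 1. f t = f (inverse t))}"

definition B_op ::
  "(complex \<Rightarrow> complex) \<Rightarrow> (complex \<Rightarrow> complex) \<Rightarrow> (complex \<Rightarrow> complex) \<Rightarrow> complex \<Rightarrow> complex" where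
  "B_op \<phi>\<^sub>m \<phi>\<^sub>0 f =
     (let g = riesz_proj (\<lambda>t. inverse (\<phi>\<^sub>m t) * f t)
      in (\<lambda>t. inverse (\<phi>\<^sub>0 t) * (g t + flip g t)))"

text \<open>
  Asymmetric factorization in \<open>Lp p\<close> with index \<open>\<kappa>\<close>; \<open>q\<close> is the conjugate exponent and
  \<open>\<phi>\<^sub>m\<close> is the factor \<open>\<phi>\<^sub>-\<close>. As \<open>\<phi>\<close> is nonzero almost everywhere, so are \<open>\<phi>\<^sub>m\<close> and \<open>\<phi>\<^sub>0\<close>, and the
  convention \<open>inverse 0 = 0\<close> only plays a role on a null set.
\<close>

definition asymmetric_factorization ::
  "real \<Rightarrow> real \<Rightarrow> (complex \<Rightarrow> complex) \<Rightarrow> int \<Rightarrow> bool" where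
  "asymmetric_factorization p q \<phi> \<kappa> \<longleftrightarrow>
     (\<exists>\<phi>\<^sub>m \<phi>\<^sub>0.
        ae_eq \<phi> (\<lambda>t. \<phi>\<^sub>m t * t powi \<kappa> * \<phi>\<^sub>0 t) \<and>
        (\<lambda>t. (1 + inverse t) * \<phi>\<^sub>m t) \<in> cnj_Hp p \<and>
        (\<lambda>t. (1 - inverse t) * inverse (\<phi>\<^sub>m t)) \<in> cnj_Hp q \<and>
        (\<lambda>t. of_real (norm (1 - t)) * \<phi>\<^sub>0 t) \<in> Lp_even q \<and>
        (\<lambda>t. of_real (norm (1 + t)) * inverse (\<phi>\<^sub>0 t)) \<in> Lp_even p \<and>
        (\<forall>f\<in>X1. \<exists>g\<in>X2 \<phi>\<^sub>0. ae_eq (B_op \<phi>\<^sub>m \<phi>\<^sub>0 f) g) \<and>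
        (\<exists>A. bounded_operator p (Lp p) (Lp_J p) A \<and>
             (\<forall>f\<in>X1. ae_eq (A f) (B_op \<phi>\<^sub>m \<phi>\<^sub>0 f))))"

end

theory Submission
  imports Defs "HOL-Complex_Analysis.Complex_Analysis"
begin

text \<open>
  As \<open>J P J = I - P\<close>, the map \<open>I + J\<close> identifies \<open>H\<^sup>p\<close> with \<open>L\<^sup>p\<^sub>J\<close>, with inverse \<open>P\<close>, and turns
  \<open>M(\<phi>) = P \<phi> (I + J)\<close> into \<open>g \<mapsto> P (\<phi> g)\<close> on \<open>L\<^sup>p\<^sub>J\<close>. Given a factorization, \<open>P \<phi> B f = P f\<close> for \<open>f\<close> in the dense
  set \<open>X1\<close>, because \<open>(1 + 1/t) (\<phi> B f - f)\<close> is a product of two antianalytic functions; hence the extension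
  of \<open>B\<close> is a right inverse. If \<open>P (\<phi> g) = 0\<close> with \<open>J g = g\<close>, then \<open>m = (1 - 1/t) \<phi>\<^sub>0 g = (1 - 1/t) \<phi>\<^sub>-\<^sup>-\<^sup>1 \<phi> g\<close> is
  antianalytic with mean zero and \<open>m(1/t) = - t\<^sup>2 m(t)\<close>, which forces \<open>m = 0\<close>.

  Conversely, let \<open>M(\<phi>)\<close> be invertible. Solving \<open>M(\<phi>) s = 1\<close> gives \<open>g = s + J s\<close> such that \<open>\<psi> = \<phi> g\<close> is antianalytic
  with mean one, and solving an adjoint equation gives an antianalytic \<open>\<eta>\<close> in \<open>L\<^sup>q\<close> with mean one such that \<open>x = \<phi> \<eta>\<close>
  satisfies \<open>J x = - x\<close>. The symmetries of \<open>g\<close> and \<open>x\<close> determine the product: \<open>\<psi> \<eta> = g x = 1 - t\<^sup>-\<^sup>2\<close>. So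
  \<open>\<phi>\<^sub>- = \<psi> / (1 + 1/t)\<close> and \<open>\<phi>\<^sub>0 = (1 + 1/t) / g\<close> have the required properties.

  The boundedness of \<open>P\<close> on \<open>L\<^sup>p\<close> is obtained for \<open>1 < p \<le> 2\<close> from the mean value of \<open>F\<^sup>p\<close>, where \<open>F\<close> is the analytic
  completion of a positive trigonometric polynomial, and for \<open>p > 2\<close> by duality.
\<close>

section \<open>Spaces of p-integrable functions\<close>

text \<open>The obstacle is that neither factor nor its inverse need be bounded, and dividing by 1 +
  1/t can leave \<open>L^p\<close>. In the argument for B this division is replaced by coefficients:
  if (1 + 1/t) D has none of index >= 0, then those of D alternate in sign from 0 on, hence have
  constant modulus, and Riemann-Lebesgue makes them zero. The value 1 - 1/t^2 is dictated by
  symmetry: m(1/t) = - t^2 m(t) says that the coefficients at n and -n-2 are opposite. An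
  antianalytic m with mean one then has coefficient -1 at -2, zero at the fixed index -1, and no
  others. The adjoint of M is never formed. A functional on \<open>L^p\<close> built from the
  inverse of M is represented by some Y in \<open>L^q\<close>, and eta = 1 + Y/t. Since
  \<open>riesz_proj\<close> is a choice pinned down by coefficients, identities are proved
  coefficientwise and become equalities almost everywhere by uniqueness.\<close>

definition Lspace :: "real \<Rightarrow> 'a measure \<Rightarrow> ('a \<Rightarrow> complex) set" where
  "Lspace p M = {f \<in> borel_measurable M. integrable M (\<lambda>x. norm (f x) powr p)}"

text \<open>The p-th power of the norm. Without the root, estimates scale by
  \<open>norm c powr p\<close> and add up to a factor 2^p, so Minkowski's inequality is avoided;
  only boundedness and convergence to zero matter, and these are the same with or without the
  root.\<close>

definition Lint :: "real \<Rightarrow> 'a measure \<Rightarrow> ('a \<Rightarrow> complex) \<Rightarrow> real" where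
  "Lint p M f = (LINT x|M. norm (f x) powr p)"

lemma LspaceI:
  "f \<in> borel_measurable M \<Longrightarrow> integrable M (\<lambda>x. norm (f x) powr p) \<Longrightarrow> f \<in> Lspace p M"
  by (simp add: Lspace_def)

lemma Lspace_measurable[measurable_dest]: "f \<in> Lspace p M \<Longrightarrow> f \<in> borel_measurable M"
  by (simp add: Lspace_def)

lemma Lspace_integrable: "f \<in> Lspace p M \<Longrightarrow> integrable M (\<lambda>x. norm (f x) powr p)"
  by (simp add: Lspace_def)

lemma Lint_nonneg [simp]: "0 \<le> Lint p M f"
  unfolding Lint_def by (intro integral_nonneg_AE) auto

text \<open>The substitute for the triangle inequality, from a + b <= 2 max(a, b). The constant 2^p
  reappears in every later norm estimate.\<close>

lemma powr_add_le:
  fixes a b p :: real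
  assumes "0 \<le> a" "0 \<le> b" "0 \<le> p"
  shows "(a + b) powr p \<le> 2 powr p * (a powr p + b powr p)"
proof -
  have "(a + b) powr p \<le> (2 * max a b) powr p"
    using assms by (intro powr_mono2) auto
  also have "\<dots> = 2 powr p * max a b powr p" using assms by (simp add: powr_mult)
  also have "max a b powr p \<le> a powr p + b powr p" by (simp add: max_def)
  finally show ?thesis by simp
qed

lemma norm_add_powr_le:
  fixes x y :: "'a::real_normed_vector"
  assumes "0 \<le> p"
  shows "norm (x + y) powr p \<le> 2 powr p * (norm x powr p + norm y powr p)"
  using powr_mono2[OF assms norm_ge_zero norm_triangle_ineq] powr_add_le[of "norm x" "norm y" p] assms
  by (meson norm_ge_zero order.trans)

lemma Lspace_dominated:
  assumes "f \<in> borel_measurable M" "integrable M w" "AE x in M. norm (f x) powr p \<le> w x"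
  shows "f \<in> Lspace p M"
proof (rule LspaceI)
  show "integrable M (\<lambda>x. norm (f x) powr p)"
    by (rule Bochner_Integration.integrable_bound[OF assms(2)]) (use assms in auto)
qed fact

lemma Lspace_add:
  assumes "0 \<le> p" "f \<in> Lspace p M" "g \<in> Lspace p M"
  shows "(\<lambda>x. f x + g x) \<in> Lspace p M"
    and "Lint p M (\<lambda>x. f x + g x) \<le> 2 powr p * (Lint p M f + Lint p M g)"
proof -
  have i: "integrable M (\<lambda>x. 2 powr p * (norm (f x) powr p + norm (g x) powr p))"
    using assms by (auto simp: Lspace_def)
  show *: "(\<lambda>x. f x + g x) \<in> Lspace p M"
    by (rule Lspace_dominated[OF _ i])
      (use assms in \<open>auto intro!: norm_add_powr_le simp: Lspace_def\<close>)
  have "Lint p M (\<lambda>x. f x + g x) \<le> (LINT x|M. 2 powr p * (norm (f x) powr p + norm (g x) powr p))"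
    unfolding Lint_def using * i assms by (intro integral_mono norm_add_powr_le) (auto simp: Lspace_def)
  also have "\<dots> = 2 powr p * (Lint p M f + Lint p M g)"
    using assms by (simp add: Lint_def Lspace_def)
  finally show "Lint p M (\<lambda>x. f x + g x) \<le> 2 powr p * (Lint p M f + Lint p M g)" .
qed

lemma Lspace_scale: "f \<in> Lspace p M \<Longrightarrow> (\<lambda>x. c * f x) \<in> Lspace p M"
  by (auto simp: Lspace_def norm_mult powr_mult)

lemma Lint_scale: "Lint p M (\<lambda>x. c * f x) = norm c powr p * Lint p M f"
  by (simp add: Lint_def norm_mult powr_mult)

lemma Lspace_uminus: "f \<in> Lspace p M \<Longrightarrow> (\<lambda>x. - f x) \<in> Lspace p M"
  by (auto simp: Lspace_def)

lemma Lint_uminus [simp]: "Lint p M (\<lambda>x. - f x) = Lint p M f"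
  by (simp add: Lint_def)

lemma Lint_minus_commute: "Lint p M (\<lambda>x. f x - g x) = Lint p M (\<lambda>x. g x - f x)"
  by (simp add: Lint_def norm_minus_commute)

lemma Lspace_diff:
  assumes "0 \<le> p" "f \<in> Lspace p M" "g \<in> Lspace p M"
  shows "(\<lambda>x. f x - g x) \<in> Lspace p M"
    and "Lint p M (\<lambda>x. f x - g x) \<le> 2 powr p * (Lint p M f + Lint p M g)"
  using Lspace_add[OF assms(1,2) Lspace_uminus[OF assms(3)]] by simp_all

lemma borel_measurable_cnj [measurable (raw)]:
  "f \<in> borel_measurable M \<Longrightarrow> (\<lambda>x. cnj (f x)) \<in> borel_measurable M"
  by (rule borel_measurable_continuous_on[OF _, of cnj]) (auto intro: continuous_intros)

lemma Lint_le_Lint_diff: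
  assumes "0 \<le> p" "f \<in> Lspace p M" "g \<in> Lspace p M"
  shows "Lint p M f \<le> 2 powr p * (Lint p M (\<lambda>x. f x - g x) + Lint p M g)"
  using Lspace_add(2)[OF assms(1) Lspace_diff(1)[OF assms] assms(3)] by simp

lemma Lspace_cnj: "f \<in> Lspace p M \<Longrightarrow> (\<lambda>x. cnj (f x)) \<in> Lspace p M"
  by (auto simp: Lspace_def)

lemma Lint_cnj [simp]: "Lint p M (\<lambda>x. cnj (f x)) = Lint p M f"
  by (simp add: Lint_def)

lemma Lspace_mult_bounded:
  assumes "0 \<le> p" "0 \<le> C" "f \<in> Lspace p M" "g \<in> borel_measurable M" "AE x in M. norm (g x) \<le> C"
  shows "(\<lambda>x. g x * f x) \<in> Lspace p M"
    and "Lint p M (\<lambda>x. g x * f x) \<le> C powr p * Lint p M f"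
proof -
  have b: "AE x in M. norm (g x * f x) powr p \<le> C powr p * norm (f x) powr p"
    using assms(5) by eventually_elim
      (use assms in \<open>auto simp: norm_mult powr_mult intro!: mult_right_mono powr_mono2\<close>)
  have i: "integrable M (\<lambda>x. C powr p * norm (f x) powr p)" using assms by (auto simp: Lspace_def)
  have [measurable]: "f \<in> borel_measurable M" "g \<in> borel_measurable M" using assms by (auto simp: Lspace_def)
  show *: "(\<lambda>x. g x * f x) \<in> Lspace p M" by (rule Lspace_dominated[OF _ i b]) auto
  have "Lint p M (\<lambda>x. g x * f x) \<le> (LINT x|M. C powr p * norm (f x) powr p)"
    unfolding Lint_def using b * i by (intro integral_mono_AE) (auto simp: Lspace_def)
  then show "Lint p M (\<lambda>x. g x * f x) \<le> C powr p * Lint p M f" by (simp add: Lint_def)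
qed

lemma Lspace_cong_AE:
  assumes "f \<in> Lspace p M" "g \<in> borel_measurable M" "AE x in M. f x = g x"
  shows "g \<in> Lspace p M" and "Lint p M g = Lint p M f"
proof -
  have [measurable]: "f \<in> borel_measurable M" "g \<in> borel_measurable M" using assms by (auto simp: Lspace_def)
  have *: "AE x in M. norm (g x) powr p = norm (f x) powr p" using assms(3) by eventually_elim auto
  show "g \<in> Lspace p M"
    by (rule Lspace_dominated[OF assms(2) Lspace_integrable[OF assms(1)]]) (use * in auto)
  show "Lint p M g = Lint p M f" unfolding Lint_def by (rule integral_cong_AE) (use * in auto)
qed

lemma Lspace_norm_cong:
  assumes "f \<in> Lspace p M" "g \<in> borel_measurable M" "AE t in M. norm (g t) = norm (f t)"
  shows "g \<in> Lspace p M"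
  by (rule Lspace_dominated[OF assms(2) Lspace_integrable[OF assms(1)]]) (use assms(3) in \<open>auto elim!: eventually_mono\<close>)

lemma Lint_eq_0_AE:
  assumes "f \<in> Lspace p M" "Lint p M f = 0"
  shows "AE x in M. f x = 0"
proof -
  have "AE x in M. norm (f x) powr p = 0"
    using integral_nonneg_eq_0_iff_AE[OF Lspace_integrable[OF assms(1)]] assms(2)
    by (auto simp: Lint_def)
  then show ?thesis by eventually_elim auto
qed

lemma (in finite_measure) Lspace_bounded:
  assumes "f \<in> borel_measurable M" "AE x in M. norm (f x) \<le> C" "0 \<le> p"
  shows "f \<in> Lspace p M"
proof (rule Lspace_dominated[OF assms(1)])
  show "integrable M (\<lambda>x. C powr p)" by simp
  show "AE x in M. norm (f x) powr p \<le> C powr p"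
    using assms(2) by eventually_elim (use assms(3) in \<open>auto intro: powr_mono2\<close>)
qed

lemma (in finite_measure) Lspace_mono:
  assumes "f \<in> Lspace p M" "0 \<le> r" "r \<le> p"
  shows "f \<in> Lspace r M"
proof (rule Lspace_dominated)
  show "integrable M (\<lambda>x. 1 + norm (f x) powr p)" using assms by (auto simp: Lspace_def)
  have "y powr r \<le> 1 + y powr p" if "0 \<le> y" for y :: real
  proof (cases "y \<le> 1")
    case True
    then have "y powr r \<le> 1" using that assms by (intro powr_le1) auto
    then show ?thesis by (smt (verit) powr_ge_zero)
  next
    case False
    then have "y powr r \<le> y powr p" using assms by (intro powr_mono) auto
    then show ?thesis by simp
  qed
  then show "AE x in M. norm (f x) powr r \<le> 1 + norm (f x) powr p" by simp
qed (use assms in \<open>auto simp: Lspace_def\<close>)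

lemma (in finite_measure) Lspace_integrable1:
  assumes "f \<in> Lspace p M" "1 \<le> p"
  shows "integrable M f"
proof -
  have "f \<in> Lspace 1 M" using Lspace_mono[OF assms(1), of 1] assms by auto
  then show ?thesis by (auto simp: Lspace_def integrable_norm_iff)
qed

section \<open>Hoelder's inequality, convergence and completeness\<close>

lemma conjugate_exponent_gt_1:
  fixes p q :: real
  assumes "1 < p" "1 / p + 1 / q = 1"
  shows "1 < q"
proof -
  have "1 / q = 1 - 1 / p" "1 / p < 1" "0 < 1 / p" using assms by auto
  then have "0 < 1 / q" "1 / q < 1" by linarith+
  then show ?thesis by (simp add: field_simps split: if_splits)
qed

lemma Holder:
  assumes p: "1 < p" "1 / p + 1 / q = 1" and f: "f \<in> Lspace p M" and g: "g \<in> Lspace q M"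
  shows "integrable M (\<lambda>x. f x * g x)"
    and "norm (LINT x|M. f x * g x) \<le> Lint p M f powr (1 / p) * Lint q M g powr (1 / q)"
proof -
  have q: "1 < q" by (rule conjugate_exponent_gt_1[OF p])
  have [measurable]: "f \<in> borel_measurable M" "g \<in> borel_measurable M" using f g by (auto simp: Lspace_def)
  have yo: "norm (u * v) \<le> norm u powr p / p + norm v powr q / q" for u v :: complex
    using Youngs_inequality[OF p(1) q p(2), of "norm u" "norm v"] by (simp add: norm_mult)
  have i: "integrable M (\<lambda>x. norm (f x) powr p / p + norm (g x) powr q / q)"
    using f g by (auto simp: Lspace_def)
  have int: "integrable M (\<lambda>x. f x * g x)" if "f \<in> Lspace p M" "g \<in> Lspace q M" for f g
  proof (rule Bochner_Integration.integrable_bound)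
    show "integrable M (\<lambda>x. norm (f x) powr p / p + norm (g x) powr q / q)"
      using that by (auto simp: Lspace_def)
    show "AE x in M. norm (f x * g x) \<le> norm (norm (f x) powr p / p + norm (g x) powr q / q)"
      by (intro AE_I2 order_trans[OF yo]) auto
  qed (use that in \<open>auto simp: Lspace_def\<close>)
  show fg: "integrable M (\<lambda>x. f x * g x)" by (rule int[OF f g])
  define a where "a = Lint p M f powr (1 / p)"
  define b where "b = Lint q M g powr (1 / q)"
  consider "a = 0" | "b = 0" | "a > 0" "b > 0" unfolding a_def b_def by fastforce
  then show "norm (LINT x|M. f x * g x) \<le> Lint p M f powr (1 / p) * Lint q M g powr (1 / q)"
  proof cases
    case 1
    then have "AE x in M. f x * g x = 0"
      using Lint_eq_0_AE[OF f] by (auto simp: a_def elim!: eventually_mono)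
    then have "(LINT x|M. f x * g x) = 0" by (simp add: integral_eq_zero_AE)
    then show ?thesis by simp
  next
    case 2
    then have "AE x in M. f x * g x = 0"
      using Lint_eq_0_AE[OF g] by (auto simp: b_def elim!: eventually_mono)
    then have "(LINT x|M. f x * g x) = 0" by (simp add: integral_eq_zero_AE)
    then show ?thesis by simp
  next
    case 3
    \<comment> \<open>Scaled to norm one, the two functions make the integrated Young inequality end
      in 1/p + 1/q = 1. The two cases above are those where the scaling is impossible.\<close>
    let ?f = "\<lambda>x. of_real (1/a) * f x" and ?g = "\<lambda>x. of_real (1/b) * g x"
    have m: "?f \<in> Lspace p M" "?g \<in> Lspace q M" using f g by (intro Lspace_scale; simp)+
    have ap: "a powr p = Lint p M f" and bq: "b powr q = Lint q M g"
      using p q by (simp_all add: a_def b_def powr_powr)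
    have 1: "Lint p M ?f = 1" "Lint q M ?g = 1"
      using 3 unfolding Lint_scale by (simp_all add: powr_divide norm_divide ap[symmetric] bq[symmetric])
    have "norm (LINT x|M. ?f x * ?g x) \<le> (LINT x|M. norm (?f x) powr p / p + norm (?g x) powr q / q)"
    proof (rule order_trans[OF integral_norm_bound integral_mono])
      show "integrable M (\<lambda>x. norm (?f x) powr p / p + norm (?g x) powr q / q)"
        using m by (intro Bochner_Integration.integrable_add) (auto simp: Lspace_def)
    qed (use int[OF m] in \<open>simp_all only: yo integrable_norm\<close>)
    also have "\<dots> = Lint p M ?f / p + Lint q M ?g / q"
      using m unfolding Lint_def by (subst Bochner_Integration.integral_add) (auto simp: Lspace_def)
    also have "\<dots> = 1" using 1 p by simp
    finally have "norm (LINT x|M. ?f x * ?g x) \<le> 1" .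
    moreover have "(LINT x|M. ?f x * ?g x) = of_real (1 / (a * b)) * (LINT x|M. f x * g x)"
      unfolding integral_mult_right_zero[symmetric] by (rule Bochner_Integration.integral_cong) auto
    ultimately show ?thesis using 3 by (simp add: norm_mult field_simps a_def[symmetric] b_def[symmetric] norm_divide)
  qed
qed

text \<open>The factor 2 is the one that comes with the simple functions of
  \<open>borel_measurable_implies_sequence_metric\<close>; it makes 3^p |f|^p a majorant of the p-th
  power of the difference.\<close>

lemma Lint_dominated_convergence:
  assumes "0 < p" "f \<in> Lspace p M" "\<And>n. s n \<in> borel_measurable M"
    "AE x in M. (\<lambda>n. s n x) \<longlonglongrightarrow> f x" "\<And>n. AE x in M. norm (s n x) \<le> 2 * norm (f x)"
  shows "(\<lambda>n. Lint p M (\<lambda>x. s n x - f x)) \<longlonglongrightarrow> 0" "\<And>n. s n \<in> Lspace p M"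
proof -
  have [measurable]: "f \<in> borel_measurable M" "\<And>n. s n \<in> borel_measurable M" using assms by (auto simp: Lspace_def)
  have i: "integrable M (\<lambda>x. 3 powr p * norm (f x) powr p)" using assms by (auto simp: Lspace_def)
  have "(\<lambda>n. Lint p M (\<lambda>x. s n x - f x)) \<longlonglongrightarrow> (LINT x|M. 0)"
    unfolding Lint_def
  proof (rule integral_dominated_convergence[OF _ _ i])
    show "AE x in M. (\<lambda>n. norm (s n x - f x) powr p) \<longlonglongrightarrow> 0"
      using assms(4)
    proof eventually_elim
      case (elim x)
      have "(\<lambda>n. norm (s n x - f x) powr p) \<longlonglongrightarrow> 0 powr p"
        using elim assms(1) by (intro tendsto_powr') (auto simp: LIM_zero_iff tendsto_norm_zero)
      then show ?case using assms(1) by simp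
    qed
    fix n
    show "AE x in M. norm (norm (s n x - f x) powr p) \<le> 3 powr p * norm (f x) powr p"
      using assms(5)[of n]
    proof eventually_elim
      case (elim x)
      have "norm (s n x - f x) \<le> 3 * norm (f x)" using elim norm_triangle_ineq4[of "s n x" "f x"] by linarith
      then have "norm (s n x - f x) powr p \<le> (3 * norm (f x)) powr p" using assms(1) by (intro powr_mono2) auto
      then show ?case by (simp add: powr_mult)
    qed
  qed auto
  then show "(\<lambda>n. Lint p M (\<lambda>x. s n x - f x)) \<longlonglongrightarrow> 0" by simp
  fix n
  show "s n \<in> Lspace p M"
  proof (rule Lspace_dominated)
    show "integrable M (\<lambda>x. 2 powr p * norm (f x) powr p)" using assms by (auto simp: Lspace_def)
    show "AE x in M. norm (s n x) powr p \<le> 2 powr p * norm (f x) powr p"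
      using assms(5)[of n]
    proof eventually_elim
      case (elim x)
      then have "norm (s n x) powr p \<le> (2 * norm (f x)) powr p" using assms(1) by (intro powr_mono2) auto
      then show ?case by (simp add: powr_mult)
    qed
  qed auto
qed

lemma tendsto_powr_0:
  fixes a :: "nat \<Rightarrow> real"
  assumes "a \<longlonglongrightarrow> 0" "0 < r" "\<And>n. 0 \<le> a n"
  shows "(\<lambda>n. a n powr r) \<longlonglongrightarrow> 0"
proof -
  have "(\<lambda>n. a n powr r) \<longlonglongrightarrow> 0 powr r"
    using assms by (intro tendsto_powr') auto
  then show ?thesis using assms by simp
qed

lemma tendsto_Lint_integral:
  assumes p: "1 < p" "1 / p + 1 / q = 1" and "\<And>n. s n \<in> Lspace p M" "f \<in> Lspace p M"
    "(\<lambda>n. Lint p M (\<lambda>x. s n x - f x)) \<longlonglongrightarrow> 0" "g \<in> Lspace q M"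
  shows "(\<lambda>n. LINT x|M. s n x * g x) \<longlonglongrightarrow> (LINT x|M. f x * g x)"
proof (rule LIM_zero_cancel, rule Lim_null_comparison)
  have d: "(\<lambda>x. s n x - f x) \<in> Lspace p M" for n using assms by (intro Lspace_diff) auto
  show "\<forall>\<^sub>F n in sequentially. norm ((LINT x|M. s n x * g x) - (LINT x|M. f x * g x))
      \<le> Lint p M (\<lambda>x. s n x - f x) powr (1/p) * Lint q M g powr (1/q)"
    using Holder(2)[OF p d assms(6)] Holder(1)[OF p assms(3) assms(6)] Holder(1)[OF p assms(4) assms(6)]
    by (intro always_eventually allI) (simp add: left_diff_distrib)
  show "(\<lambda>n. Lint p M (\<lambda>x. s n x - f x) powr (1/p) * Lint q M g powr (1/q)) \<longlonglongrightarrow> 0"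
    using p by (intro tendsto_mult_left_zero tendsto_powr_0[OF assms(5)]) auto
qed

lemma AE_summable_of_integrals:
  fixes h :: "nat \<Rightarrow> 'a \<Rightarrow> real"
  assumes "\<And>n. integrable M (h n)" "\<And>n x. 0 \<le> h n x" "summable (\<lambda>n. LINT x|M. h n x)"
  shows "AE x in M. summable (\<lambda>n. h n x)"
proof -
  have [measurable]: "h n \<in> borel_measurable M" for n using assms(1) by auto
  have "(\<integral>\<^sup>+x. (\<Sum>n. ennreal (h n x)) \<partial>M) = (\<Sum>n. \<integral>\<^sup>+x. ennreal (h n x) \<partial>M)"
    by (rule nn_integral_suminf) auto
  also have "\<dots> = (\<Sum>n. ennreal (LINT x|M. h n x))"
    using assms by (intro suminf_cong nn_integral_eq_integral) auto
  also have "\<dots> \<noteq> \<infinity>"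
    using assms by (simp add: ennreal_suminf_neq_top integral_nonneg_AE)
  finally have "AE x in M. (\<Sum>n. ennreal (h n x)) \<noteq> \<infinity>"
    by (intro nn_integral_noteq_infinite) auto
  then show ?thesis
    by eventually_elim (use assms(2) in \<open>auto intro: summable_suminf_not_top\<close>)
qed

text \<open>Rapid convergence makes the dominating function \<open>(\<Sum>n. 2 ^ (p * n) * |f (n + 1) - f n| ^ p)\<close> integrable.\<close>

lemma Lspace_complete:
  fixes f :: "nat \<Rightarrow> 'a \<Rightarrow> complex"
  assumes p: "0 < p" and f: "\<And>n. f n \<in> Lspace p M"
    and fast: "\<And>n. Lint p M (\<lambda>x. f (Suc n) x - f n x) \<le> B * (2 powr (-p) / 2) ^ n"
  obtains g where "g \<in> Lspace p M" "(\<lambda>n. Lint p M (\<lambda>x. f n x - g x)) \<longlonglongrightarrow> 0"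
proof -
  define h where "h = (\<lambda>n x. (2 powr p) ^ n * norm (f (Suc n) x - f n x) powr p)"
  have [measurable]: "f n \<in> borel_measurable M" for n using f by (auto simp: Lspace_def)
  have d: "(\<lambda>x. f (Suc n) x - f n x) \<in> Lspace p M" for n using p by (intro Lspace_diff f) auto
  have hi: "integrable M (h n)" for n using d[of n] by (auto simp: h_def Lspace_def)
  have h0: "0 \<le> h n x" for n x by (simp add: h_def)
  have hb: "(LINT x|M. h n x) \<le> B * (1/2) ^ n" for n
  proof -
    have "(LINT x|M. h n x) = (2 powr p) ^ n * Lint p M (\<lambda>x. f (Suc n) x - f n x)"
      by (simp add: h_def Lint_def)
    also have "\<dots> \<le> (2 powr p) ^ n * (B * (2 powr (-p) / 2) ^ n)"
      by (intro mult_left_mono fast) auto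
    also have "\<dots> = B * (1/2) ^ n" by (simp add: powr_minus field_simps)
    finally show ?thesis .
  qed
  have sm: "summable (\<lambda>n. LINT x|M. h n x)"
    by (rule summable_comparison_test'[of "\<lambda>n. B * (1/2)^n" 0])
      (use hb h0 in \<open>auto simp: integral_nonneg_AE intro!: summable_mult\<close>)
  have AEs: "AE x in M. summable (\<lambda>n. h n x)" by (rule AE_summable_of_integrals[OF hi h0 sm])
  define S where "S x = (\<Sum>n. h n x)" for x
  have Si: "integrable M S"
    unfolding S_def by (rule integrable_suminf[OF hi]) (use AEs h0 sm in auto)
  define g where "g x = lim (\<lambda>n. f n x)" for x
  have [measurable]: "g \<in> borel_measurable M" unfolding g_def by measurable
  have bound: "norm (f n x - g x) powr p \<le> 2 powr p * (2 powr (-p)) ^ n * S x"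
    if s: "summable (\<lambda>n. h n x)" for n x
  proof -
    define R where "R = S x powr (1/p)"
    have S0: "0 \<le> S x" unfolding S_def by (intro suminf_nonneg s h0)
    have R0: "0 \<le> R" by (simp add: R_def)
    \<comment> \<open>A single term of the series is at most its sum, so after taking p-th roots the
      increments at x decay like (1/2)^n.\<close>
    have step: "norm (f (Suc n) x - f n x) \<le> R * (1/2) ^ n" for n
    proof -
      have "h n x \<le> S x" unfolding S_def using sum_le_suminf[OF s, of "{n}"] h0 by auto
      moreover have "(2 powr p) ^ n = ((2::real) ^ n) powr p"
        by (simp add: powr_powr powr_power powr_realpow[symmetric] mult.commute)
      ultimately have "((2::real) ^ n * norm (f (Suc n) x - f n x)) powr p \<le> S x"
        by (simp add: h_def powr_mult)
      then have "(((2::real) ^ n * norm (f (Suc n) x - f n x)) powr p) powr (1/p) \<le> R"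
        unfolding R_def using p by (intro powr_mono2) auto
      then have "(2::real) ^ n * norm (f (Suc n) x - f n x) \<le> R" using p by (simp add: powr_powr)
      then show ?thesis by (simp add: field_simps)
    qed
    \<comment> \<open>The factor 1 - (1/2)^k is the exact geometric partial sum; it is what lets the
      induction on k close.\<close>
    have tail: "norm (f (n + k) x - f n x) \<le> 2 * R * (1/2)^n * (1 - (1/2) ^ k)" for n k
    proof (induction k)
      case (Suc k)
      have "norm (f (n + Suc k) x - f n x) \<le> norm (f (Suc (n + k)) x - f (n + k) x) + norm (f (n + k) x - f n x)"
        using norm_triangle_ineq[of "f (Suc (n + k)) x - f (n + k) x" "f (n + k) x - f n x"] by simp
      also have "\<dots> \<le> R * (1/2) ^ (n + k) + 2 * R * (1/2)^n * (1 - (1/2) ^ k)"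
        by (intro add_mono step Suc)
      finally show ?case by (simp add: power_add algebra_simps)
    qed simp
    have tail': "norm (f m x - f n x) \<le> 2 * R * (1/2)^n" if "n \<le> m" for n m
    proof -
      have "norm (f m x - f n x) \<le> 2 * R * (1/2)^n * (1 - (1/2) ^ (m - n))" using tail[of n "m - n"] that by simp
      also have "\<dots> \<le> 2 * R * (1/2)^n * 1" using R0 by (intro mult_left_mono) auto
      finally show ?thesis by simp
    qed
    have "Cauchy (\<lambda>n. f n x)"
    proof (rule CauchyI')
      fix e :: real assume "0 < e"
      have "(\<lambda>n. 2 * R * (1/2)^n) \<longlonglongrightarrow> 0" by (intro tendsto_mult_right_zero LIMSEQ_power_zero) auto
      then obtain N where N: "2 * R * (1/2)^N < e / 2"
        using \<open>0 < e\<close>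
        by (metis (no_types, lifting) eventually_sequentially order.refl order_tendstoD(2) half_gt_zero)
      show "\<exists>M. \<forall>m\<ge>M. \<forall>n>m. dist (f m x) (f n x) < e"
      proof (intro exI[of _ N] allI impI)
        fix m n assume "N \<le> m" "m < n"
        then show "dist (f m x) (f n x) < e"
          using tail'[of N m] tail'[of N n] dist_triangle2[of "f m x" "f n x" "f N x"] N
          by (auto simp: dist_norm)
      qed
    qed
    then have lim: "(\<lambda>n. f n x) \<longlonglongrightarrow> g x"
      unfolding g_def using Cauchy_convergent convergent_LIMSEQ_iff by blast
    have "norm (g x - f n x) \<le> 2 * R * (1/2)^n"
    proof (rule tendsto_upperbound)
      show "(\<lambda>m. norm (f m x - f n x)) \<longlonglongrightarrow> norm (g x - f n x)" using lim by (intro tendsto_intros)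
      show "\<forall>\<^sub>F m in sequentially. norm (f m x - f n x) \<le> 2 * R * (1/2)^n"
        using tail' by (auto simp: eventually_sequentially)
    qed auto
    then have "norm (f n x - g x) powr p \<le> (2 * R * (1/2)^n) powr p"
      using p by (intro powr_mono2) (auto simp: norm_minus_commute)
    also have "\<dots> = 2 powr p * (2 powr (-p)) ^ n * S x"
    proof -
      have "R powr p = S x" using p S0 by (simp add: R_def powr_powr)
      moreover have "((1/2)^n) powr p = (2 powr (-p)) ^ n"
        by (simp add: powr_realpow[symmetric] powr_powr powr_power powr_divide powr_minus_divide mult.commute)
      ultimately show ?thesis by (simp add: powr_mult)
    qed
    finally show ?thesis .
  qed
  have Lb: "(\<lambda>x. f n x - g x) \<in> Lspace p M" "Lint p M (\<lambda>x. f n x - g x) \<le> 2 powr p * (2 powr (-p)) ^ n * (LINT x|M. S x)" for n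
  proof -
    have i: "integrable M (\<lambda>x. 2 powr p * (2 powr (-p)) ^ n * S x)" using Si by auto
    have b: "AE x in M. norm (f n x - g x) powr p \<le> 2 powr p * (2 powr (-p)) ^ n * S x"
      using AEs by eventually_elim (rule bound)
    show *: "(\<lambda>x. f n x - g x) \<in> Lspace p M" by (rule Lspace_dominated[OF _ i b]) auto
    have "Lint p M (\<lambda>x. f n x - g x) \<le> (LINT x|M. 2 powr p * (2 powr (-p)) ^ n * S x)"
      unfolding Lint_def by (intro integral_mono_AE i b Lspace_integrable[OF *])
    then show "Lint p M (\<lambda>x. f n x - g x) \<le> 2 powr p * (2 powr (-p)) ^ n * (LINT x|M. S x)" by simp
  qed
  show ?thesis
  proof (rule that[of g])
    show "g \<in> Lspace p M" using Lspace_diff(1)[OF _ f[of 0] Lb(1)[of 0]] p by simp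
    have "2 powr (-p) < 1" using p by (simp add: powr_less_one)
    then have "(\<lambda>n. 2 powr p * (2 powr (-p)) ^ n * (LINT x|M. S x)) \<longlonglongrightarrow> 0"
      by (intro tendsto_mult_left_zero tendsto_mult_right_zero LIMSEQ_power_zero) auto
    then show "(\<lambda>n. Lint p M (\<lambda>x. f n x - g x)) \<longlonglongrightarrow> 0"
      by (rule Lim_null_comparison[rotated]) (use Lb(2) in auto)
  qed
qed

section \<open>The dual space\<close>

text \<open>The bound by a positive power of the measure does two jobs: it gives continuity at the
  empty set, hence countable additivity, and absolute continuity, so that Radon-Nikodym
  applies.\<close>

lemma (in finite_measure) set_function_density_nonneg:
  fixes \<nu> :: "'a set \<Rightarrow> real"
  assumes add: "\<And>A B. A \<in> sets M \<Longrightarrow> B \<in> sets M \<Longrightarrow> A \<inter> B = {} \<Longrightarrow> \<nu> (A \<union> B) = \<nu> A + \<nu> B"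
    and nn: "\<And>A. A \<in> sets M \<Longrightarrow> 0 \<le> \<nu> A"
    and bd: "\<And>A. A \<in> sets M \<Longrightarrow> \<nu> A \<le> K * measure M A powr r" and r: "0 < r"
  shows "\<exists>f :: 'a \<Rightarrow> real. integrable M f \<and> (\<forall>A\<in>sets M. \<nu> A = (LINT x:A|M. f x))"
proof -
  let ?N = "measure_of (space M) (sets M) (\<lambda>A. ennreal (\<nu> A))"
  have 0: "\<nu> {} = 0" using add[of "{}" "{}"] by simp
  have "countably_additive (sets M) (\<lambda>A. ennreal (\<nu> A))"
  proof (rule sets.empty_continuous_imp_countably_additive)
    show "positive (sets M) (\<lambda>A. ennreal (\<nu> A))" by (simp add: positive_def 0)
    show "additive (sets M) (\<lambda>A. ennreal (\<nu> A))" by (auto simp: additive_def add nn)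
    fix A :: "nat \<Rightarrow> 'a set"
    assume A: "range A \<subseteq> sets M" "decseq A" "(\<Inter>i. A i) = {}"
    have "(\<lambda>i. measure M (A i)) \<longlonglongrightarrow> measure M (\<Inter>i. A i)"
      using A by (intro finite_Lim_measure_decseq) auto
    then have "(\<lambda>i. measure M (A i) powr r) \<longlonglongrightarrow> 0"
      using r A by (intro tendsto_powr_0) auto
    then have "(\<lambda>i. K * measure M (A i) powr r) \<longlonglongrightarrow> 0" by (rule tendsto_mult_right_zero)
    then have "(\<lambda>i. \<nu> (A i)) \<longlonglongrightarrow> 0"
      using A by (elim Lim_null_comparison[rotated]) (auto simp: nn bd image_subset_iff)
    then show "(\<lambda>i. ennreal (\<nu> (A i))) \<longlonglongrightarrow> 0"
      using tendsto_ennrealI by fastforce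
  qed auto
  then have N: "emeasure ?N A = ennreal (\<nu> A)" if "A \<in> sets M" for A
    using that by (intro emeasure_measure_of_sigma) (auto simp: positive_def 0 sets.sigma_algebra_axioms)
  have "absolutely_continuous M ?N"
    unfolding absolutely_continuous_def
  proof
    fix A assume "A \<in> null_sets M"
    then have A: "A \<in> sets M" "measure M A = 0" by (auto simp: null_sets_def measure_def)
    then have "\<nu> A = 0" using nn[of A] bd[of A] r by auto
    then show "A \<in> null_sets ?N" using A N[of A] by (auto simp: null_sets_def)
  qed
  then obtain f where f[measurable]: "f \<in> borel_measurable M" and fN: "density M f = ?N"
    using Radon_Nikodym[of ?N] by auto
  have fA: "(\<integral>\<^sup>+x\<in>A. f x \<partial>M) = ennreal (\<nu> A)" if "A \<in> sets M" for A
    using N[OF that] that unfolding fN[symmetric] by (simp add: emeasure_density)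
  have "(\<integral>\<^sup>+x. f x \<partial>M) = (\<integral>\<^sup>+x\<in>space M. f x \<partial>M)" by (rule nn_integral_cong) (auto split: split_indicator)
  then have fin: "(\<integral>\<^sup>+x. f x \<partial>M) \<noteq> \<infinity>" using fA[of "space M"] by simp
  then have AEf: "AE x in M. f x \<noteq> \<infinity>" by (intro nn_integral_noteq_infinite) auto
  have AEf': "AE x in M. ennreal (enn2real (f x)) = f x" using AEf by eventually_elim (auto simp: less_top)
  have int: "integrable M (\<lambda>x. enn2real (f x))"
    using fin AEf' by (intro integrableI_nonneg) (auto simp: less_top nn_integral_cong_AE)
  show ?thesis
  proof (intro exI conjI ballI, rule int)
    fix A assume A[measurable]: "A \<in> sets M"
    have "ennreal (LINT x:A|M. enn2real (f x)) = (\<integral>\<^sup>+x. ennreal (indicator A x * enn2real (f x)) \<partial>M)"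
      unfolding set_lebesgue_integral_def real_scaleR_def
      by (rule nn_integral_eq_integral[symmetric])
        (use integrable_mult_indicator[OF A int] in auto)
    also have "\<dots> = (\<integral>\<^sup>+x\<in>A. f x \<partial>M)"
      using AEf' by (intro nn_integral_cong_AE) (auto split: split_indicator)
    also have "\<dots> = ennreal (\<nu> A)" by (rule fA[OF A])
    finally show "\<nu> A = (LINT x:A|M. enn2real (f x))"
      using nn[OF A] by (subst (asm) ennreal_inj)
        (auto simp: set_lebesgue_integral_def intro!: integral_nonneg_AE)
  qed
qed

text \<open>The positive part is \<open>A \<mapsto> sup {\<nu> B | B \<subseteq> A}\<close>.\<close>

lemma (in finite_measure) set_function_density:
  fixes \<nu> :: "'a set \<Rightarrow> real"
  assumes add: "\<And>A B. A \<in> sets M \<Longrightarrow> B \<in> sets M \<Longrightarrow> A \<inter> B = {} \<Longrightarrow> \<nu> (A \<union> B) = \<nu> A + \<nu> B"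
    and bd: "\<And>A. A \<in> sets M \<Longrightarrow> \<bar>\<nu> A\<bar> \<le> K * measure M A powr r" and r: "0 < r"
  shows "\<exists>f :: 'a \<Rightarrow> real. integrable M f \<and> (\<forall>A\<in>sets M. \<nu> A = (LINT x:A|M. f x))"
proof -
  define s where "s A = {B \<in> sets M. B \<subseteq> A}" for A
  define pos where "pos A = (SUP B\<in>s A. \<nu> B)" for A
  have K: "0 \<le> K * measure M A powr r" if "A \<in> sets M" for A using bd[OF that] by linarith
  have sb: "\<nu> B \<le> \<bar>K\<bar> * measure M A powr r" if "B \<in> s A" "A \<in> sets M" for A B
  proof -
    have "\<nu> B \<le> \<bar>K\<bar> * measure M B powr r"
      using bd[of B] that mult_right_mono[OF abs_ge_self, of "measure M B powr r" K] unfolding s_def by force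
    also have "\<dots> \<le> \<bar>K\<bar> * measure M A powr r"
      using that r by (intro mult_left_mono powr_mono2 finite_measure_mono) (auto simp: s_def)
    finally show ?thesis .
  qed
  have bdd: "bdd_above (\<nu> ` s A)" if "A \<in> sets M" for A using sb that by (meson bdd_aboveI2)
  have ne: "s A \<noteq> {}" for A by (auto simp: s_def)
  have 0: "\<nu> {} = 0" using add[of "{}" "{}"] by simp
  have pos_ge: "\<nu> B \<le> pos A" if "B \<in> sets M" "B \<subseteq> A" "A \<in> sets M" for A B
    unfolding pos_def by (rule cSUP_upper[OF _ bdd]) (use that in \<open>auto simp: s_def\<close>)
  have pos0: "0 \<le> pos A" if "A \<in> sets M" for A using pos_ge[of "{}" A] that 0 by auto
  have posK: "pos A \<le> \<bar>K\<bar> * measure M A powr r" if "A \<in> sets M" for A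
    unfolding pos_def by (rule cSUP_least[OF ne]) (use sb that in auto)
  have posadd: "pos (A \<union> B) = pos A + pos B" if A: "A \<in> sets M" and B: "B \<in> sets M" and AB: "A \<inter> B = {}" for A B
  proof (rule antisym)
    show "pos (A \<union> B) \<le> pos A + pos B"
      unfolding pos_def[of "A \<union> B"]
    proof (rule cSUP_least[OF ne])
      fix C assume C: "C \<in> s (A \<union> B)"
      then have "C = (C \<inter> A) \<union> (C \<inter> B)" "C \<in> sets M" by (auto simp: s_def)
      then have "\<nu> C = \<nu> (C \<inter> A) + \<nu> (C \<inter> B)" using add[of "C \<inter> A" "C \<inter> B"] A B AB by auto
      also have "\<dots> \<le> pos A + pos B" using A B \<open>C \<in> sets M\<close> by (intro add_mono pos_ge) auto
      finally show "\<nu> C \<le> pos A + pos B" .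
    qed
    \<comment> \<open>Superadditivity: for C inside A and D inside B the union is a competitor in
      the supremum over subsets of \<open>A \<union> B\<close>. The supremum is taken over C with
      \<open>pos B\<close> fixed, then over D with C fixed.\<close>
    have "pos A \<le> pos (A \<union> B) - pos B"
      unfolding pos_def[of A]
    proof (rule cSUP_least[OF ne])
      fix C assume C: "C \<in> s A"
      have "pos B \<le> pos (A \<union> B) - \<nu> C"
        unfolding pos_def[of B]
      proof (rule cSUP_least[OF ne])
        fix D assume D: "D \<in> s B"
        have "\<nu> C + \<nu> D = \<nu> (C \<union> D)" using C D AB by (intro add[symmetric]) (auto simp: s_def)
        also have "\<dots> \<le> pos (A \<union> B)" using C D A B by (intro pos_ge) (auto simp: s_def)
        finally show "\<nu> D \<le> pos (A \<union> B) - \<nu> C" by simp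
      qed
      then show "\<nu> C \<le> pos (A \<union> B) - pos B" by simp
    qed
    then show "pos A + pos B \<le> pos (A \<union> B)" by simp
  qed
  have E: "\<exists>f. integrable M f \<and> (\<forall>A\<in>sets M. pos A = (LINT x:A|M. f x))"
    by (rule set_function_density_nonneg[where K="\<bar>K\<bar>" and r=r, OF posadd pos0 posK r])
  obtain f where f: "integrable M f" "\<forall>A\<in>sets M. pos A = (LINT x:A|M. f x)"
    using E by auto
  have Kabs: "K * measure M A powr r \<le> \<bar>K\<bar> * measure M A powr r" for A
    by (intro mult_right_mono) auto
  \<comment> \<open>The difference \<open>pos A - \<nu> A\<close> is the negative part. It is
    additive and nonnegative, and satisfies the same kind of bound with the constant doubled, so the
    nonnegative case applies once more.\<close>
  have "pos A - \<nu> A \<le> (2 * \<bar>K\<bar>) * measure M A powr r" if "A \<in> sets M" for A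
    using posK[OF that] bd[OF that] Kabs[of A] by linarith
  note negK = this
  have negadd: "pos (A \<union> B) - \<nu> (A \<union> B) = (pos A - \<nu> A) + (pos B - \<nu> B)"
    if "A \<in> sets M" "B \<in> sets M" "A \<inter> B = {}" for A B
    using posadd[OF that] add[OF that] by simp
  have neg0: "0 \<le> pos A - \<nu> A" if "A \<in> sets M" for A using pos_ge[OF that _ that] by simp
  have "\<exists>g. integrable M g \<and> (\<forall>A\<in>sets M. pos A - \<nu> A = (LINT x:A|M. g x))"
    by (rule set_function_density_nonneg[where \<nu>="\<lambda>A. pos A - \<nu> A" and K="2 * \<bar>K\<bar>" and r=r, OF negadd neg0 negK r])
  then obtain g where g: "integrable M g" "\<forall>A\<in>sets M. pos A - \<nu> A = (LINT x:A|M. g x)" by auto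
  show ?thesis
  proof (intro exI[of _ "\<lambda>x. f x - g x"] conjI ballI)
    show "integrable M (\<lambda>x. f x - g x)" using f g by auto
    fix A assume A: "A \<in> sets M"
    have "(LINT x:A|M. f x - g x) = (LINT x:A|M. f x) - (LINT x:A|M. g x)"
      using integrable_mult_indicator[OF A f(1)] integrable_mult_indicator[OF A g(1)]
      by (intro set_integral_diff) (auto simp: set_integrable_def)
    then show "\<nu> A = (LINT x:A|M. f x - g x)" using f(2)[rule_format, OF A] g(2)[rule_format, OF A] by linarith
  qed
qed

lemma (in finite_measure) Lspace_indicator: "0 \<le> p \<Longrightarrow> A \<in> sets M \<Longrightarrow> (\<lambda>x. indicator A x :: complex) \<in> Lspace p M"
  by (rule Lspace_bounded[where C=1]) (auto simp: indicator_def)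

lemma (in finite_measure) simple_function_Lspace:
  fixes s :: "'a \<Rightarrow> complex"
  assumes "simple_function M s" "0 \<le> p"
  shows "s \<in> Lspace p M"
proof (rule Lspace_bounded[OF _ _ assms(2)])
  show "AE x in M. norm (s x) \<le> Max (norm ` s ` space M)"
    using simple_functionD(1)[OF assms(1)] by (intro AE_I2 Max_ge) auto
qed (use assms borel_measurable_simple_function in auto)

text \<open>On indicators the functional is an additive set function of size at most K
  measure(A)^(1/p); the densities of its real and imaginary parts form Y. The formula extends to
  simple functions by linearity and to bounded ones by dominated convergence. Bounded test functions
  then show that Y lies in \<open>L^q\<close>, which in turn opens the passage to all of
  \<open>L^p\<close>.\<close>

theorem (in finite_measure) Lspace_dual:
  fixes \<Lambda> :: "('a \<Rightarrow> complex) \<Rightarrow> complex"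
  assumes p: "1 < p" "1 / p + 1 / q = 1"
    and add: "\<And>f g. f \<in> Lspace p M \<Longrightarrow> g \<in> Lspace p M \<Longrightarrow> \<Lambda> (\<lambda>x. f x + g x) = \<Lambda> f + \<Lambda> g"
    and scale: "\<And>f c. f \<in> Lspace p M \<Longrightarrow> \<Lambda> (\<lambda>x. c * f x) = c * \<Lambda> f"
    and bound: "\<And>f. f \<in> Lspace p M \<Longrightarrow> norm (\<Lambda> f) \<le> K * Lint p M f powr (1 / p)"
  shows "\<exists>Y\<in>Lspace q M. \<forall>f\<in>Lspace p M. \<Lambda> f = (LINT x|M. f x * Y x)"
proof -
  have q: "1 < q" by (rule conjugate_exponent_gt_1[OF p])
  have p0: "0 \<le> p" "0 < p" using p by auto
  have diff: "\<Lambda> (\<lambda>x. f x - g x) = \<Lambda> f - \<Lambda> g" if "f \<in> Lspace p M" "g \<in> Lspace p M" for f g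
    using add[OF that(1) Lspace_scale[OF that(2), of "-1"]] scale[OF that(2), of "-1"] by simp
  have cont: "(\<lambda>n. \<Lambda> (s n)) \<longlonglongrightarrow> \<Lambda> f"
    if "\<And>n. s n \<in> Lspace p M" "f \<in> Lspace p M" "(\<lambda>n. Lint p M (\<lambda>x. s n x - f x)) \<longlonglongrightarrow> 0" for s f
  proof (rule LIM_zero_cancel, rule Lim_null_comparison)
    show "\<forall>\<^sub>F n in sequentially. norm (\<Lambda> (s n) - \<Lambda> f) \<le> K * Lint p M (\<lambda>x. s n x - f x) powr (1/p)"
      using bound[OF Lspace_diff(1)[OF p0(1) that(1,2)]] diff[OF that(1,2)] by auto
    show "(\<lambda>n. K * Lint p M (\<lambda>x. s n x - f x) powr (1/p)) \<longlonglongrightarrow> 0"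
      using p by (intro tendsto_mult_right_zero tendsto_powr_0[OF that(3)]) auto
  qed
  \<comment> \<open>Functions that agree on \<open>space M\<close> may differ elsewhere, and
    \<open>\<Lambda>\<close> takes total functions; that it ignores the difference follows from the
    norm bound.\<close>
  have cong: "\<Lambda> f = \<Lambda> g" if "f \<in> Lspace p M" "g \<in> Lspace p M" "\<And>x. x \<in> space M \<Longrightarrow> f x = g x" for f g
  proof -
    have "Lint p M (\<lambda>x. f x - g x) = (LINT x|M. 0)"
      unfolding Lint_def by (rule Bochner_Integration.integral_cong) (use that in auto)
    then show ?thesis using bound[OF Lspace_diff(1)[OF p0(1) that(1,2)]] diff[OF that(1,2)] p by simp
  qed
  let ?I = "\<lambda>A x. indicator A x :: complex"
  have I: "?I A \<in> Lspace p M" if "A \<in> sets M" for A using Lspace_indicator[OF p0(1) that] .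
  have addI: "\<Lambda> (?I (A \<union> B)) = \<Lambda> (?I A) + \<Lambda> (?I B)" if "A \<in> sets M" "B \<in> sets M" "A \<inter> B = {}" for A B
  proof -
    have "?I (A \<union> B) = (\<lambda>x. ?I A x + ?I B x)" using that by (auto simp: indicator_def fun_eq_iff)
    then show ?thesis using add[OF I I] that by simp
  qed
  have LintI: "Lint p M (?I A) = measure M A" if "A \<in> sets M" for A
  proof -
    have "Lint p M (?I A) = (LINT x|M. indicator A x)"
      unfolding Lint_def by (rule Bochner_Integration.integral_cong) (auto simp: indicator_def)
    then show ?thesis using that by simp
  qed
  have bI: "norm (\<Lambda> (?I A)) \<le> K * measure M A powr (1/p)" if "A \<in> sets M" for A
    using bound[OF I[OF that]] LintI[OF that] by simp
  have "\<exists>f::'a\<Rightarrow>real. integrable M f \<and> (\<forall>A\<in>sets M. Re (\<Lambda> (?I A)) = (LINT x:A|M. f x))"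
    using addI p order_trans[OF abs_Re_le_cmod bI]
    by (intro set_function_density[where K=K and r="1/p"]) auto
  then obtain Y1 :: "'a \<Rightarrow> real" where Y1: "integrable M Y1" "\<forall>A\<in>sets M. Re (\<Lambda> (?I A)) = (LINT x:A|M. Y1 x)" by auto
  have "\<exists>f::'a\<Rightarrow>real. integrable M f \<and> (\<forall>A\<in>sets M. Im (\<Lambda> (?I A)) = (LINT x:A|M. f x))"
    using addI p order_trans[OF abs_Im_le_cmod bI]
    by (intro set_function_density[where K=K and r="1/p"]) auto
  then obtain Y2 :: "'a \<Rightarrow> real" where Y2: "integrable M Y2" "\<forall>A\<in>sets M. Im (\<Lambda> (?I A)) = (LINT x:A|M. Y2 x)" by auto
  define Y where "Y = (\<lambda>x. complex_of_real (Y1 x) + \<i> * complex_of_real (Y2 x))"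
  have Y: "integrable M Y" using Y1 Y2 unfolding Y_def by auto
  then have [measurable]: "Y \<in> borel_measurable M" by auto
  have ind: "\<Lambda> (?I A) = (LINT x|M. ?I A x * Y x)" if A: "A \<in> sets M" for A
  proof -
    have i: "integrable M (\<lambda>x. indicator A x * Y1 x)" "integrable M (\<lambda>x. indicator A x * Y2 x)"
      using integrable_mult_indicator[OF A Y1(1)] integrable_mult_indicator[OF A Y2(1)] by simp_all
    have "(LINT x|M. ?I A x * Y x) = (LINT x|M. complex_of_real (indicator A x * Y1 x) + \<i> * complex_of_real (indicator A x * Y2 x))"
      by (rule Bochner_Integration.integral_cong) (auto simp: Y_def indicator_def)
    also have "\<dots> = complex_of_real (LINT x|M. indicator A x * Y1 x) + \<i> * complex_of_real (LINT x|M. indicator A x * Y2 x)"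
      using i by (subst Bochner_Integration.integral_add)
        (auto simp del: of_real_mult of_real_indicator intro!: integrable_of_real integrable_mult_right)
    also have "\<dots> = \<Lambda> (?I A)"
      using Y1(2) Y2(2) A by (simp add: set_lebesgue_integral_def complex_eq_iff)
    finally show ?thesis by simp
  qed
  have bint: "integrable M (\<lambda>x. f x * Y x)"
    if "f \<in> borel_measurable M" "\<And>x. x \<in> space M \<Longrightarrow> norm (f x) \<le> C" for f C
    by (rule Bochner_Integration.integrable_bound[of _ "\<lambda>x. C * Y x"])
      (use Y that in \<open>auto simp: norm_mult intro!: mult_right_mono AE_I2 order_trans[OF that(2) abs_ge_self]\<close>)
  have simp: "\<Lambda> s = (LINT x|M. s x * Y x)" if s: "simple_function M s" for s
  proof -
    define A where "A y = s -` {y} \<inter> space M" for y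
    have fin: "finite (s ` space M)" and A: "A y \<in> sets M" for y
      using simple_functionD[OF s] by (auto simp: A_def)
    have *: "(\<lambda>x. \<Sum>y\<in>F. y * ?I (A y) x) \<in> Lspace p M \<and>
        \<Lambda> (\<lambda>x. \<Sum>y\<in>F. y * ?I (A y) x) = (\<Sum>y\<in>F. y * \<Lambda> (?I (A y)))" if "finite F" for F
      using that
    proof induction
      case empty
      show ?case using scale[OF I[OF A], of 0] Lspace_scale[OF I[OF A], of 0] by simp
    next
      case (insert y F)
      let ?g = "\<lambda>x. \<Sum>y\<in>F. y * ?I (A y) x"
      have g: "?g \<in> Lspace p M" "\<Lambda> ?g = (\<Sum>y\<in>F. y * \<Lambda> (?I (A y)))" using insert.IH by blast+
      have y: "(\<lambda>x. y * ?I (A y) x) \<in> Lspace p M" by (rule Lspace_scale[OF I[OF A]])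
      show ?case
        unfolding sum.insert[OF insert.hyps] add[OF y g(1)] g(2) scale[OF I[OF A[of y]], of y]
        using Lspace_add(1)[OF p0(1) y g(1)] by blast
    qed
    have rep: "s x = (\<Sum>y\<in>s ` space M. y * ?I (A y) x)" if "x \<in> space M" for x
    proof -
      have "s x = (\<Sum>y\<in>s ` space M. indicator (A y) x *\<^sub>R y)"
        unfolding A_def by (rule simple_function_indicator_representation_banach[OF s that])
      also have "\<dots> = (\<Sum>y\<in>s ` space M. y * ?I (A y) x)"
        by (rule sum.cong) (auto simp: scaleR_conv_of_real indicator_def)
      finally show ?thesis .
    qed
    have "\<Lambda> s = \<Lambda> (\<lambda>x. \<Sum>y\<in>s ` space M. y * ?I (A y) x)"
      by (rule cong[OF simple_function_Lspace[OF s p0(1)] conjunct1[OF *[OF fin]] rep])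
    also have "\<dots> = (\<Sum>y\<in>s ` space M. y * \<Lambda> (?I (A y)))" by (rule conjunct2[OF *[OF fin]])
    also have "\<dots> = (LINT x|M. (\<Sum>y\<in>s ` space M. y * (?I (A y) x * Y x)))"
    proof -
      have "integrable M (\<lambda>x. ?I (A y) x * Y x)" for y
        by (rule bint[OF borel_measurable_indicator[OF A], of _ 1]) (simp add: indicator_def)
      then show ?thesis
        unfolding ind[OF A] by (subst Bochner_Integration.integral_sum) simp_all
    qed
    also have "\<dots> = (LINT x|M. s x * Y x)"
    proof (rule Bochner_Integration.integral_cong[OF refl])
      fix x assume "x \<in> space M"
      show "(\<Sum>y\<in>s ` space M. y * (?I (A y) x * Y x)) = s x * Y x"
        by (subst rep[OF \<open>x \<in> space M\<close>]) (simp only: sum_distrib_right mult.assoc)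
    qed
    finally show ?thesis .
  qed
  have approx: "\<exists>s. (\<forall>n. simple_function M (s n)) \<and> (\<forall>x\<in>space M. (\<lambda>n. s n x) \<longlonglongrightarrow> f x) \<and>
      (\<forall>n. \<forall>x\<in>space M. norm (s n x) \<le> 2 * norm (f x)) \<and> (\<lambda>n. \<Lambda> (s n)) \<longlonglongrightarrow> \<Lambda> f"
    if f: "f \<in> Lspace p M" for f
  proof -
    have "f \<in> borel_measurable M" using f by (simp add: Lspace_def)
    from borel_measurable_implies_sequence_metric[OF this, of 0] obtain s where
      s: "\<forall>n. simple_function M (s n)" "\<forall>x\<in>space M. (\<lambda>n. s n x) \<longlonglongrightarrow> f x"
        "\<forall>n. \<forall>x\<in>space M. norm (s n x) \<le> 2 * norm (f x)"
      by (auto simp: dist_norm)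
    have "(\<lambda>n. \<Lambda> (s n)) \<longlonglongrightarrow> \<Lambda> f"
    proof (rule cont[OF _ f])
      show "s n \<in> Lspace p M" for n using s p0 by (intro simple_function_Lspace) auto
      show "(\<lambda>n. Lint p M (\<lambda>x. s n x - f x)) \<longlonglongrightarrow> 0"
        by (rule Lint_dominated_convergence[OF p0(2) f])
          (use s in \<open>auto intro: borel_measurable_simple_function\<close>)
    qed
    with s show ?thesis by blast
  qed
  have bdd: "\<Lambda> f = (LINT x|M. f x * Y x)"
    if f[measurable]: "f \<in> borel_measurable M" and C: "\<And>x. x \<in> space M \<Longrightarrow> norm (f x) \<le> C" for f C
  proof -
    have fL: "f \<in> Lspace p M" by (rule Lspace_bounded[OF f _ p0(1), of C]) (use C in auto)
    obtain s where s: "\<And>n. simple_function M (s n)" "\<And>x. x\<in>space M \<Longrightarrow> (\<lambda>n. s n x) \<longlonglongrightarrow> f x"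
        "\<And>n x. x\<in>space M \<Longrightarrow> norm (s n x) \<le> 2 * norm (f x)" "(\<lambda>n. \<Lambda> (s n)) \<longlonglongrightarrow> \<Lambda> f"
      using approx[OF fL] by blast
    have [measurable]: "s n \<in> borel_measurable M" for n using s by (auto intro: borel_measurable_simple_function)
    have "(\<lambda>n. LINT x|M. s n x * Y x) \<longlonglongrightarrow> (LINT x|M. f x * Y x)"
    proof (rule integral_dominated_convergence)
      show "integrable M (\<lambda>x. 2 * norm (f x * Y x))" using bint[OF f C] by auto
      show "AE x in M. (\<lambda>n. s n x * Y x) \<longlonglongrightarrow> f x * Y x" by (intro AE_I2 tendsto_intros s)
      show "AE x in M. norm (s n x * Y x) \<le> 2 * norm (f x * Y x)" for n
        using s(3) by (auto simp: norm_mult mult.assoc[symmetric] intro!: mult_right_mono)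
    qed auto
    moreover have "(\<lambda>n. LINT x|M. s n x * Y x) \<longlonglongrightarrow> \<Lambda> f" using s(4) simp[OF s(1)] by simp
    ultimately show ?thesis using LIMSEQ_unique by blast
  qed
  have Yq: "Y \<in> Lspace q M"
  proof -
    \<comment> \<open>Truncation keeps the test functions bounded, where the formula for
      \<open>\<Lambda>\<close> is already known, and keeps \<open>J n\<close> finite, so that one
      may divide by a power of it.\<close>
    define E where "E n = {x \<in> space M. norm (Y x) \<le> real n}" for n :: nat
    have [measurable]: "E n \<in> sets M" for n unfolding E_def by measurable
    \<comment> \<open>The extremal function for Hoelder's inequality: on \<open>E n\<close> both
      |g|^p and g Y equal |Y|^q. The bound on \<open>\<Lambda>\<close> therefore reads J <= K
      J^(1/p), that is J <= K^q, uniformly in n, and monotone convergence applies.\<close>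
    define g where "g n x = ?I (E n) x * (of_real (norm (Y x) powr (q - 2)) * cnj (Y x))" for n x
    define h where "h n x = indicator (E n) x * norm (Y x) powr q" for n x
    have g_meas[measurable]: "g n \<in> borel_measurable M" for n unfolding g_def by measurable
    have h_meas[measurable]: "h n \<in> borel_measurable M" for n unfolding h_def by measurable
    have ng: "norm (g n x) = indicator (E n) x * norm (Y x) powr (q - 1)" for n x
    proof -
      have "norm (Y x) powr (q - 2) * norm (Y x) = norm (Y x) powr (q - 1)"
        using powr_mult_base[of "norm (Y x)" "q - 2"] by (simp add: mult.commute add.commute)
      then show ?thesis by (auto simp: g_def norm_mult indicator_def)
    qed
    have gY: "g n x * Y x = of_real (h n x)" for n x
    proof -
      have "norm (Y x) powr (q - 2) * (norm (Y x))\<^sup>2 = norm (Y x) powr q"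
        using q by (cases "Y x = 0") (auto simp: powr_realpow[symmetric] powr_add[symmetric] simp del: powr_numeral)
      moreover have "cnj (Y x) * Y x = of_real ((norm (Y x))\<^sup>2)"
        using complex_norm_square[of "Y x"] by (simp add: mult.commute)
      ultimately have "of_real (norm (Y x) powr (q - 2)) * (cnj (Y x) * Y x) = (of_real (norm (Y x) powr q) :: complex)"
        by (metis of_real_mult)
      then show ?thesis by (auto simp: g_def h_def indicator_def mult.assoc)
    qed
    have hb: "norm (h n x) \<le> real n powr q" if "x \<in> space M" for n x
      using q by (auto simp: h_def E_def indicator_def intro!: powr_mono2)
    have hint: "integrable M (h n)" for n
      by (rule integrable_const_bound[OF AE_I2 h_meas]) (rule hb)
    have gb: "norm (g n x) \<le> real n powr (q - 1)" if "x \<in> space M" for n x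
      unfolding ng using q by (auto simp: E_def indicator_def intro!: powr_mono2)
    have qp: "(q - 1) * p = q" using p q by (simp add: field_simps)
    have Lg: "Lint p M (g n) = (LINT x|M. h n x)" for n
      unfolding Lint_def ng h_def
      by (rule Bochner_Integration.integral_cong) (auto simp: indicator_def powr_powr qp)
    define J where "J n = (LINT x|M. h n x)" for n
    have J0: "0 \<le> J n" for n unfolding J_def h_def by (intro integral_nonneg_AE) auto
    have Jb: "J n \<le> K * J n powr (1/p)" for n
    proof -
      have "\<Lambda> (g n) = (LINT x|M. complex_of_real (h n x))"
        using bdd[OF g_meas gb] by (simp add: gY)
      also have "\<dots> = of_real (J n)" unfolding J_def by (rule integral_of_real[OF hint])
      finally have "J n = norm (\<Lambda> (g n))" using J0[of n] by simp
      also have "\<dots> \<le> K * J n powr (1/p)"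
        using bound[of "g n"] Lspace_bounded[OF g_meas _ p0(1)] gb Lg unfolding J_def by fastforce
      finally show ?thesis .
    qed
    have Jb': "J n \<le> K powr q" for n
    proof (cases "J n = 0")
      case False
      then have Jp: "0 < J n" using J0[of n] by simp
      have "J n powr (1/q) * J n powr (1/p) = J n" using p Jp by (simp add: powr_add[symmetric] add.commute)
      then have "J n powr (1/q) * J n powr (1/p) \<le> K * J n powr (1/p)" using Jb[of n] by simp
      then have "J n powr (1/q) \<le> K" using Jp by simp
      then have "(J n powr (1/q)) powr q \<le> K powr q" using q by (intro powr_mono2) auto
      then show ?thesis using q Jp by (simp add: powr_powr)
    qed auto
    have hlim: "(\<lambda>n. h n x) \<longlonglongrightarrow> norm (Y x) powr q" if "x \<in> space M" for x
    proof (rule tendsto_eventually)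
      obtain N where "norm (Y x) \<le> real N" using real_arch_simple by blast
      then show "\<forall>\<^sub>F n in sequentially. h n x = norm (Y x) powr q"
        using that by (auto simp: eventually_sequentially h_def E_def indicator_def intro!: exI[of _ N])
    qed
    have hmono: "incseq (\<lambda>n. h n x)" for x
      by (rule monoI) (auto simp: h_def E_def indicator_def)
    have "incseq J" unfolding J_def
      by (rule monoI, rule integral_mono[OF hint hint]) (use hmono in \<open>auto simp: incseq_def\<close>)
    then obtain L where "J \<longlonglongrightarrow> L" using incseq_convergent[of J "K powr q"] Jb' by metis
    have "integrable M (\<lambda>x. norm (Y x) powr q)"
    proof (rule integrable_monotone_convergence[OF hint])
      show "AE x in M. mono (\<lambda>n. h n x)" using hmono by (intro AE_I2)
      show "AE x in M. (\<lambda>n. h n x) \<longlonglongrightarrow> norm (Y x) powr q" using hlim by (intro AE_I2)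
      show "(\<lambda>n. LINT x|M. h n x) \<longlonglongrightarrow> L" using \<open>J \<longlonglongrightarrow> L\<close> by (simp add: J_def[abs_def])
    qed auto
    then show ?thesis by (intro LspaceI) auto
  qed
  show ?thesis
  proof (rule bexI[OF _ Yq], rule ballI)
    fix f assume f: "f \<in> Lspace p M"
    obtain s where s: "\<And>n. simple_function M (s n)" "\<And>x. x\<in>space M \<Longrightarrow> (\<lambda>n. s n x) \<longlonglongrightarrow> f x"
        "\<And>n x. x\<in>space M \<Longrightarrow> norm (s n x) \<le> 2 * norm (f x)" "(\<lambda>n. \<Lambda> (s n)) \<longlonglongrightarrow> \<Lambda> f"
      using approx[OF f] by blast
    have "(\<lambda>n. LINT x|M. s n x * Y x) \<longlonglongrightarrow> (LINT x|M. f x * Y x)"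
      by (rule tendsto_Lint_integral[OF p simple_function_Lspace[OF s(1) p0(1)] f _ Yq],
          rule Lint_dominated_convergence(1)[OF p0(2) f])
        (use s in \<open>auto intro: borel_measurable_simple_function\<close>)
    moreover have "(\<lambda>n. LINT x|M. s n x * Y x) \<longlonglongrightarrow> \<Lambda> f" using s(4) simp[OF s(1)] by simp
    ultimately show "\<Lambda> f = (LINT x|M. f x * Y x)" using LIMSEQ_unique by blast
  qed
qed

section \<open>The unit circle\<close>

abbreviation circle :: "complex set" where "circle \<equiv> sphere 0 1"

lemma space_circle [simp]: "space circle_measure = circle"
  by (simp add: circle_measure_def space_restrict_space)

lemma sets_circle: "sets circle_measure = sets (restrict_space borel circle)"
  by (simp add: circle_measure_def)

lemma measurable_circle_iff: "f \<in> borel_measurable circle_measure \<longleftrightarrow> f \<in> borel_measurable (restrict_space borel circle)"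
  by (simp add: measurable_cong_sets[OF sets_circle refl])

lemma borel_measurable_circle_continuous:
  "continuous_on circle f \<Longrightarrow> f \<in> borel_measurable circle_measure"
  unfolding measurable_circle_iff by (rule borel_measurable_continuous_on_restrict)

lemma borel_measurable_circle_borel:
  "f \<in> borel_measurable borel \<Longrightarrow> f \<in> borel_measurable circle_measure"
  unfolding measurable_circle_iff by (rule measurable_restrict_space1)

lemma cis_measurable:
  "cis \<in> measurable (uniform_measure lborel {0..<2 * pi}) (restrict_space borel circle)"
proof (rule measurable_restrict_space2)
  have "cis \<in> borel_measurable borel" by (intro borel_measurable_continuous_onI continuous_intros)
  then show "cis \<in> borel_measurable (uniform_measure lborel {0..<2 * pi})" by simp
qed auto

lemma measure_circle [simp]: "emeasure circle_measure circle = 1"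
proof -
  have "emeasure circle_measure circle = emeasure (uniform_measure lborel {0..<2 * pi}) (cis -` circle \<inter> UNIV)"
    unfolding circle_measure_def
    by (subst emeasure_distr[OF cis_measurable]) (auto simp: sets_restrict_space_iff)
  also have "cis -` circle \<inter> UNIV = UNIV" by auto
  also have "emeasure (uniform_measure lborel {0..<2 * pi}) UNIV = emeasure lborel {0..<2 * pi} / emeasure lborel {0..<2 * pi}"
    by (subst emeasure_uniform_measure) auto
  also have "\<dots> = 1" by (simp add: ennreal_divide_self)
  finally show ?thesis .
qed

interpretation circle: finite_measure circle_measure
  by standard auto

lemma measure_circle_1 [simp]: "measure circle_measure circle = 1"
  by (simp add: measure_def)

lemma lebesgue_integral_circle:
  fixes f :: "complex \<Rightarrow> 'a::{banach, second_countable_topology}"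
  assumes "f \<in> borel_measurable circle_measure"
  shows "(LINT t|circle_measure. f t) = (1 / (2 * pi)) *\<^sub>R (LINT x:{0..<2*pi}|lborel. f (cis x))"
proof -
  have f: "f \<in> borel_measurable (restrict_space borel circle)" using assms by (simp add: measurable_circle_iff)
  have fc: "(\<lambda>x. f (cis x)) \<in> borel_measurable lborel"
    using measurable_compose[OF cis_measurable f] by simp
  have u: "uniform_measure lborel {0..<2 * pi} = density lborel (\<lambda>x. ennreal (indicator {0..<2*pi} x / (2 * pi)))"
    unfolding uniform_measure_def
    by (rule density_cong)
      (auto simp: indicator_def divide_ennreal[symmetric] ennreal_mult' simp flip: ennreal_numeral)
  have "(LINT t|circle_measure. f t) = (LINT x|uniform_measure lborel {0..<2 * pi}. f (cis x))"
    unfolding circle_measure_def by (rule integral_distr[OF cis_measurable f])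
  also have "\<dots> = (LINT x|lborel. (indicator {0..<2*pi} x / (2 * pi)) *\<^sub>R f (cis x))"
    unfolding u by (rule integral_density[OF fc]) auto
  also have "\<dots> = (LINT x|lborel. (1 / (2 * pi)) *\<^sub>R (indicator {0..<2*pi} x *\<^sub>R f (cis x)))"
    by (rule Bochner_Integration.integral_cong) auto
  also have "\<dots> = (1 / (2 * pi)) *\<^sub>R (LINT x:{0..<2*pi}|lborel. f (cis x))"
    unfolding set_lebesgue_integral_def by (rule integral_scaleR_right) 
  finally show ?thesis .
qed

lemma powi_cis: "cis x powi n = cis (of_int n * x)"
proof (cases "0 \<le> n")
  case True
  then show ?thesis using Complex.DeMoivre[of x "nat n"] by (simp add: power_int_def)
next
  case False
  then show ?thesis using Complex.DeMoivre[of "-x" "nat (- n)"] by (simp add: power_int_def)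
qed

lemma integral_powi_circle: "(LINT t|circle_measure. t powi n) = (if n = 0 then 1 else 0)"
proof (cases "n = 0")
  case True
  then show ?thesis by simp
next
  case False
  have c: "continuous_on circle (\<lambda>t. t powi n)" by (intro continuous_intros) auto
  have "(LINT x:{0..<2*pi}|lborel. cis x powi n) = (LINT x|lborel. indicator {0..2*pi} x *\<^sub>R cis (of_int n * x))"
    unfolding set_lebesgue_integral_def powi_cis
  proof (rule integral_cong_AE)
    show "AE x in lborel. indicat_real {0..<2 * pi} x *\<^sub>R cis (of_int n * x) = indicat_real {0..2 * pi} x *\<^sub>R cis (of_int n * x)"
      using AE_lborel_singleton[of "2*pi"] by eventually_elim (auto simp: indicator_def)
    have [measurable]: "(\<lambda>x. cis (of_int n * x)) \<in> borel_measurable borel"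
      by (intro borel_measurable_continuous_onI continuous_intros)
    show "(\<lambda>x. indicat_real {0..<2 * pi} x *\<^sub>R cis (of_int n * x)) \<in> borel_measurable lborel"
      "(\<lambda>x. indicat_real {0..2 * pi} x *\<^sub>R cis (of_int n * x)) \<in> borel_measurable lborel" by simp_all
  qed
  also have "\<dots> = cis (of_int n * (2*pi)) / (\<i> * of_int n) - cis (of_int n * 0) / (\<i> * of_int n)"
  proof (rule integral_FTC_Icc)
    fix x :: real
    have "((\<lambda>x. exp (\<i> * of_int n * of_real x) / (\<i> * of_int n)) has_vector_derivative exp (\<i> * of_int n * of_real x)) (at x within {0..2*pi})"
      using False by (auto intro!: derivative_eq_intros has_vector_derivative_real_field simp: field_simps)
    then show "((\<lambda>x. cis (of_int n * x) / (\<i> * of_int n)) has_vector_derivative cis (of_int n * x)) (at x within {0..2*pi})"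
      by (simp add: cis_conv_exp mult.assoc)
  qed (auto intro!: continuous_intros)
  also have "cis (of_int n * (2*pi)) = 1"
    using cis_multiple_2pi[of "of_int n"] by (simp add: mult.commute)
  finally show ?thesis
    using False by (simp add: lebesgue_integral_circle[OF borel_measurable_circle_continuous[OF c]])
qed

lemma inverse_measurable_circle [measurable]: "inverse \<in> measurable circle_measure circle_measure"
proof -
  have "inverse \<in> measurable (restrict_space borel circle) (restrict_space borel circle)"
    by (rule measurable_restrict_space3)  (auto simp: norm_inverse)
  then show ?thesis by (simp add: measurable_cong_sets[OF sets_circle sets_circle])
qed

text \<open>In the angle, t -> 1/t is x -> 2 pi - x, which maps [0, 2 pi) to (0, 2 pi]; the
  endpoints are null. The real case is enough to see that the measure is invariant, and the general
  integral follows from that.\<close>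

lemma integral_inverse_circle_aux:
  fixes f :: "complex \<Rightarrow> real"
  assumes f: "f \<in> borel_measurable circle_measure"
  shows "(LINT t|circle_measure. f (inverse t)) = (LINT t|circle_measure. f t)"
proof -
  have fi: "(\<lambda>t. f (inverse t)) \<in> borel_measurable circle_measure"
    using f by simp
  have m: "(\<lambda>x. g (cis x)) \<in> borel_measurable borel" if "g \<in> borel_measurable circle_measure" for g :: "complex \<Rightarrow> real"
  proof -
    have "g \<in> borel_measurable (restrict_space borel circle)" using that by (simp add: measurable_circle_iff)
    from measurable_compose[OF cis_measurable this] show ?thesis by simp
  qed
  note [measurable] = m[OF f] m[OF fi]
  have "(LINT x:{0..<2*pi}|lborel. f (cis x)) = (LINT x|lborel. indicator {0..<2*pi} (2*pi + (-1) * x) *\<^sub>R f (cis (2*pi + (-1) * x)))"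
    unfolding set_lebesgue_integral_def by (subst lborel_integral_real_affine[of "-1" _ "2*pi"]) auto
  also have "\<dots> = (LINT x|lborel. indicator {0..<2*pi} x *\<^sub>R f (inverse (cis x)))"
  proof (rule integral_cong_AE)
    have c: "cis (2*pi + (-1) * x) = inverse (cis x)" for x
      by (metis (no_types, opaque_lifting) cis_2pi cis_inverse cis_mult mult_1 mult_minus1)
    show "AE x in lborel. indicator {0..<2*pi} (2*pi + (-1) * x) *\<^sub>R f (cis (2*pi + (-1) * x)) = indicat_real {0..<2*pi} x *\<^sub>R f (inverse (cis x))"
      using AE_lborel_singleton[of "2*pi"] AE_lborel_singleton[of 0] unfolding c
      by eventually_elim (auto simp: indicator_def)
    show "(\<lambda>x. indicat_real {0..<2 * pi} (2 * pi + (- 1) * x) *\<^sub>R f (cis (2 * pi + (- 1) * x))) \<in> borel_measurable lborel"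
      unfolding c by (simp del: cis_inverse)
    show "(\<lambda>x. indicat_real {0..<2 * pi} x *\<^sub>R f (inverse (cis x))) \<in> borel_measurable lborel" by (simp del: cis_inverse)
  qed
  finally show ?thesis
    using lebesgue_integral_circle[OF f] lebesgue_integral_circle[OF fi] by (simp add: set_lebesgue_integral_def)
qed

lemma distr_inverse_circle: "distr circle_measure circle_measure inverse = circle_measure"
proof (rule measure_eqI)
  fix A assume "A \<in> sets (distr circle_measure circle_measure inverse)"
  then have A: "A \<in> sets circle_measure" by simp
  have Ai: "inverse -` A \<inter> circle \<in> sets circle_measure" using measurable_sets[OF inverse_measurable_circle A] by simp
  have "measure circle_measure (inverse -` A \<inter> circle) = (LINT t|circle_measure. indicator A (inverse t))"
    using Ai by (subst Bochner_Integration.integral_cong[OF refl, of _ _ "indicator (inverse -` A \<inter> circle)"]) (auto simp: indicator_def)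
  also have "\<dots> = (LINT t|circle_measure. indicator A t)"
    using A by (intro integral_inverse_circle_aux) auto
  also have "\<dots> = measure circle_measure A" using A sets.sets_into_space[OF A] by (simp add: Int_absorb2)
  finally show "emeasure (distr circle_measure circle_measure inverse) A = emeasure circle_measure A"
    using A by (simp add: emeasure_distr circle.emeasure_eq_measure)
qed simp

lemma integral_inverse_circle:
  fixes f :: "complex \<Rightarrow> 'a::{banach, second_countable_topology}"
  assumes "f \<in> borel_measurable circle_measure"
  shows "(LINT t|circle_measure. f (inverse t)) = (LINT t|circle_measure. f t)"
  using integral_distr[OF inverse_measurable_circle assms] by (simp add: distr_inverse_circle)

lemma AE_inverse_circle:
  assumes "AE t in circle_measure. Q t"
  shows "AE t in circle_measure. Q (inverse t)"
  by (rule AE_distrD[OF inverse_measurable_circle, unfolded distr_inverse_circle, OF assms])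

lemma integrable_inverse_circle:
  fixes f :: "complex \<Rightarrow> 'a::{banach, second_countable_topology}"
  assumes "integrable circle_measure f"
  shows "integrable circle_measure (\<lambda>t. f (inverse t))"
  using integrable_distr[OF inverse_measurable_circle, of f] assms by (simp add: distr_inverse_circle)

text \<open>Used for the points 1 and -1, the zeros of 1 - 1/t and 1 + 1/t, where the factors cannot
  be controlled. A point has at most one angle in [0, 2 pi), namely \<open>Arg2pi\<close>.\<close>

lemma AE_circle_not_singleton: "AE t in circle_measure. t \<noteq> a"
proof -
  have S: "{a} \<inter> circle \<in> sets (restrict_space borel circle)"
    unfolding sets_restrict_space by (rule image_eqI[of _ _ "{a}"]) auto
  have "emeasure circle_measure ({a} \<inter> circle) = emeasure (uniform_measure lborel {0..<2 * pi}) (cis -` ({a} \<inter> circle) \<inter> UNIV)"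
    unfolding circle_measure_def
    by (subst emeasure_distr[OF cis_measurable S]) simp
  also have "\<dots> = emeasure lborel ({0..<2*pi} \<inter> (cis -` ({a} \<inter> circle) \<inter> UNIV)) / emeasure lborel {0..<2*pi}"
  proof (rule emeasure_uniform_measure)
    have "closed (cis -` ({a} \<inter> circle))" by (intro closed_vimage) (auto intro: continuous_intros)
    then show "cis -` ({a} \<inter> circle) \<inter> UNIV \<in> sets lborel" by auto
  qed auto
  also have "emeasure lborel ({0..<2*pi} \<inter> (cis -` ({a} \<inter> circle) \<inter> UNIV)) = 0"
  proof -
    have "{0..<2*pi} \<inter> (cis -` ({a} \<inter> circle) \<inter> UNIV) \<subseteq> {Arg2pi a}"
    proof
      fix x assume "x \<in> {0..<2*pi} \<inter> (cis -` ({a} \<inter> circle) \<inter> UNIV)"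
      then have "0 \<le> x" "x < 2 * pi" "a = of_real 1 * exp (\<i> * of_real x)" by (auto simp: cis_conv_exp)
      from Arg2pi_unique[OF this(3)[symmetric] _ this(1,2)] show "x \<in> {Arg2pi a}" by simp
    qed
    then show ?thesis
      by (metis emeasure_lborel_singleton emeasure_mono le_zero_eq sets_lborel borel_singleton sets.empty_sets)
  qed
  finally have "{a} \<inter> circle \<in> null_sets circle_measure"
    using S by (simp add: null_sets_def sets_circle)
  then have "AE t in circle_measure. t \<notin> {a} \<inter> circle" by (rule AE_not_in)
  moreover have "AE t in circle_measure. t \<in> circle" by (rule AE_I2) simp
  ultimately show ?thesis by eventually_elim auto
qed

abbreviation LC :: "real \<Rightarrow> (complex \<Rightarrow> complex) set" where "LC p \<equiv> Lspace p circle_measure"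
abbreviation LI :: "real \<Rightarrow> (complex \<Rightarrow> complex) \<Rightarrow> real" where "LI p \<equiv> Lint p circle_measure"

section \<open>Trigonometric polynomials and Fourier coefficients\<close>

text \<open>Unlike \<open>trig_polys\<close>, this prescribes values on the circle only. The class
  is then closed under conjugation, since conj t = 1/t holds only there, and under products without
  concern for the value at 0.\<close>

definition trig :: "(complex \<Rightarrow> complex) \<Rightarrow> bool" where
  "trig f \<longleftrightarrow> (\<exists>N c. finite N \<and> (\<forall>t\<in>circle. f t = (\<Sum>n\<in>N. c n * t powi n)))"

lemma trig_cong: "trig f \<Longrightarrow> (\<And>t. t \<in> circle \<Longrightarrow> f t = g t) \<Longrightarrow> trig g"
  unfolding trig_def by metis

lemma trig_sum_powi: "finite N \<Longrightarrow> trig (\<lambda>t. \<Sum>n\<in>N. c n * t powi n)"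
  unfolding trig_def by blast

lemma trig_monom: "trig (\<lambda>t. c * t powi n)"
  using trig_sum_powi[of "{n}" "\<lambda>_. c"] by simp

lemma trig_const: "trig (\<lambda>t. c)"
  using trig_monom[of c 0] by simp

lemma trig_add:
  assumes "trig f" "trig g" shows "trig (\<lambda>t. f t + g t)"
proof -
  obtain N c M d where f: "finite N" "\<forall>t\<in>circle. f t = (\<Sum>n\<in>N. c n * t powi n)"
    and g: "finite M" "\<forall>t\<in>circle. g t = (\<Sum>n\<in>M. d n * t powi n)"
    using assms unfolding trig_def by metis
  let ?c = "\<lambda>n. (if n \<in> N then c n else 0) + (if n \<in> M then d n else 0)"
  have "f t + g t = (\<Sum>n\<in>N\<union>M. ?c n * t powi n)" if "t \<in> circle" for t
  proof -
    have "(\<Sum>n\<in>N. c n * t powi n) = (\<Sum>n\<in>N\<union>M. (if n \<in> N then c n else 0) * t powi n)"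
      using f g by (intro sum.mono_neutral_cong_left) auto
    moreover have "(\<Sum>n\<in>M. d n * t powi n) = (\<Sum>n\<in>N\<union>M. (if n \<in> M then d n else 0) * t powi n)"
      using f g by (intro sum.mono_neutral_cong_left) auto
    ultimately show ?thesis using f g that by (simp add: sum.distrib distrib_right)
  qed
  then show ?thesis unfolding trig_def using f g by (intro exI[of _ "N \<union> M"] exI[of _ ?c]) auto
qed

lemma trig_sum: "(\<And>i. i \<in> I \<Longrightarrow> trig (f i)) \<Longrightarrow> trig (\<lambda>t. \<Sum>i\<in>I. f i t)"
  by (induction I rule: infinite_finite_induct) (auto intro: trig_add trig_const)

lemma trig_scale:
  assumes "trig f" shows "trig (\<lambda>t. c * f t)"
proof -
  obtain N d where "finite N" "\<forall>t\<in>circle. f t = (\<Sum>n\<in>N. d n * t powi n)"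
    using assms unfolding trig_def by metis
  then show ?thesis unfolding trig_def
    by (intro exI[of _ N] exI[of _ "\<lambda>n. c * d n"]) (auto simp: sum_distrib_left mult.assoc)
qed

lemma trig_diff: "trig f \<Longrightarrow> trig g \<Longrightarrow> trig (\<lambda>t. f t - g t)"
  using trig_add[of f "\<lambda>t. -1 * g t"] trig_scale[of g "-1"] by simp

lemma trig_induct [consumes 1, case_names cong monom add]:
  assumes "trig f"
    and cong: "\<And>f g. trig f \<Longrightarrow> (\<And>t. t \<in> circle \<Longrightarrow> f t = g t) \<Longrightarrow> P f \<Longrightarrow> P g"
    and monom: "\<And>c n. P (\<lambda>t. c * t powi n)"
    and add: "\<And>f g. trig f \<Longrightarrow> trig g \<Longrightarrow> P f \<Longrightarrow> P g \<Longrightarrow> P (\<lambda>t. f t + g t)"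
  shows "P f"
proof -
  obtain N c where N: "finite N" and f: "\<forall>t\<in>circle. f t = (\<Sum>n\<in>N. c n * t powi n)"
    using assms(1) unfolding trig_def by metis
  have "P (\<lambda>t. \<Sum>n\<in>N. c n * t powi n)"
    using N
  proof induction
    case empty
    then show ?case using monom[of 0 0] by simp
  next
    case (insert n N)
    then show ?case using add[OF trig_monom trig_sum_powi monom] by simp
  qed
  then show ?thesis using cong[OF trig_sum_powi[OF N], of c f] f by auto
qed

lemma trig_mult_powi:
  assumes "trig f" shows "trig (\<lambda>t. t powi k * f t)"
  using assms
proof (induction rule: trig_induct)
  case (cong f g)
  show ?case by (rule trig_cong[OF cong(3)]) (use cong in auto)
next
  case (monom c n)
  show ?case by (rule trig_cong[OF trig_monom[of c "k + n"]]) (subst power_int_add; auto)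
next
  case (add f g)
  then show ?case using trig_add by (simp add: distrib_left)
qed

lemma trig_mult:
  assumes "trig f" "trig g" shows "trig (\<lambda>t. f t * g t)"
  using assms(1)
proof (induction rule: trig_induct)
  case (cong f h)
  show ?case by (rule trig_cong[OF cong(3)]) (use cong in auto)
next
  case (monom c n)
  show ?case using trig_scale[OF trig_mult_powi[OF assms(2), of n], of c] by (simp add: mult.assoc)
next
  case (add f h)
  then show ?case using trig_add by (simp add: distrib_right)
qed

lemma cnj_circle: "t \<in> circle \<Longrightarrow> cnj t = inverse t"
  using complex_norm_square[of t] by (intro inverse_unique[symmetric]) simp

lemma trig_cnj:
  assumes "trig f" shows "trig (\<lambda>t. cnj (f t))"
  using assms
proof (induction rule: trig_induct)
  case (cong f h)
  show ?case by (rule trig_cong[OF cong(3)]) (use cong in auto)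
next
  case (monom c n)
  show ?case by (rule trig_cong[OF trig_monom[of "cnj c" "-n"]])
      (simp add: cnj_circle power_int_inverse power_int_minus)
next
  case (add f h)
  then show ?case using trig_add by simp
qed

lemma trig_continuous:
  assumes "trig f" shows "continuous_on circle f"
proof -
  obtain N c where "finite N" and f: "\<And>t. t\<in>circle \<Longrightarrow> f t = (\<Sum>n\<in>N. c n * t powi n)"
    using assms unfolding trig_def by metis
  have "continuous_on circle (\<lambda>t. \<Sum>n\<in>N. c n * t powi n)"
    by (intro continuous_intros) auto
  then show ?thesis by (subst continuous_on_cong[OF refl f])
qed

lemma continuous_circle_bounded:
  assumes "continuous_on circle (f :: complex \<Rightarrow> complex)"
  obtains C where "0 \<le> C" "\<And>t. t \<in> circle \<Longrightarrow> norm (f t) \<le> C"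
proof -
  have "bounded (f ` circle)" by (intro compact_imp_bounded compact_continuous_image assms compact_sphere)
  then show ?thesis using that unfolding bounded_pos by (metis imageI less_imp_le)
qed

lemma continuous_circle_Lspace:
  assumes "continuous_on circle f" "0 \<le> p" shows "f \<in> LC p"
proof -
  obtain C where "\<And>t. t \<in> circle \<Longrightarrow> norm (f t) \<le> C" using continuous_circle_bounded[OF assms(1)] by metis
  then show ?thesis using borel_measurable_circle_continuous[OF assms(1)]
    by (intro circle.Lspace_bounded[where C=C] assms) auto
qed

lemma trig_Lspace: "trig f \<Longrightarrow> 0 \<le> p \<Longrightarrow> f \<in> LC p"
  by (intro continuous_circle_Lspace trig_continuous)

text \<open>Stone-Weierstrass gives polynomials in the real coordinates. On the circle these are
  trigonometric polynomials, because Re t = (t + 1/t) / 2 and Im t = (t - 1/t) / (2 i).\<close>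

lemma Weierstrass_circle:
  assumes "continuous_on circle f" "0 < e"
  obtains g where "trig g" "\<And>t. t \<in> circle \<Longrightarrow> norm (f t - g t) < e"
proof -
  obtain g where g: "polynomial_function g" "\<forall>t\<in>circle. norm (f t - g t) < e"
    using Stone_Weierstrass_polynomial_function[OF compact_sphere assms] by auto
  have *: "trig (\<lambda>t. complex_of_real (h t))" if "real_polynomial_function h" for h :: "complex \<Rightarrow> real"
    using that
  proof induction
    case (linear h)
    interpret h: bounded_linear h by fact
    have eq: "complex_of_real (h t) = (of_real (h 1) / 2 + of_real (h \<i>) / (2 * \<i>)) * t powi 1 + (of_real (h 1) / 2 - of_real (h \<i>) / (2 * \<i>)) * t powi (-1)"
      if "t \<in> circle" for t
    proof -
      have "h t = h (Re t *\<^sub>R 1 + Im t *\<^sub>R \<i>)" by (rule arg_cong[where f=h]) (simp add: complex_eq_iff)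
      then have "h t = Re t * h 1 + Im t * h \<i>" by (simp add: h.add h.scaleR)
      then have "complex_of_real (h t) = of_real (Re t) * of_real (h 1) + of_real (Im t) * of_real (h \<i>)" by simp
      moreover have "of_real (Re t) = (t + cnj t) / 2" "of_real (Im t) = (t - cnj t) / (2 * \<i>)"
        by (auto simp: complex_eq_iff)
      ultimately show ?thesis using cnj_circle[OF that]
        by (simp add: power_int_minus algebra_simps add_divide_distrib diff_divide_distrib)
    qed
    show ?case by (rule trig_cong[OF trig_add[OF trig_monom trig_monom]]) (rule eq[symmetric])
  next
    case (mult f g)
    then show ?case using trig_mult by simp
  qed (auto intro: trig_const trig_add)
  have "real_polynomial_function (Re \<circ> g)" "real_polynomial_function (Im \<circ> g)"
    using g(1) bounded_linear_Re bounded_linear_Im unfolding polynomial_function_def by blast+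
  from this[THEN *] have "trig (\<lambda>t. complex_of_real (Re (g t)) + \<i> * complex_of_real (Im (g t)))"
    by (intro trig_add trig_scale) (simp_all add: o_def)
  then have "trig g" by (simp add: complex_eq[symmetric])
  with g(2) that show ?thesis by auto
qed

text \<open>A monotone class argument, used both for density and for uniqueness of Fourier
  coefficients. Closed sets form an intersection-stable generator of the Borel sets, and the sets
  whose indicator satisfies P are closed under complements and countable disjoint unions.\<close>

lemma bounded_limits_indicator:
  fixes P :: "(complex \<Rightarrow> complex) \<Rightarrow> bool"
  assumes cont: "\<And>g. continuous_on circle g \<Longrightarrow> P g"
    and lim: "\<And>s g C. (\<And>n::nat. P (s n)) \<Longrightarrow> (\<And>n. s n \<in> borel_measurable circle_measure) \<Longrightarrow>
       g \<in> borel_measurable circle_measure \<Longrightarrow> (\<And>n t. t \<in> circle \<Longrightarrow> norm (s n t) \<le> C) \<Longrightarrow> (\<And>t. t \<in> circle \<Longrightarrow> (\<lambda>n. s n t) \<longlonglongrightarrow> g t) \<Longrightarrow> P g"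
    and add: "\<And>f g. P f \<Longrightarrow> P g \<Longrightarrow> P (\<lambda>t. f t + g t)"
    and minus: "\<And>f. P f \<Longrightarrow> P (\<lambda>t. - f t)"
    and A: "A \<in> sets circle_measure"
  shows "P (indicator A)"
proof -
  have "P (indicator B)" if "B \<in> sets borel" for B
  proof -
    have "Int_stable (Collect (closed :: complex set \<Rightarrow> bool))" by (auto simp: Int_stable_def)
    moreover have "Collect closed \<subseteq> Pow (UNIV :: complex set)" by simp
    moreover have "B \<in> sigma_sets UNIV (Collect closed)"
      using that by (simp add: borel_eq_closed)
    ultimately show ?thesis
    proof (induction rule: sigma_sets_induct_disjoint)
      case (basic F)
      then have F: "closed F" by simp
      show ?case
      proof (cases "F = {}")
        case True
        then show ?thesis using cont[of "\<lambda>_. 0"] by (auto simp: indicator_def[abs_def])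
      next
        case False
        \<comment> \<open>Continuous ramps that shrink to the indicator of F. The empty set is
          treated separately because \<open>infdist\<close> to it is 0 by convention.\<close>
        let ?s = "\<lambda>n t. complex_of_real (max 0 (1 - real n * infdist t F))"
        show ?thesis
        proof (rule lim[of ?s _ 1])
          have c: "continuous_on circle (?s n)" for n by (intro continuous_intros)
          show "P (?s n)" "?s n \<in> borel_measurable circle_measure" for n
            using cont[OF c] borel_measurable_circle_continuous[OF c] by auto
          show "indicator F \<in> borel_measurable circle_measure"
            using F by (intro borel_measurable_circle_borel) auto
          show "norm (?s n t) \<le> 1" for n t using infdist_nonneg[of t F] by (auto simp: max_def)
          show "(\<lambda>n. ?s n t) \<longlonglongrightarrow> indicator F t" for t
          proof (cases "t \<in> F")
            case True
            then show ?thesis by simp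
          next
            case f: False
            then have pos: "0 < infdist t F"
              using F False by (metis in_closed_iff_infdist_zero infdist_nonneg less_eq_real_def)
            obtain N where N: "1 < real N * infdist t F" using reals_Archimedean3[OF pos] by blast
            have "?s n t = 0" if "N \<le> n" for n
            proof -
              have "real N * infdist t F \<le> real n * infdist t F" using that pos by (intro mult_right_mono) auto
              then have "1 - real n * infdist t F \<le> 0" using N by linarith
              then show ?thesis by (simp only: max_absorb1 of_real_0)
            qed
            then show ?thesis using f by (intro tendsto_eventually) (auto simp: eventually_sequentially)
          qed
        qed
      qed
    next
      case empty
      then show ?case using cont[of "\<lambda>_. 0"] by (auto simp: indicator_def[abs_def])
    next
      case (compl A)
      have "P (\<lambda>t. 1 + - indicator A t)" by (intro add minus compl cont) auto
      moreover have "(\<lambda>t. 1 + - indicator A t) = (indicator (UNIV - A) :: complex \<Rightarrow> complex)"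
        by (auto simp: indicator_def fun_eq_iff)
      ultimately show ?case by simp
    next
      case (union A)
      let ?s = "\<lambda>n t. \<Sum>i<n. indicator (A i) t :: complex"
      have Am: "A i \<in> sets borel" for i using union(2) by (auto simp: borel_eq_closed)
      have seq: "(\<Sum>i<n. indicator (A i) t :: complex) = indicator (\<Union>i<n. A i) t" for n t
        by (rule indicator_UN_disjoint[symmetric]) (use union(1) in \<open>auto simp: disjoint_family_on_def\<close>)
      show ?case
      proof (rule lim[of ?s _ 1])
        show "P (?s n)" for n
        proof (induction n)
          case 0
          show ?case using cont[of "\<lambda>_. 0"] by simp
        next
          case (Suc n)
          then show ?case using add[OF _ union(3)] by simp
        qed
        show "?s n \<in> borel_measurable circle_measure" for n
          using Am by (intro borel_measurable_circle_borel) auto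
        show "indicator (\<Union>i. A i) \<in> borel_measurable circle_measure"
          using Am by (intro borel_measurable_circle_borel) auto
        show "norm (?s n t) \<le> 1" for n t unfolding seq by (simp add: indicator_def)
        show "(\<lambda>n. ?s n t) \<longlonglongrightarrow> indicator (\<Union>i. A i) t" for t
          unfolding seq by (rule LIMSEQ_indicator_UN)
      qed
    qed
  qed
  moreover obtain B where B: "B \<in> sets borel" "A = circle \<inter> B"
    using A by (auto simp: sets_circle sets_restrict_space)
  moreover have "P (indicator A)" if "P (indicator B)"
  \<comment> \<open>A constant sequence: \<open>lim\<close> compares values on the circle only, and
    there the two indicators agree.\<close>
  proof (rule lim[of "\<lambda>n. indicator B" _ 1])
    show "indicator A \<in> borel_measurable circle_measure" using A by simp
    show "indicator B \<in> borel_measurable circle_measure"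
      using B by (intro borel_measurable_circle_borel) auto
    show "norm (indicator B t :: complex) \<le> 1" for t by (simp add: indicator_def)
    show "(\<lambda>n. indicator B t :: complex) \<longlonglongrightarrow> indicator A t" if "t \<in> circle" for t
      using that B by (simp add: indicator_def)
  qed (rule that)
  ultimately show ?thesis by blast
qed

section \<open>Density of the trigonometric polynomials\<close>

lemma Lp_eq: "Lp p = LC p"
  by (simp add: Lp_def Lspace_def)

lemma Lp_norm_eq: "Lp_norm p f = LI p f powr (1 / p)"
  by (simp add: Lp_norm_def Lint_def)

text \<open>The functions that can be approximated form a class D closed under sums, multiples and
  limits. It contains the continuous functions by Weierstrass, hence indicators, simple functions
  and everything.\<close>

lemma trig_dense:
  assumes p: "0 < p" and f: "f \<in> LC p" and e: "0 < e"
  obtains g where "trig g" "LI p (\<lambda>t. f t - g t) < e"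
proof -
  let ?M = circle_measure
  define D where "D f \<longleftrightarrow> f \<in> LC p \<and> (\<forall>e>0. \<exists>g. trig g \<and> LI p (\<lambda>t. f t - g t) < e)" for f
  have p0: "0 \<le> p" using p by simp
  have lim: "D g" if D: "\<And>n::nat. D (s n)" and g: "g \<in> LC p"
    and l: "(\<lambda>n. LI p (\<lambda>t. s n t - g t)) \<longlonglongrightarrow> 0" for s g
    unfolding D_def
  proof (intro conjI allI impI g)
    fix e :: real assume "0 < e"
    \<comment> \<open>Two errors of this size, multiplied by the quasi-triangle constant 2^p, add up
      to e.\<close>
    let ?d = "e / (2 powr p * 2)"
    have d: "0 < ?d" using \<open>0 < e\<close> by simp
    obtain n where n: "LI p (\<lambda>t. s n t - g t) < ?d"
      using order_tendstoD(2)[OF l d] by (auto simp: eventually_sequentially)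
    obtain h where h: "trig h" "LI p (\<lambda>t. s n t - h t) < ?d" using D[of n] d unfolding D_def by blast
    have L: "s n \<in> LC p" "h \<in> LC p" using D h trig_Lspace p0 by (auto simp: D_def)
    have "LI p (\<lambda>t. g t - h t) = LI p (\<lambda>t. (g t - s n t) + (s n t - h t))" by simp
    also have "\<dots> \<le> 2 powr p * (LI p (\<lambda>t. g t - s n t) + LI p (\<lambda>t. s n t - h t))"
      by (intro Lspace_add p0 Lspace_diff L g)
    also have "\<dots> < 2 powr p * (?d + ?d)"
      using n h(2) by (intro mult_strict_left_mono add_strict_mono) (auto simp: Lint_minus_commute[of p ?M g])
    also have "\<dots> = e" by (simp add: field_simps)
    finally show "\<exists>h. trig h \<and> LI p (\<lambda>t. g t - h t) < e" using h by blast
  qed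
  have add: "D (\<lambda>t. f t + g t)" if f: "D f" and g: "D g" for f g
    unfolding D_def
  proof (intro conjI allI impI)
    show "(\<lambda>t. f t + g t) \<in> LC p" using f g by (intro Lspace_add p0) (auto simp: D_def)
    fix e :: real assume "0 < e"
    let ?d = "e / (2 powr p * 2)"
    have d: "0 < ?d" using \<open>0 < e\<close> by simp
    obtain h k where h: "trig h" "LI p (\<lambda>t. f t - h t) < ?d" and k: "trig k" "LI p (\<lambda>t. g t - k t) < ?d"
      using f g d unfolding D_def by blast
    have L: "f \<in> LC p" "g \<in> LC p" "h \<in> LC p" "k \<in> LC p"
      using f g h k trig_Lspace p0 by (auto simp: D_def)
    have "LI p (\<lambda>t. (f t + g t) - (h t + k t)) = LI p (\<lambda>t. (f t - h t) + (g t - k t))"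
      by (simp add: algebra_simps)
    also have "\<dots> \<le> 2 powr p * (LI p (\<lambda>t. f t - h t) + LI p (\<lambda>t. g t - k t))"
      by (intro Lspace_add p0 Lspace_diff L)
    also have "\<dots> < 2 powr p * (?d + ?d)"
      using h k by (intro mult_strict_left_mono add_strict_mono) auto
    also have "\<dots> = e" by (simp add: field_simps)
    finally show "\<exists>h. trig h \<and> LI p (\<lambda>t. (f t + g t) - h t) < e" using trig_add h k by blast
  qed
  have scale: "D (\<lambda>t. c * f t)" if f: "D f" for c f
    unfolding D_def
  proof (intro conjI allI impI)
    show "(\<lambda>t. c * f t) \<in> LC p" using f by (intro Lspace_scale) (auto simp: D_def)
    fix e :: real assume "0 < e"
    let ?d = "e / (norm c powr p + 1)"
    have c0: "0 < norm c powr p + 1" by (smt (verit) powr_ge_zero)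
    then have d: "0 < ?d" using \<open>0 < e\<close> by simp
    obtain h where h: "trig h" "LI p (\<lambda>t. f t - h t) < ?d" using f d unfolding D_def by blast
    have "LI p (\<lambda>t. c * f t - c * h t) = norm c powr p * LI p (\<lambda>t. f t - h t)"
      unfolding Lint_scale[symmetric] by (simp add: right_diff_distrib)
    also have "\<dots> \<le> norm c powr p * ?d" using h by (intro mult_left_mono) auto
    also have "\<dots> < (norm c powr p + 1) * ?d" using d by (intro mult_strict_right_mono) auto
    also have "\<dots> = e" using c0 by simp
    finally show "\<exists>h. trig h \<and> LI p (\<lambda>t. c * f t - h t) < e" using trig_scale h by blast
  qed
  have ind: "D (indicator A)" if "A \<in> sets ?M" for A
  proof (rule bounded_limits_indicator[OF _ _ _ _ that])
    fix g :: "complex \<Rightarrow> complex" assume g: "continuous_on circle g"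
    show "D g" unfolding D_def
    proof (intro conjI allI impI)
      show "g \<in> LC p" by (rule continuous_circle_Lspace[OF g p0])
      fix e :: real assume "0 < e"
      define d where "d = (e / 2) powr (1/p)"
      have d: "0 < d" "d powr p = e / 2" using \<open>0 < e\<close> p by (auto simp: d_def powr_powr)
      obtain h where h: "trig h" "\<And>t. t \<in> circle \<Longrightarrow> norm (g t - h t) < d" using Weierstrass_circle[OF g d(1)] by metis
      have L: "(\<lambda>t. g t - h t) \<in> LC p"
        by (intro Lspace_diff p0 continuous_circle_Lspace g trig_continuous h)
      have "LI p (\<lambda>t. g t - h t) \<le> (LINT t|?M. e / 2)"
        unfolding Lint_def d(2)[symmetric]
        by (rule integral_mono[OF Lspace_integrable[OF L]]) (use h p0 in \<open>auto intro!: powr_mono2 less_imp_le[OF h(2)]\<close>)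
      then have "LI p (\<lambda>t. g t - h t) < e" using \<open>0 < e\<close> by simp
      then show "\<exists>h. trig h \<and> LI p (\<lambda>t. g t - h t) < e" using h by blast
    qed
  next
    fix s :: "nat \<Rightarrow> complex \<Rightarrow> complex" and g C
    assume s: "\<And>n. D (s n)" and sm: "\<And>n. s n \<in> borel_measurable ?M" and g: "g \<in> borel_measurable ?M"
      and C: "\<And>n t. t \<in> circle \<Longrightarrow> norm (s n t) \<le> C" and l: "\<And>t. t \<in> circle \<Longrightarrow> (\<lambda>n. s n t) \<longlonglongrightarrow> g t"
    have Cg: "norm (g t) \<le> C" if "t \<in> circle" for t
      using tendsto_upperbound[OF tendsto_norm[OF l[OF that]], of C] C[OF that] by auto
    have gL: "g \<in> LC p" by (rule circle.Lspace_bounded[OF g _ p0, of C]) (use Cg in auto)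
    have "(\<lambda>n. LI p (\<lambda>t. s n t - g t)) \<longlonglongrightarrow> (LINT t|?M. 0)"
      unfolding Lint_def
    proof (rule integral_dominated_convergence)
      show "integrable ?M (\<lambda>t. (2 * C) powr p)" by simp
      show "AE t in ?M. (\<lambda>n. norm (s n t - g t) powr p) \<longlonglongrightarrow> 0"
      proof (rule AE_I2)
        fix t assume "t \<in> space ?M"
        then have "(\<lambda>n. s n t - g t) \<longlonglongrightarrow> 0" using l by (simp add: LIM_zero)
        from tendsto_powr_0[OF tendsto_norm_zero[OF this] p] show "(\<lambda>n. norm (s n t - g t) powr p) \<longlonglongrightarrow> 0" by simp
      qed
      show "AE t in ?M. norm (norm (s n t - g t) powr p) \<le> (2 * C) powr p" for n
      proof (rule AE_I2)
        fix t assume "t \<in> space ?M"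
        then have "norm (s n t - g t) \<le> 2 * C" using C[of t n] Cg[of t] norm_triangle_ineq4[of "s n t" "g t"] by simp
        then show "norm (norm (s n t - g t) powr p) \<le> (2 * C) powr p" using p0 by (auto intro: powr_mono2)
      qed
    qed (use sm g in auto)
    then show "D g" using lim[OF s gL] by simp
  next
    show "D (\<lambda>t. f t + g t)" if "D f" "D g" for f g using add that by blast
    show "D (\<lambda>t. - f t)" if "D f" for f using scale[OF that, of "-1"] by simp
  qed
  have cong: "D g" if "D f" "\<And>t. t \<in> circle \<Longrightarrow> f t = g t" for f g
  proof (rule lim[of "\<lambda>_. f"])
    have m: "f \<in> borel_measurable ?M" using that(1) by (auto simp: D_def)
    have "g \<in> borel_measurable ?M" by (rule measurable_cong[THEN iffD1, OF _ m]) (use that in auto)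
    then show "g \<in> LC p" using Lspace_cong_AE(1)[of f p ?M g] that AE_I2[of ?M "\<lambda>t. f t = g t"] by (auto simp: D_def)
    have "LI p (\<lambda>t. f t - g t) = (LINT t|?M. 0)"
      unfolding Lint_def by (rule Bochner_Integration.integral_cong) (use that in auto)
    then show "(\<lambda>n::nat. LI p (\<lambda>t. f t - g t)) \<longlonglongrightarrow> 0" by simp
  qed (rule that)
  have simp: "D s" if s: "simple_function ?M s" for s
  proof (rule cong)
    let ?A = "\<lambda>y. s -` {y} \<inter> space ?M"
    have fin: "finite (s ` space ?M)" and A: "?A y \<in> sets ?M" for y
      using simple_functionD[OF s] by auto
    have D0: "D (\<lambda>t. 0)" using ind[of "{}"] by (simp add: indicator_def[abs_def])
    have "D (\<lambda>t. \<Sum>y\<in>F. y * indicator (?A y) t)" if "finite F" for F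
      using that
    proof induction
      case (insert y F)
      show ?case unfolding sum.insert[OF insert.hyps] by (rule add[OF scale[OF ind[OF A]] insert.IH])
    qed (simp only: sum.empty D0)
    then show "D (\<lambda>t. \<Sum>y\<in>s ` space ?M. y * indicator (?A y) t)" using fin by blast
    fix t assume t: "t \<in> circle"
    have "s t = (\<Sum>y\<in>s ` space ?M. indicator (?A y) t *\<^sub>R y)"
      by (rule simple_function_indicator_representation_banach[OF s]) (use t in simp)
    also have "\<dots> = (\<Sum>y\<in>s ` space ?M. y * indicator (?A y) t)"
      by (rule sum.cong) (auto simp: scaleR_conv_of_real indicator_def)
    finally show "(\<Sum>y\<in>s ` space ?M. y * indicator (?A y) t) = s t" by (rule sym)
  qed
  have fm: "f \<in> borel_measurable ?M" using f by (simp add: Lspace_def)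
  from borel_measurable_implies_sequence_metric[OF this, of 0] obtain s where
    s: "\<forall>n. simple_function ?M (s n)" "\<forall>x\<in>space ?M. (\<lambda>n. s n x) \<longlonglongrightarrow> f x"
      "\<forall>n. \<forall>x\<in>space ?M. norm (s n x) \<le> 2 * norm (f x)"
    by (auto simp: dist_norm)
  have l: "(\<lambda>n. LI p (\<lambda>t. s n t - f t)) \<longlonglongrightarrow> 0"
    by (rule Lint_dominated_convergence(1)[OF p f, of s])
      (use s in \<open>auto intro: borel_measurable_simple_function\<close>)
  have "D f"
    by (rule lim[OF simp f l]) (use s in blast)
  then show ?thesis using that e unfolding D_def by blast
qed

section \<open>Fourier coefficients and uniqueness\<close>

lemma norm_powi_circle [simp]: "norm t = 1 \<Longrightarrow> norm (t powi n) = 1" for t :: complex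
  by (simp add: norm_power_int)

lemma powi_measurable_circle [measurable]: "(\<lambda>t. t powi n) \<in> borel_measurable circle_measure"
  by (intro borel_measurable_circle_continuous continuous_intros) auto

lemma integrable_mult_powi:
  "integrable circle_measure f \<Longrightarrow> integrable circle_measure (\<lambda>t. f t * t powi n)"
  by (rule Bochner_Integration.integrable_bound) (auto simp: norm_mult)

lemma fourier_coeff_add:
  assumes "integrable circle_measure f" "integrable circle_measure g"
  shows "fourier_coeff (\<lambda>t. f t + g t) n = fourier_coeff f n + fourier_coeff g n"
  using assms[THEN integrable_mult_powi] by (simp add: fourier_coeff_def distrib_right)

lemma fourier_coeff_diff:
  assumes "integrable circle_measure f" "integrable circle_measure g"
  shows "fourier_coeff (\<lambda>t. f t - g t) n = fourier_coeff f n - fourier_coeff g n"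
  using assms[THEN integrable_mult_powi] by (simp add: fourier_coeff_def left_diff_distrib)

lemma fourier_coeff_scale: "fourier_coeff (\<lambda>t. c * f t) n = c * fourier_coeff f n"
  by (simp add: fourier_coeff_def mult.assoc)

lemma fourier_coeff_cong_AE:
  assumes "f \<in> borel_measurable circle_measure" "g \<in> borel_measurable circle_measure" "ae_eq f g"
  shows "fourier_coeff f n = fourier_coeff g n"
  unfolding fourier_coeff_def
  by (rule integral_cong_AE) (use assms in \<open>auto simp: ae_eq_def elim!: eventually_mono\<close>)

lemma fourier_coeff_cong:
  "(\<And>t. t \<in> circle \<Longrightarrow> f t = g t) \<Longrightarrow> fourier_coeff f n = fourier_coeff g n"
  unfolding fourier_coeff_def by (rule Bochner_Integration.integral_cong) auto

lemma fourier_coeff_norm_le: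
  assumes "integrable circle_measure f"
  shows "norm (fourier_coeff f n) \<le> (LINT t|circle_measure. norm (f t))"
proof -
  have "norm (fourier_coeff f n) \<le> (LINT t|circle_measure. norm (f t * t powi (-n)))"
    unfolding fourier_coeff_def by (rule integral_norm_bound)
  also have "\<dots> = (LINT t|circle_measure. norm (f t))"
    by (rule Bochner_Integration.integral_cong) (auto simp: norm_mult)
  finally show ?thesis .
qed

lemma fourier_coeff_mult_powi: "fourier_coeff (\<lambda>t. t powi k * f t) n = fourier_coeff f (n - k)"
  unfolding fourier_coeff_def
proof (rule Bochner_Integration.integral_cong[OF refl])
  fix t assume "t \<in> space circle_measure"
  then have "t \<noteq> 0" by auto
  then have "t powi (- (n - k)) = t powi k * t powi (- n)" by (subst power_int_add[symmetric]) auto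
  then show "t powi k * f t * t powi - n = f t * t powi - (n - k)" by simp
qed

lemma fourier_coeff_cnj: "fourier_coeff (\<lambda>t. cnj (f t)) n = cnj (fourier_coeff f (- n))"
proof -
  have "fourier_coeff (\<lambda>t. cnj (f t)) n = (LINT t|circle_measure. cnj (f t * t powi n))"
    unfolding fourier_coeff_def
  proof (rule Bochner_Integration.integral_cong[OF refl])
    fix t assume "t \<in> space circle_measure"
    then show "cnj (f t) * t powi - n = cnj (f t * t powi n)"
      by (simp add: cnj_circle power_int_inverse power_int_minus)
  qed
  also have "\<dots> = cnj (LINT t|circle_measure. f t * t powi n)" by (rule Bochner_Integration.integral_cnj)
  finally show ?thesis by (simp add: fourier_coeff_def[of f])
qed

lemma fourier_coeff_inverse:
  assumes "f \<in> borel_measurable circle_measure"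
  shows "fourier_coeff (\<lambda>t. f (inverse t)) n = fourier_coeff f (- n)"
proof -
  have "fourier_coeff (\<lambda>t. f (inverse t)) n = (LINT t|circle_measure. f (inverse t) * (inverse t) powi n)"
    unfolding fourier_coeff_def by (simp add: power_int_inverse power_int_minus)
  also have "\<dots> = (LINT t|circle_measure. f t * t powi n)"
    by (rule integral_inverse_circle) (use assms in measurable)
  finally show ?thesis by (simp add: fourier_coeff_def)
qed

lemma fourier_coeff_flip:
  assumes "f \<in> borel_measurable circle_measure"
  shows "fourier_coeff (flip f) n = fourier_coeff f (- n - 1)"
proof -
  have "flip f = (\<lambda>t. t powi (-1) * f (inverse t))" by (simp add: flip_def power_int_minus)
  then show ?thesis using fourier_coeff_mult_powi[of "-1" "\<lambda>t. f (inverse t)" n] fourier_coeff_inverse[OF assms]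
    by simp
qed

lemma fourier_coeff_monom: "fourier_coeff (\<lambda>t. c * t powi k) n = (if n = k then c else 0)"
  using fourier_coeff_mult_powi[of k "\<lambda>t. c" n] integral_powi_circle[of "k - n"]
  by (simp add: mult.commute) (simp add: fourier_coeff_def)

lemma trig_integrable: "trig f \<Longrightarrow> integrable circle_measure f"
  using circle.Lspace_integrable1[OF trig_Lspace, of f 1] by simp

lemma fourier_coeff_trig_sum:
  assumes "finite N"
  shows "fourier_coeff (\<lambda>t. \<Sum>k\<in>N. c k * t powi k) n = (if n \<in> N then c n else 0)"
  using assms
proof induction
  case (insert k N)
  have "fourier_coeff (\<lambda>t. \<Sum>k\<in>insert k N. c k * t powi k) n
      = fourier_coeff (\<lambda>t. c k * t powi k) n + fourier_coeff (\<lambda>t. \<Sum>k\<in>N. c k * t powi k) n"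
    unfolding sum.insert[OF insert.hyps]
    by (intro fourier_coeff_add trig_integrable trig_monom trig_sum_powi insert.hyps)
  then show ?case using insert by (auto simp: fourier_coeff_monom)
qed (simp add: fourier_coeff_def)

lemma trig_fourier:
  assumes "trig f"
  obtains N where "finite N" "\<And>t. t \<in> circle \<Longrightarrow> f t = (\<Sum>n\<in>N. fourier_coeff f n * t powi n)"
    "\<And>n. n \<notin> N \<Longrightarrow> fourier_coeff f n = 0"
proof -
  obtain N c where N: "finite N" "\<forall>t\<in>circle. f t = (\<Sum>n\<in>N. c n * t powi n)"
    using assms unfolding trig_def by metis
  have *: "fourier_coeff f n = (if n \<in> N then c n else 0)" for n
    using fourier_coeff_cong[of f "\<lambda>t. \<Sum>n\<in>N. c n * t powi n"] fourier_coeff_trig_sum[OF N(1)] N(2) by simp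
  show ?thesis by (rule that[of N]) (use N * in auto)
qed

text \<open>Vanishing coefficients mean that f integrates to zero against trigonometric polynomials,
  hence against continuous functions, hence over every measurable set. Only integrability is
  assumed, so products of an \<open>L^p\<close> and an \<open>L^q\<close> function are
  covered.\<close>

lemma fourier_zero:
  assumes f: "integrable circle_measure f" and z: "\<And>n. fourier_coeff f n = 0"
  shows "AE t in circle_measure. f t = 0"
proof -
  let ?M = circle_measure
  have fm[measurable]: "f \<in> borel_measurable ?M" using f by auto
  define P where "P g \<longleftrightarrow> g \<in> borel_measurable ?M \<and> integrable ?M (\<lambda>t. f t * g t) \<and> (LINT t|?M. f t * g t) = 0" for g
  have bnd: "integrable ?M (\<lambda>t. f t * g t)"
    if "g \<in> borel_measurable ?M" "\<And>t. t \<in> circle \<Longrightarrow> norm (g t) \<le> C" for g C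
  proof (rule Bochner_Integration.integrable_bound[of _ "\<lambda>t. of_real C * f t"])
    show "AE t in ?M. norm (f t * g t) \<le> norm (of_real C * f t)"
    proof (rule AE_I2)
      fix t assume "t \<in> space ?M"
      then have "norm (g t) \<le> \<bar>C\<bar>" using that(2)[of t] by simp
      then show "norm (f t * g t) \<le> norm (of_real C * f t)"
        using mult_right_mono[of "norm (g t)" "\<bar>C\<bar>" "norm (f t)"] by (simp add: norm_mult mult.commute)
    qed
  qed (use f that in auto)
  have contb: "integrable ?M (\<lambda>t. f t * g t)" if g: "continuous_on circle g" for g
  proof -
    obtain C where "\<And>t. t \<in> circle \<Longrightarrow> norm (g t) \<le> C" using continuous_circle_bounded[OF g] by metis
    then show ?thesis using bnd borel_measurable_circle_continuous[OF g] by blast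
  qed
  have trigP: "(LINT t|?M. f t * g t) = 0" if "trig g" for g
    using that
  proof (induction rule: trig_induct)
    case (cong g h)
    then show ?case using Bochner_Integration.integral_cong[of ?M ?M "\<lambda>t. f t * g t" "\<lambda>t. f t * h t"] by auto
  next
    case (monom c n)
    show ?case using z[of "-n"] integral_mult_right_zero[of ?M c "\<lambda>t. f t * t powi n"]
      by (simp add: fourier_coeff_def mult.left_commute)
  next
    case (add g h)
    then show ?case using contb[OF trig_continuous] by (simp add: distrib_left)
  qed
  have P: "P (indicator A)" if "A \<in> sets ?M" for A
  proof (rule bounded_limits_indicator[OF _ _ _ _ that])
    fix g :: "complex \<Rightarrow> complex" assume g: "continuous_on circle g"
    have "norm (LINT t|?M. f t * g t) \<le> 0"
    proof (rule field_le_epsilon)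
      fix e :: real assume "0 < e"
      define L where "L = (LINT t|?M. norm (f t))"
      have L: "0 \<le> L" unfolding L_def by simp
      \<comment> \<open>Division by L + 1 instead of L, since the integral L of |f| may be
        zero.\<close>
      have "0 < e / (L + 1)" using \<open>0 < e\<close> L by simp
      then obtain h where h: "trig h" "\<And>t. t \<in> circle \<Longrightarrow> norm (g t - h t) < e / (L + 1)"
        using Weierstrass_circle[OF g] by metis
      have i: "integrable ?M (\<lambda>t. f t * (g t - h t))"
        by (rule contb[OF continuous_on_diff[OF g trig_continuous[OF h(1)]]])
      have "norm (LINT t|?M. f t * g t) = norm (LINT t|?M. f t * (g t - h t))"
        using contb[OF g] contb[OF trig_continuous[OF h(1)]] trigP[OF h(1)] by (simp add: right_diff_distrib)
      also have "\<dots> \<le> (LINT t|?M. norm (f t * (g t - h t)))" by (rule integral_norm_bound)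
      also have "\<dots> \<le> (LINT t|?M. norm (f t) * (e / (L + 1)))"
      proof (rule integral_mono)
        show "integrable ?M (\<lambda>t. norm (f t * (g t - h t)))" using i by (rule integrable_norm)
        show "norm (f t * (g t - h t)) \<le> norm (f t) * (e / (L + 1))" if "t \<in> space ?M" for t
          unfolding norm_mult using h(2)[of t] that by (intro mult_left_mono) auto
      qed (use f in auto)
      also have "\<dots> = L * (e / (L + 1))" by (simp add: L_def)
      also have "\<dots> \<le> e" using L \<open>0 < e\<close> by (simp add: field_simps)
      finally show "norm (LINT t|?M. f t * g t) \<le> 0 + e" by simp
    qed
    then show "P g" using contb[OF g] borel_measurable_circle_continuous[OF g] by (simp add: P_def)
  next
    fix s :: "nat \<Rightarrow> complex \<Rightarrow> complex" and g C
    assume s: "\<And>n. P (s n)" and sm: "\<And>n. s n \<in> borel_measurable ?M" and g: "g \<in> borel_measurable ?M"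
      and C: "\<And>n t. t \<in> circle \<Longrightarrow> norm (s n t) \<le> C" and l: "\<And>t. t \<in> circle \<Longrightarrow> (\<lambda>n. s n t) \<longlonglongrightarrow> g t"
    note [measurable] = sm g
    have Cg: "norm (g t) \<le> C" if "t \<in> circle" for t
      using tendsto_upperbound[OF tendsto_norm[OF l[OF that]], of C] C[OF that] by auto
    have "(\<lambda>n. LINT t|?M. f t * s n t) \<longlonglongrightarrow> (LINT t|?M. f t * g t)"
    proof (rule integral_dominated_convergence)
      show "integrable ?M (\<lambda>t. norm (f t) * C)" using f by auto
      show "AE t in ?M. (\<lambda>n. f t * s n t) \<longlonglongrightarrow> f t * g t" by (intro AE_I2 tendsto_intros l) simp
      show "AE t in ?M. norm (f t * s n t) \<le> norm (f t) * C" for n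
        using C by (intro AE_I2) (auto simp: norm_mult intro!: mult_left_mono)
    qed auto
    moreover have "(\<lambda>n. LINT t|?M. f t * s n t) = (\<lambda>n. 0)" using s by (simp add: P_def)
    ultimately have "(LINT t|?M. f t * g t) = 0" using LIMSEQ_unique tendsto_const by metis
    then show "P g" using g bnd[OF g Cg] by (simp add: P_def)
  next
    show "P (\<lambda>t. u t + v t)" if "P u" "P v" for u v using that by (auto simp: P_def distrib_left)
    show "P (\<lambda>t. - u t)" if "P u" for u using that by (auto simp: P_def)
  qed
  have "set_lebesgue_integral ?M A f = set_lebesgue_integral ?M A (\<lambda>t. 0)" if "A \<in> sets ?M" for A
  proof -
    have "complex_of_real (indicator A t) = indicator A t" for t by (auto simp: indicator_def)
    then show ?thesis using P[OF that] by (simp add: P_def set_lebesgue_integral_def scaleR_conv_of_real mult.commute)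
  qed
  then show ?thesis using circle.density_unique_banach[OF f, of "\<lambda>t. 0"] by auto
qed

lemma fourier_unique:
  assumes "integrable circle_measure f" "integrable circle_measure g" "\<And>n. fourier_coeff f n = fourier_coeff g n"
  shows "ae_eq f g"
  using fourier_zero[of "\<lambda>t. f t - g t"] assms fourier_coeff_diff[OF assms(1,2)]
  by (auto simp: ae_eq_def)

text \<open>Beyond the degree of an approximating trigonometric polynomial g, a coefficient of f is
  one of f - g, hence at most the integral of |f - g|. It serves together with
  \<open>alternating_null\<close>.\<close>

lemma Riemann_Lebesgue:
  assumes f: "integrable circle_measure f"
  shows "(\<lambda>n. fourier_coeff f (int n)) \<longlonglongrightarrow> 0"
proof (rule LIMSEQ_I)
  fix e :: real assume e: "0 < e"
  have "f \<in> LC 1" using f by (auto intro!: LspaceI)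
  then obtain g where g: "trig g" "LI 1 (\<lambda>t. f t - g t) < e"
    using trig_dense[of 1 f e] e by auto
  obtain N where N: "finite N" "\<And>n. n \<notin> N \<Longrightarrow> fourier_coeff g n = 0" using trig_fourier[OF g(1)] by metis
  obtain B where B: "\<And>n. n \<in> N \<Longrightarrow> n \<le> B" using bdd_above_finite[OF N(1)] by (auto simp: bdd_above_def)
  define K where "K = nat (B + 1)"
  have K: "n < int K" if "n \<in> N" for n using B[OF that] by (simp add: K_def)
  have "norm (fourier_coeff f (int n)) < e" if "K \<le> n" for n
  proof -
    have "int n \<notin> N" using K[of "int n"] that by auto
    then have "fourier_coeff f (int n) = fourier_coeff (\<lambda>t. f t - g t) (int n)"
      using N(2) fourier_coeff_diff[OF f trig_integrable[OF g(1)]] by simp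
    also have "norm \<dots> \<le> (LINT t|circle_measure. norm (f t - g t))"
      using f trig_integrable[OF g(1)] by (intro fourier_coeff_norm_le) auto
    also have "\<dots> < e" using g(2) by (simp add: Lint_def)
    finally show ?thesis .
  qed
  then show "\<exists>no. \<forall>n\<ge>no. norm (fourier_coeff f (int n) - 0) < e" by auto
qed

lemma tendsto_fourier_coeff:
  assumes p: "1 < p" and s: "\<And>n. s n \<in> LC p" and f: "f \<in> LC p"
    and l: "(\<lambda>n. LI p (\<lambda>x. s n x - f x)) \<longlonglongrightarrow> 0"
  shows "(\<lambda>n. fourier_coeff (s n) k) \<longlonglongrightarrow> fourier_coeff f k"
  unfolding fourier_coeff_def
proof (rule tendsto_Lint_integral[OF p _ s f l])
  define q where "q = 1 / (1 - 1/p)"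
  show "1 / p + 1 / q = 1" by (simp add: q_def)
  show "(\<lambda>t. t powi - k) \<in> LC q"
    using p by (intro continuous_circle_Lspace continuous_intros) (auto simp: q_def)
qed

section \<open>The theorem of M. Riesz\<close>

lemma mean_value_circle:
  assumes cont: "continuous_on (cball 0 1) G" and hol: "G holomorphic_on ball 0 1"
  shows "(LINT t|circle_measure. G t) = G 0"
proof -
  have c: "continuous_on circle G" by (rule continuous_on_subset[OF cont]) auto
  have cc: "continuous_on {0..2*pi} (\<lambda>x. G (cis x))"
    by (rule continuous_on_compose2[OF c]) (auto intro!: continuous_intros)
  have "((\<lambda>u. G u / (u - 0)) has_contour_integral (2 * of_real pi * \<i> * G 0)) (circlepath 0 1)"
    by (rule Cauchy_integral_circlepath[OF cont hol]) simp
  then have "((\<lambda>t. G (cis t) / cis t * \<i> * cis t) has_integral (2 * of_real pi * \<i> * G 0)) {0..2*pi}"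
    unfolding circlepath_def by (subst (asm) has_contour_integral_part_circlepath_iff) auto
  then have "((\<lambda>t. \<i> * G (cis t)) has_integral (2 * of_real pi * \<i> * G 0)) {0..2*pi}"
    by (rule has_integral_eq[rotated]) simp
  from has_integral_mult_right[OF this, of "- \<i>"]
  have "((\<lambda>t. - \<i> * (\<i> * G (cis t))) has_integral (- \<i> * (2 * of_real pi * \<i> * G 0))) {0..2*pi}" .
  moreover have "- \<i> * (2 * of_real pi * \<i> * G 0) = 2 * of_real pi * G 0" by (simp add: algebra_simps)
  moreover have "- \<i> * (\<i> * x) = x" for x by simp
  ultimately have "((\<lambda>t. G (cis t)) has_integral (2 * of_real pi * G 0)) {0..2*pi}" by (simp only:)
  then have "integral {0..2*pi} (\<lambda>t. G (cis t)) = 2 * of_real pi * G 0" by (rule integral_unique)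
  moreover have "(LINT x:{0..2*pi}|lborel. G (cis x)) = integral {0..2*pi} (\<lambda>t. G (cis t))"
    by (rule set_borel_integral_eq_integral(2)[OF borel_integrable_atLeastAtMost'[OF cc]])
  moreover have "(LINT x:{0..<2*pi}|lborel. G (cis x)) = (LINT x:{0..2*pi}|lborel. G (cis x))"
    unfolding set_lebesgue_integral_def
  proof (rule integral_cong_AE)
    show "AE x in lborel. indicat_real {0..<2 * pi} x *\<^sub>R G (cis x) = indicat_real {0..2 * pi} x *\<^sub>R G (cis x)"
      using AE_lborel_singleton[of "2*pi"] by eventually_elim (auto simp: indicator_def)
    have "(\<lambda>x. G (cis x)) \<in> borel_measurable (uniform_measure lborel {0..<2 * pi})"
      by (rule measurable_compose[OF cis_measurable])
        (use borel_measurable_circle_continuous[OF c] in \<open>simp add: measurable_circle_iff\<close>)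
    then have [measurable]: "(\<lambda>x. G (cis x)) \<in> borel_measurable borel" by simp
    show "(\<lambda>x. indicat_real {0..<2 * pi} x *\<^sub>R G (cis x)) \<in> borel_measurable lborel"
      "(\<lambda>x. indicat_real {0..2 * pi} x *\<^sub>R G (cis x)) \<in> borel_measurable lborel" by simp_all
  qed
  ultimately show ?thesis
    by (simp add: lebesgue_integral_circle[OF borel_measurable_circle_continuous[OF c]] scaleR_conv_of_real)
qed

text \<open>The bound for the conjugate function of a positive function follows by integrating this
  inequality along the values of the analytic completion, as \<open>w powr p\<close> has a mean value with
  nonnegative real part.\<close>

lemma powr_half_plane_bound:
  fixes p :: real
  assumes "1 < p" "p \<le> 2"
  obtains a b where "0 \<le> a" "0 \<le> b"
    "\<And>w. 0 < Re w \<Longrightarrow> norm w powr p \<le> a * Re w powr p - b * Re (w powr of_real p)"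
proof -
  \<comment> \<open>The midpoint between pi/(2p) and pi/2. Beyond it p times the angle lies in
    (pi/2, pi], as p <= 2, so cos(p theta) is negative and bounded away from 0. Below it cos(theta)
    is bounded away from 0.\<close>
  define \<theta>0 where "\<theta>0 = (pi / 2 / p + pi / 2) / 2"
  have "pi / 2 / p < pi / 2" using assms by (simp add: field_simps)
  then have th: "0 < \<theta>0" "\<theta>0 < pi / 2" "pi / 2 / p < \<theta>0"
    using assms unfolding \<theta>0_def by (auto simp: add_pos_pos)
  have pth: "pi / 2 < p * \<theta>0" using th(3) assms by (simp add: field_simps)
  have pth2: "p * \<theta>0 \<le> pi"
    using mult_mono[of p 2 \<theta>0 "pi/2"] assms th by simp
  define \<kappa> where "\<kappa> = - cos (p * \<theta>0)"
  have k: "0 < \<kappa>" using cos_lt_zero_pi[of "p * \<theta>0"] pth pth2 pi_gt_zero unfolding \<kappa>_def by linarith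
  define b where "b = 1 / \<kappa>"
  \<comment> \<open>With b = 1/kappa the term - b cos(p theta) is at least 1 for large angles. For
    small angles it may be as low as -b, so a is chosen such that a cos(theta)^p is at least 1 +
    b.\<close>
  define a where "a = (1 + b) / cos \<theta>0 powr p"
  have c0: "0 < cos \<theta>0" using th by (intro cos_gt_zero) auto
  have b0: "0 < b" using k by (simp add: b_def)
  have a0: "0 < a" using b0 c0 by (simp add: a_def)
  have main: "1 \<le> a * cos \<theta> powr p - b * cos (p * \<theta>)" if "0 \<le> \<theta>" "\<theta> < pi / 2" for \<theta>
  proof (cases "\<theta>0 \<le> \<theta>")
    case True
    have "p * \<theta> \<le> pi" using mult_mono[of p 2 \<theta> "pi/2"] assms that by simp
    then have "cos (p * \<theta>) \<le> cos (p * \<theta>0)"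
      using True assms th by (intro cos_monotone_0_pi_le) auto
    then have "\<kappa> \<le> - cos (p * \<theta>)" by (simp add: \<kappa>_def)
    then have "1 \<le> b * - cos (p * \<theta>)" using k by (simp add: b_def field_simps)
    moreover have "0 \<le> a * cos \<theta> powr p" using a0 by simp
    ultimately show ?thesis by simp
  next
    case False
    have "cos \<theta>0 \<le> cos \<theta>" using False that th pi_gt_zero by (intro cos_monotone_0_pi_le) linarith+
    then have "cos \<theta>0 powr p \<le> cos \<theta> powr p" using c0 assms by (intro powr_mono2) auto
    then have "a * cos \<theta>0 powr p \<le> a * cos \<theta> powr p" using a0 by simp
    then have "1 + b \<le> a * cos \<theta> powr p" using c0 by (simp add: a_def)
    moreover have "b * cos (p * \<theta>) \<le> b * 1" using b0 by (intro mult_left_mono) auto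
    ultimately show ?thesis by simp
  qed
  show ?thesis
  proof (rule that[of a b])
    fix w :: complex assume w: "0 < Re w"
    then have w0: "w \<noteq> 0" by auto
    define \<theta> where "\<theta> = \<bar>Im (Ln w)\<bar>"
    have th': "0 \<le> \<theta>" "\<theta> < pi / 2" using Re_Ln_pos_lt[OF w0] w by (auto simp: \<theta>_def)
    have cosabs: "cos \<bar>x\<bar> = cos x" for x :: real by (simp add: abs_if)
    have Rew: "Re w = norm w * cos \<theta>"
    proof -
      have "w = exp (Ln w)" using w0 by simp
      then have "Re w = exp (Re (Ln w)) * cos (Im (Ln w))" by (metis Re_exp)
      then show ?thesis using w0 by (simp add: \<theta>_def cosabs)
    qed
    have Rp: "Re (w powr of_real p) = norm w powr p * cos (p * \<theta>)"
    proof -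
      have "w powr of_real p = exp (of_real p * Ln w)" using w0 by (simp add: powr_def)
      then have "Re (w powr of_real p) = exp (p * Re (Ln w)) * cos (p * Im (Ln w))" by (simp add: Re_exp)
      moreover have "cos (p * Im (Ln w)) = cos (p * \<theta>)"
        using cosabs[of "p * Im (Ln w)"] assms by (simp add: \<theta>_def abs_mult)
      moreover have "exp (p * Re (Ln w)) = norm w powr p" using w0 by (simp add: powr_def)
      ultimately show ?thesis by simp
    qed
    have "0 < cos \<theta>" using th' by (intro cos_gt_zero_pi) auto
    then have "a * Re w powr p - b * Re (w powr of_real p) = norm w powr p * (a * cos \<theta> powr p - b * cos (p * \<theta>))"
      unfolding Rew Rp by (simp add: powr_mult algebra_simps)
    also have "\<dots> \<ge> norm w powr p * 1" by (intro mult_left_mono main th') auto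
    finally show "norm w powr p \<le> a * Re w powr p - b * Re (w powr of_real p)" by simp
  qed (use a0 b0 in auto)
qed

text \<open>The Riesz projection on trigonometric polynomials as an explicit finite sum. It is
  available before the bound is proved, whereas the existence behind the choice in
  \<open>riesz_proj\<close> is a consequence of that bound.\<close>

definition tproj :: "(complex \<Rightarrow> complex) \<Rightarrow> complex \<Rightarrow> complex" where
  "tproj f t = (\<Sum>n | 0 \<le> n \<and> fourier_coeff f n \<noteq> 0. fourier_coeff f n * t powi n)"

lemma trig_finite_support:
  assumes "trig f" shows "finite {n. fourier_coeff f n \<noteq> 0}"
  by (rule trig_fourier[OF assms]) (metis (mono_tags, lifting) finite_subset mem_Collect_eq subsetI)

lemma tproj_finite: "trig f \<Longrightarrow> finite {n. 0 \<le> n \<and> fourier_coeff f n \<noteq> 0}"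
  by (rule finite_subset[OF _ trig_finite_support]) auto

lemma trig_tproj: "trig f \<Longrightarrow> trig (tproj f)"
  unfolding tproj_def[abs_def] by (intro trig_sum_powi tproj_finite)

lemma fourier_coeff_tproj:
  "trig f \<Longrightarrow> fourier_coeff (tproj f) n = (if 0 \<le> n then fourier_coeff f n else 0)"
  unfolding tproj_def[abs_def] by (subst fourier_coeff_trig_sum[OF tproj_finite]) auto

lemma trig_eqI:
  assumes "trig f" "trig g" "\<And>n. fourier_coeff f n = fourier_coeff g n" "t \<in> circle"
  shows "f t = g t"
proof -
  let ?h = "\<lambda>t. f t - g t"
  have h: "trig ?h" by (rule trig_diff[OF assms(1,2)])
  have z: "fourier_coeff ?h n = 0" for n
    using fourier_coeff_diff[OF trig_integrable trig_integrable, OF assms(1,2)] assms(3) by simp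
  obtain N where "\<And>t. t \<in> circle \<Longrightarrow> ?h t = (\<Sum>n\<in>N. fourier_coeff ?h n * t powi n)" using trig_fourier[OF h] by metis
  then have "?h t = 0" using z assms(4) by simp
  then show ?thesis by simp
qed

lemma Lint_cong_circle:
  "(\<And>t. t \<in> circle \<Longrightarrow> f t = g t) \<Longrightarrow> LI p f = LI p g"
  unfolding Lint_def by (rule Bochner_Integration.integral_cong) auto

lemma tproj_add:
  assumes "trig f" "trig g" "t \<in> circle" shows "tproj (\<lambda>t. f t + g t) t = tproj f t + tproj g t"
  by (rule trig_eqI[OF _ _ _ assms(3)])
    (use assms in \<open>auto intro!: trig_tproj trig_add trig_integrable simp: fourier_coeff_tproj trig_add trig_tproj trig_integrable fourier_coeff_add\<close>)

lemma tproj_scale: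
  assumes "trig f" "t \<in> circle" shows "tproj (\<lambda>t. c * f t) t = c * tproj f t"
  by (rule trig_eqI[OF _ _ _ assms(2)])
    (use assms in \<open>auto intro!: trig_tproj trig_scale simp: fourier_coeff_tproj trig_scale fourier_coeff_scale\<close>)

lemma tproj_diff:
  assumes "trig f" "trig g" "t \<in> circle" shows "tproj (\<lambda>t. f t - g t) t = tproj f t - tproj g t"
  using tproj_add[OF assms(1) trig_scale[OF assms(2), of "-1"] assms(3)] tproj_scale[OF assms(2,3), of "-1"] by simp

text \<open>The pairing has no conjugation, so index n meets index -n. One polynomial factor keeps
  the sum finite, and h is allowed to be merely integrable.\<close>

lemma trig_bilinear:
  assumes f: "trig f" and N: "finite N" "\<And>n. n \<notin> N \<Longrightarrow> fourier_coeff f n = 0" and h: "integrable circle_measure h"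
  shows "(LINT t|circle_measure. f t * h t) = (\<Sum>n\<in>N. fourier_coeff f n * fourier_coeff h (-n))"
proof -
  have f': "f t = (\<Sum>n\<in>N. fourier_coeff f n * t powi n)" if "t \<in> circle" for t
    by (rule trig_eqI[OF f trig_sum_powi[OF N(1)] _ that]) (use N in \<open>simp add: fourier_coeff_trig_sum\<close>)
  have "(LINT t|circle_measure. f t * h t) = (LINT t|circle_measure. (\<Sum>n\<in>N. fourier_coeff f n * (h t * t powi n)))"
  proof (rule Bochner_Integration.integral_cong[OF refl])
    fix t assume "t \<in> space circle_measure"
    then have "f t = (\<Sum>n\<in>N. fourier_coeff f n * t powi n)" by (intro f') simp
    then show "f t * h t = (\<Sum>n\<in>N. fourier_coeff f n * (h t * t powi n))"
      by (simp add: sum_distrib_left sum_distrib_right mult_ac)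
  qed
  also have "\<dots> = (\<Sum>n\<in>N. LINT t|circle_measure. fourier_coeff f n * (h t * t powi n))"
    by (rule Bochner_Integration.integral_sum) (use integrable_mult_powi[OF h] in auto)
  also have "\<dots> = (\<Sum>n\<in>N. fourier_coeff f n * fourier_coeff h (-n))"
    by (simp add: fourier_coeff_def[of h])
  finally show ?thesis .
qed

lemma Parseval_trig:
  assumes "trig f" "finite N" "\<And>n. n \<notin> N \<Longrightarrow> fourier_coeff f n = 0"
  shows "LI 2 f = (\<Sum>n\<in>N. (norm (fourier_coeff f n))\<^sup>2)"
proof -
  have "complex_of_real (LI 2 f) = (LINT t|circle_measure. of_real (norm (f t) powr 2))"
    unfolding Lint_def by (rule integral_complex_of_real[symmetric])
  also have "\<dots> = (LINT t|circle_measure. f t * cnj (f t))"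
    by (rule Bochner_Integration.integral_cong) (auto simp: complex_norm_square powr_numeral simp flip: of_real_power)
  also have "\<dots> = (\<Sum>n\<in>N. fourier_coeff f n * fourier_coeff (\<lambda>t. cnj (f t)) (-n))"
    by (rule trig_bilinear[OF assms]) (use trig_integrable[OF assms(1)] in auto)
  also have "\<dots> = of_real (\<Sum>n\<in>N. (norm (fourier_coeff f n))\<^sup>2)"
    by (simp add: fourier_coeff_cnj complex_norm_square del: of_real_power)
  finally show ?thesis by (simp only: of_real_eq_iff)
qed

text \<open>By Parseval, dropping coefficients cannot increase the norm. This bound controls the
  approximation error in the real case, which is of no definite sign.\<close>

lemma Lint_2_tproj:
  assumes "trig f" shows "LI 2 (tproj f) \<le> LI 2 f"
proof -
  obtain N where N: "finite N" "\<And>n. n \<notin> N \<Longrightarrow> fourier_coeff f n = 0" using trig_fourier[OF assms] by metis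
  have "LI 2 (tproj f) = (\<Sum>n\<in>N. (norm (fourier_coeff (tproj f) n))\<^sup>2)"
    by (rule Parseval_trig[OF trig_tproj[OF assms] N(1)]) (use N assms in \<open>auto simp: fourier_coeff_tproj\<close>)
  also have "\<dots> \<le> (\<Sum>n\<in>N. (norm (fourier_coeff f n))\<^sup>2)"
    by (rule sum_mono) (simp add: fourier_coeff_tproj[OF assms])
  also have "\<dots> = LI 2 f" by (rule Parseval_trig[OF assms N, symmetric])
  finally show ?thesis .
qed

text \<open>Split the values at s: below it x^p <= s^p, above it x^(p-2) <= s^(p-2) as p <= 2. The
  scale s is free and is later matched to the size of the error.\<close>

lemma Lint_le_Lint_2:
  assumes "1 < p" "p \<le> 2" "0 < s" and f: "f \<in> LC 2"
  shows "LI p f \<le> s powr p + s powr (p - 2) * LI 2 f"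
proof -
  have pt: "x powr p \<le> s powr p + s powr (p - 2) * x powr 2" if "0 \<le> x" for x :: real
  proof (cases "x \<le> s")
    case True
    then have "x powr p \<le> s powr p" using that assms by (intro powr_mono2) auto
    moreover have "0 \<le> s powr (p - 2) * x powr 2" by simp
    ultimately show ?thesis by linarith
  next
    case False
    have "x powr p = x powr (p - 2) * x powr 2" by (simp add: powr_add[symmetric] del: powr_numeral)
    also have "\<dots> \<le> s powr (p - 2) * x powr 2"
      using False assms by (intro mult_right_mono powr_mono2') auto
    finally show ?thesis by (smt (verit) powr_ge_zero)
  qed
  have fp: "f \<in> LC p" using circle.Lspace_mono[OF f, of p] assms by auto
  have "LI p f \<le> (LINT t|circle_measure. s powr p + s powr (p - 2) * norm (f t) powr 2)"
    unfolding Lint_def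
    by (rule integral_mono[OF Lspace_integrable[OF fp]])
      (use Lspace_integrable[OF f] pt in \<open>auto simp del: powr_numeral\<close>)
  also have "\<dots> = s powr p + s powr (p - 2) * LI 2 f"
    unfolding Lint_def using Lspace_integrable[OF f]
    by (subst Bochner_Integration.integral_add) (auto simp del: powr_numeral)
  finally show ?thesis .
qed

lemma Lint_const: "LI p (\<lambda>t. c) = norm c powr p"
  by (simp add: Lint_def)

lemma fourier_coeff_Lint_bound:
  assumes "1 < p" "f \<in> LC p"
  shows "norm (fourier_coeff f n) powr p \<le> LI p f"
proof -
  define q where "q = 1 / (1 - 1/p)"
  have pq: "1 / p + 1 / q = 1" by (simp add: q_def)
  have q: "1 < q" by (rule conjugate_exponent_gt_1[OF assms(1) pq])
  let ?g = "\<lambda>t. t powi - n"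
  have g: "?g \<in> LC q"
    using q by (intro continuous_circle_Lspace continuous_intros) auto
  have "LI q ?g = LI q (\<lambda>t. 1)"
    unfolding Lint_def by (rule Bochner_Integration.integral_cong) auto
  then have "LI q ?g = 1" by (simp add: Lint_const)
  then have "norm (fourier_coeff f n) \<le> LI p f powr (1 / p)"
    using Holder(2)[OF assms(1) pq assms(2) g] by (simp add: fourier_coeff_def)
  then have "norm (fourier_coeff f n) powr p \<le> (LI p f powr (1 / p)) powr p"
    using assms by (intro powr_mono2) auto
  then show ?thesis using assms by (simp add: powr_powr)
qed

text \<open>\<open>powr_half_plane_bound\<close> is integrated along F, whose real part on the
  circle is u. The mean of F^p is F(0)^p, a positive number, so its term may be dropped. The
  constant a + 1 pays for F and for the mean of u. The positive lower bound e gives no contribution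
  to the constant; it keeps F off the branch cut.\<close>

lemma Riesz_positive:
  assumes "1 < p" "p \<le> 2"
  obtains K where "0 \<le> K" "\<And>u e. \<lbrakk>trig u; 0 < e; \<And>t. t \<in> circle \<Longrightarrow> Im (u t) = 0 \<and> e \<le> Re (u t)\<rbrakk>
    \<Longrightarrow> LI p (tproj u) \<le> K * LI p u"
proof -
  let ?M = circle_measure
  obtain a b where ab: "0 \<le> a" "0 \<le> b" and
    pt: "\<And>w. 0 < Re w \<Longrightarrow> norm w powr p \<le> a * Re w powr p - b * Re (w powr of_real p)"
    using powr_half_plane_bound[OF assms] by metis
  have p0: "0 \<le> p" using assms by simp
  show ?thesis
  proof (rule that[of "a + 1"])
    fix u :: "complex \<Rightarrow> complex" and e :: real
    assume u: "trig u" and e: "0 < e" and pos: "\<And>t. t \<in> circle \<Longrightarrow> Im (u t) = 0 \<and> e \<le> Re (u t)"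
    define c0 where "c0 = fourier_coeff u 0"
    let ?S = "{n. 0 \<le> n \<and> fourier_coeff u n \<noteq> 0}"
    \<comment> \<open>Doubling the nonnegative part counts the mean twice, which subtracting
      \<open>c0\<close> corrects. As u is real, its coefficients at n and -n are conjugate, and F
      plus its conjugate is 2u on the circle.\<close>
    define F where "F z = 2 * (\<Sum>n\<in>?S. fourier_coeff u n * z ^ nat n) - c0" for z
    have Fcirc: "F t = 2 * tproj u t - c0" for t
      unfolding F_def tproj_def by (simp add: power_int_def)
    have Fhol: "F holomorphic_on A" for A unfolding F_def[abs_def] by (intro holomorphic_intros)
    have Fcont: "continuous_on A F" for A by (rule holomorphic_on_imp_continuous_on[OF Fhol])
    have ucnj: "fourier_coeff u (-n) = cnj (fourier_coeff u n)" for n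
    proof -
      have "fourier_coeff (\<lambda>t. cnj (u t)) (-n) = fourier_coeff u (-n)"
        by (rule fourier_coeff_cong) (use pos in \<open>auto simp: complex_eq_iff\<close>)
      then show ?thesis by (simp add: fourier_coeff_cnj)
    qed
    have ReF: "Re (F t) = Re (u t)" if t: "t \<in> circle" for t
    proof -
      let ?G = "\<lambda>t. (2 * tproj u t + - c0) + cnj (2 * tproj u t + - c0)"
      have T: "trig (\<lambda>t. 2 * tproj u t + - c0)"
        by (intro trig_add trig_scale trig_tproj trig_const u)
      have f2: "fourier_coeff (\<lambda>t. 2 * tproj u t + - c0) n = 2 * (if 0 \<le> n then fourier_coeff u n else 0) - (if n = 0 then c0 else 0)" for n
      proof -
        have "fourier_coeff (\<lambda>t. 2 * tproj u t + - c0) n = fourier_coeff (\<lambda>t. 2 * tproj u t) n + fourier_coeff (\<lambda>t. - c0 * t powi 0) n"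
          using fourier_coeff_add[OF trig_integrable trig_integrable, OF trig_scale[OF trig_tproj[OF u]] trig_monom[of "-c0" 0]]
          by simp
        then show ?thesis unfolding fourier_coeff_monom fourier_coeff_scale fourier_coeff_tproj[OF u] by simp
      qed
      have "?G t = 2 * u t"
      proof (rule trig_eqI[OF _ _ _ t])
        show "trig ?G" by (intro trig_add trig_cnj T[simplified] T)
        show "trig (\<lambda>t. 2 * u t)" by (intro trig_scale u)
        fix n
        have "fourier_coeff ?G n = fourier_coeff (\<lambda>t. 2 * tproj u t + - c0) n + cnj (fourier_coeff (\<lambda>t. 2 * tproj u t + - c0) (-n))"
          using fourier_coeff_add[OF trig_integrable trig_integrable, OF T trig_cnj[OF T]] fourier_coeff_cnj[of "\<lambda>t. 2 * tproj u t + - c0"] by simp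
        also have "\<dots> = 2 * fourier_coeff u n"
          unfolding f2 using ucnj[of n] ucnj[of 0] by (auto simp: c0_def)
        finally show "fourier_coeff ?G n = fourier_coeff (\<lambda>t. 2 * u t) n" by (simp add: fourier_coeff_scale)
      qed
      then have "Re (?G t) = 2 * Re (u t)" by simp
      then show ?thesis by (simp add: Fcirc)
    qed
    \<comment> \<open>The maximum principle for - Re F carries the lower bound from the circle into
      the disc. So F maps the closed disc into the right half-plane, where the principal power is
      holomorphic.\<close>
    have Rpos: "e \<le> Re (F z)" if "z \<in> cball 0 1" for z
    proof -
      have "Re (- F z) \<le> - e"
        by (rule maximum_real_frontier[of "\<lambda>z. - F z" "cball 0 1"])
          (use that pos ReF in \<open>auto intro!: holomorphic_on_minus Fhol continuous_intros Fcont\<close>)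
      then show ?thesis by simp
    qed
    define G where "G z = F z powr of_real p" for z
    have Gc: "continuous_on (cball 0 1) G" unfolding G_def[abs_def]
      by (intro continuous_on_powr_complex Fcont continuous_intros) (use Rpos e in force)+
    have Gh: "G holomorphic_on ball 0 1" unfolding G_def[abs_def]
    proof (intro holomorphic_on_powr Fhol holomorphic_intros)
      fix z :: complex assume "z \<in> ball 0 1"
      then have "0 < Re (F z)" using Rpos[of z] e by auto
      then show "F z \<notin> \<real>\<^sub>\<le>\<^sub>0" by (auto simp: complex_nonpos_Reals_iff)
    qed
    have mv: "(LINT t|?M. G t) = G 0" by (rule mean_value_circle[OF Gc Gh])
    have Gci: "continuous_on circle G" by (rule continuous_on_subset[OF Gc]) auto
    have Gi: "integrable ?M G" using circle.Lspace_integrable1[OF continuous_circle_Lspace[OF Gci, of 1]] by simp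
    have F0: "F 0 = c0"
    proof -
      have fin: "finite ?S" by (rule tproj_finite[OF u])
      have "(\<Sum>n\<in>?S. fourier_coeff u n * 0 ^ nat n) = (\<Sum>n\<in>?S. if n = 0 then c0 else 0)"
        by (rule sum.cong) (auto simp: c0_def)
      also have "\<dots> = c0" using fin by (auto simp: c0_def)
      finally show ?thesis unfolding F_def by simp
    qed
    have "0 \<le> Re (G 0)"
    proof -
      have "cnj c0 = c0" using ucnj[of 0] by (simp add: c0_def)
      then have "c0 = of_real (Re c0)" by (simp add: complex_eq_iff)
      moreover have "0 < Re c0" using Rpos[of 0] e F0 by simp
      ultimately have "G 0 = of_real (Re c0 powr p)" unfolding G_def F0
        by (metis less_imp_le powr_of_real)
      then show ?thesis by simp
    qed
    have FL: "F \<in> LC p" by (intro continuous_circle_Lspace Fcont p0)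
    have uL: "u \<in> LC p" by (intro trig_Lspace u p0)
    have "LI p F \<le> (LINT t|?M. a * norm (u t) powr p - b * Re (G t))"
      unfolding Lint_def
    proof (rule integral_mono[OF Lspace_integrable[OF FL]])
      show "integrable ?M (\<lambda>t. a * norm (u t) powr p - b * Re (G t))"
        using Lspace_integrable[OF uL] Gi by auto
      fix t assume "t \<in> space ?M"
      then have t: "t \<in> circle" by simp
      have "norm (u t) = Re (F t)" using pos[OF t] ReF[OF t] e by (simp add: cmod_def)
      moreover have "0 < Re (F t)" using pos[OF t] ReF[OF t] e by simp
      ultimately show "norm (F t) powr p \<le> a * norm (u t) powr p - b * Re (G t)"
        using pt[of "F t"] by (simp add: G_def)
    qed
    also have "\<dots> = a * LI p u - b * Re (LINT t|?M. G t)"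
      unfolding Lint_def using Lspace_integrable[OF uL] Gi by (subst Bochner_Integration.integral_diff) auto
    also have "\<dots> \<le> a * LI p u" unfolding mv using ab \<open>0 \<le> Re (G 0)\<close> by simp
    finally have 1: "LI p F \<le> a * LI p u" .
    have 2: "LI p (\<lambda>t. c0) \<le> LI p u"
      unfolding Lint_const c0_def by (rule fourier_coeff_Lint_bound[OF assms(1) uL])
    have "LI p (tproj u) = LI p (\<lambda>t. (1/2) * (F t + c0))"
      by (rule Lint_cong_circle) (simp add: Fcirc)
    also have "\<dots> = (1/2) powr p * LI p (\<lambda>t. F t + c0)" unfolding Lint_scale by simp
    also have "\<dots> \<le> (1/2) powr p * (2 powr p * (LI p F + LI p (\<lambda>t. c0)))"
      by (intro mult_left_mono Lspace_add FL p0 continuous_circle_Lspace continuous_intros) auto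
    also have "\<dots> = LI p F + LI p (\<lambda>t. c0)" by (simp add: powr_divide)
    also have "\<dots> \<le> (a + 1) * LI p u" using 1 2 by (simp add: algebra_simps)
    finally show "LI p (tproj u) \<le> (a + 1) * LI p u" .
  qed (use ab in simp)
qed

lemma Lint_le_sup:
  assumes "f \<in> LC p" "0 \<le> p" "\<And>t. t \<in> circle \<Longrightarrow> norm (f t) \<le> C"
  shows "LI p f \<le> C powr p"
proof -
  have "LI p f \<le> (LINT t|circle_measure. C powr p)"
    unfolding Lint_def by (rule integral_mono[OF Lspace_integrable[OF assms(1)]]) (use assms in \<open>auto intro: powr_mono2\<close>)
  then show ?thesis by simp
qed

lemma Lint_mono_circle:
  assumes "f \<in> LC p" "g \<in> LC p" "0 \<le> p" "\<And>t. t \<in> circle \<Longrightarrow> norm (f t) \<le> norm (g t)"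
  shows "LI p f \<le> LI p g"
  unfolding Lint_def
  by (rule integral_mono[OF Lspace_integrable[OF assms(1)] Lspace_integrable[OF assms(2)]])
    (use assms in \<open>auto intro: powr_mono2\<close>)

text \<open>The positive and the negative part of a real trigonometric polynomial are approximated
  uniformly by strictly positive trigonometric polynomials; the error is controlled in \<open>L\<^sup>2\<close>.\<close>

lemma Riesz_real:
  assumes "1 < p" "p \<le> 2"
  obtains K where "0 \<le> K" "\<And>u. \<lbrakk>trig u; \<And>t. t \<in> circle \<Longrightarrow> Im (u t) = 0\<rbrakk>
    \<Longrightarrow> LI p (tproj u) \<le> K * LI p u"
proof -
  let ?M = circle_measure
  have p0: "0 \<le> p" using assms by simp
  obtain A where A: "0 \<le> A" and
    pos: "\<And>u e. \<lbrakk>trig u; 0 < e; \<And>t. t \<in> circle \<Longrightarrow> Im (u t) = 0 \<and> e \<le> Re (u t)\<rbrakk> \<Longrightarrow> LI p (tproj u) \<le> A * LI p u"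
    using Riesz_positive[OF assms] by metis
  define B where "B = 2 powr p"
  have B: "0 < B" by (simp add: B_def)
  \<comment> \<open>One B for each of three quasi-triangle inequalities (u against v - w, v against
    w, a part against its approximation), A for the positive case, and 2 for the two parts.\<close>
  define K where "K = 2 * B * B * A * B"
  show ?thesis
  proof (rule that[of K])
    show "0 \<le> K" using A B by (simp add: K_def)
    fix u assume u: "trig u" and re: "\<And>t. t \<in> circle \<Longrightarrow> Im (u t) = 0"
    have uc: "continuous_on circle u" by (rule trig_continuous[OF u])
    have uL: "u \<in> LC p" by (rule trig_Lspace[OF u p0])
    \<comment> \<open>A nonnegative g is raised by d and approximated within d/2, so the approximant
      stays above d/2; taking its real part makes it real without increasing the error.\<close>
    have approx: "\<exists>v. trig v \<and> (\<forall>t\<in>circle. Im (v t) = 0 \<and> d / 2 \<le> Re (v t) \<and> norm (v t - of_real (g t)) \<le> 2 * d)"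
      if g: "continuous_on circle g" "\<And>t. 0 \<le> g t" and d: "0 < d" for g :: "complex \<Rightarrow> real" and d
    proof -
      have "continuous_on circle (\<lambda>t. complex_of_real (g t + d))" by (intro continuous_intros g)
      moreover have "0 < d / 2" using d by simp
      ultimately obtain h where h: "trig h" "\<And>t. t \<in> circle \<Longrightarrow> norm (complex_of_real (g t + d) - h t) < d / 2"
        by (rule Weierstrass_circle) blast
      let ?v = "\<lambda>t. (1/2) * (h t + cnj (h t))"
      have v: "?v t = of_real (Re (h t))" for t by (simp add: complex_eq_iff)
      have "trig ?v" by (intro trig_scale trig_add trig_cnj h)
      moreover have "Im (?v t) = 0 \<and> d / 2 \<le> Re (?v t) \<and> norm (?v t - of_real (g t)) \<le> 2 * d" if "t \<in> circle" for t
      proof -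
        have "\<bar>(g t + d) - Re (h t)\<bar> < d / 2"
          using h(2)[OF that] abs_Re_le_cmod[of "complex_of_real (g t + d) - h t"] by simp
        then have 1: "\<bar>Re (h t) - g t\<bar> \<le> 2 * d" "d / 2 \<le> Re (h t)" using g(2)[of t] d by linarith+
        have "norm (?v t - of_real (g t)) = \<bar>Re (h t) - g t\<bar>" unfolding v by (simp flip: of_real_diff)
        then show ?thesis using 1 unfolding v by simp
      qed
      ultimately show ?thesis by blast
    qed
    have main: "LI p (tproj u) \<le> K * LI p u + (K * 2 powr p + 17 * B) * d powr p" if d: "0 < d" for d
    proof -
      have c: "continuous_on circle (\<lambda>t. max 0 (Re (u t)))" "continuous_on circle (\<lambda>t. max 0 (- Re (u t)))"
        by (intro continuous_intros uc)+
      obtain v where v: "trig v" "\<And>t. t \<in> circle \<Longrightarrow> Im (v t) = 0 \<and> d / 2 \<le> Re (v t)"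
          "\<And>t. t \<in> circle \<Longrightarrow> norm (v t - of_real (max 0 (Re (u t)))) \<le> 2 * d"
        using approx[OF c(1) _ d] by fastforce
      obtain w where w: "trig w" "\<And>t. t \<in> circle \<Longrightarrow> Im (w t) = 0 \<and> d / 2 \<le> Re (w t)"
          "\<And>t. t \<in> circle \<Longrightarrow> norm (w t - of_real (max 0 (- Re (u t)))) \<le> 2 * d"
        using approx[OF c(2) _ d] by fastforce
      have d2: "0 < d / 2" using d by simp
      have Pv: "LI p (tproj v) \<le> A * LI p v" by (rule pos[OF v(1) d2 v(2)])
      have Pw: "LI p (tproj w) \<le> A * LI p w" by (rule pos[OF w(1) d2 w(2)])
      have size: "LI p h \<le> B * (LI p u + 2 powr p * d powr p)"
        if h: "trig h" "\<And>t. t \<in> circle \<Longrightarrow> norm (h t - of_real (g t)) \<le> 2 * d"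
          and g: "continuous_on circle g" "\<And>t. t \<in> circle \<Longrightarrow> \<bar>g t\<bar> \<le> norm (u t)" for h and g :: "complex \<Rightarrow> real"
      proof -
        have gL: "(\<lambda>t. complex_of_real (g t)) \<in> LC p" by (intro continuous_circle_Lspace continuous_intros g p0)
        have hL: "h \<in> LC p" by (rule trig_Lspace[OF h(1) p0])
        have "LI p h \<le> B * (LI p (\<lambda>t. h t - of_real (g t)) + LI p (\<lambda>t. complex_of_real (g t)))"
          unfolding B_def by (rule Lint_le_Lint_diff[OF p0 hL gL])
        also have "\<dots> \<le> B * ((2 * d) powr p + LI p u)"
          by (intro mult_left_mono add_mono Lint_le_sup[OF Lspace_diff(1)[OF p0 hL gL] p0 h(2)] Lint_mono_circle[OF gL uL p0])
            (use g B in auto)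
        finally show ?thesis using d by (simp add: powr_mult add.commute)
      qed
      have Lv: "LI p v \<le> B * (LI p u + 2 powr p * d powr p)"
        by (rule size[OF v(1,3) c(1)]) (use abs_Re_le_cmod in \<open>auto simp: max_def abs_le_iff\<close>)
      have Lw: "LI p w \<le> B * (LI p u + 2 powr p * d powr p)"
        by (rule size[OF w(1,3) c(2)]) (use abs_Re_le_cmod in \<open>auto simp: max_def abs_le_iff\<close>)
      \<comment> \<open>The approximations are within 2d of the positive and the negative part, so e
        is at most 4d in modulus.\<close>
      define e where "e t = u t - (v t - w t)" for t
      have e: "trig e" unfolding e_def[abs_def] by (intro trig_diff u v w)
      have eb: "norm (e t) \<le> 4 * d" if t: "t \<in> circle" for t
      proof -
        have "u t = of_real (max 0 (Re (u t))) - of_real (max 0 (- Re (u t)))"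
          using re[OF t] by (auto simp: complex_eq_iff max_def)
        then have "e t = (w t - of_real (max 0 (- Re (u t)))) - (v t - of_real (max 0 (Re (u t))))"
          unfolding e_def by (simp add: algebra_simps)
        then have "norm (e t) \<le> norm (w t - of_real (max 0 (- Re (u t)))) + norm (v t - of_real (max 0 (Re (u t))))"
          by (simp only: norm_triangle_ineq4)
        then show ?thesis using v(3)[OF t] w(3)[OF t] by linarith
      qed
      have Pe: "LI p (tproj e) \<le> 17 * d powr p"
      proof -
        have "LI 2 (tproj e) \<le> LI 2 e" by (rule Lint_2_tproj[OF e])
        also have "\<dots> \<le> (4 * d) powr 2" by (intro Lint_le_sup trig_Lspace e eb) auto
        finally have 2: "LI 2 (tproj e) \<le> 16 * d powr 2" using d by (simp add: powr_mult powr_numeral)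
        \<comment> \<open>With the free scale s = d, the bound 16 d^2 for the square becomes 16 d^p;
          in total 17 d^p, which vanishes with d.\<close>
        have "LI p (tproj e) \<le> d powr p + d powr (p - 2) * LI 2 (tproj e)"
          by (rule Lint_le_Lint_2[OF assms d trig_Lspace[OF trig_tproj[OF e]]]) simp
        also have "\<dots> \<le> d powr p + d powr (p - 2) * (16 * d powr 2)"
          using 2 by (intro add_left_mono mult_left_mono) auto
        also have "d powr (p - 2) * (16 * d powr 2) = 16 * d powr p"
          using d by (simp add: powr_add[symmetric] del: powr_numeral)
        finally show ?thesis by simp
      qed
      have TL: "tproj v \<in> LC p" "tproj w \<in> LC p" "tproj e \<in> LC p" "tproj u \<in> LC p"
        by (intro trig_Lspace trig_tproj v w e u p0)+
      have vwL: "(\<lambda>t. tproj v t - tproj w t) \<in> LC p" by (rule Lspace_diff(1)[OF p0 TL(1,2)])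
      have eq: "tproj e t = tproj u t - (tproj v t - tproj w t)" if "t \<in> circle" for t
        unfolding e_def[abs_def] using that by (simp add: tproj_diff u v w trig_diff)
      have "LI p (tproj u) \<le> B * (LI p (\<lambda>t. tproj u t - (tproj v t - tproj w t)) + LI p (\<lambda>t. tproj v t - tproj w t))"
        unfolding B_def by (rule Lint_le_Lint_diff[OF p0 TL(4) vwL])
      also have "LI p (\<lambda>t. tproj u t - (tproj v t - tproj w t)) = LI p (tproj e)"
        by (rule Lint_cong_circle) (simp add: eq)
      also have "B * (LI p (tproj e) + LI p (\<lambda>t. tproj v t - tproj w t))
          \<le> B * (17 * d powr p + B * (LI p (tproj v) + LI p (tproj w)))"
        using Lspace_diff(2)[OF p0 TL(1,2)] Pe B unfolding B_def by (intro mult_left_mono add_mono) auto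
      also have "\<dots> \<le> B * (17 * d powr p + B * (A * (B * (LI p u + 2 powr p * d powr p)) + A * (B * (LI p u + 2 powr p * d powr p))))"
        using B A by (intro mult_left_mono add_mono order_refl order_trans[OF Pv] order_trans[OF Pw] Lv Lw) auto
      also have "\<dots> = K * LI p u + (K * 2 powr p + 17 * B) * d powr p"
        by (simp add: K_def algebra_simps)
      finally show ?thesis .
    qed
    have "((\<lambda>n. K * LI p u + (K * 2 powr p + 17 * B) * (1 / real (Suc n)) powr p) \<longlonglongrightarrow> K * LI p u + (K * 2 powr p + 17 * B) * 0)"
      by (intro tendsto_intros tendsto_powr_0 LIMSEQ_Suc[OF lim_1_over_n]) (use assms in auto)
    from tendsto_lowerbound[OF this, of "LI p (tproj u)"] show "LI p (tproj u) \<le> K * LI p u"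
      using main by auto
  qed
qed

lemma Riesz_le_2:
  assumes "1 < p" "p \<le> 2"
  obtains K where "0 \<le> K" "\<And>f. trig f \<Longrightarrow> LI p (tproj f) \<le> K * LI p f"
proof -
  let ?M = circle_measure
  have p0: "0 \<le> p" using assms by simp
  obtain A where A: "0 \<le> A" and
    re: "\<And>u. \<lbrakk>trig u; \<And>t. t \<in> circle \<Longrightarrow> Im (u t) = 0\<rbrakk> \<Longrightarrow> LI p (tproj u) \<le> A * LI p u"
    using Riesz_real[OF assms] by metis
  show ?thesis
  proof (rule that[of "2 powr p * (2 * A)"])
    fix f assume f: "trig f"
    define u where "u t = complex_of_real (Re (f t))" for t
    define v where "v t = complex_of_real (Im (f t))" for t
    have u: "trig u"
      by (rule trig_cong[OF trig_scale[OF trig_add[OF f trig_cnj[OF f]], of "1/2"]]) (simp add: u_def complex_eq_iff)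
    have v: "trig v"
      by (rule trig_cong[OF trig_scale[OF trig_diff[OF f trig_cnj[OF f]], of "1/(2*\<i>)"]]) (simp add: v_def complex_eq_iff)
    have L: "f \<in> LC p" "u \<in> LC p" "v \<in> LC p" using f u v p0 by (auto intro: trig_Lspace)
    have fe: "f = (\<lambda>t. u t + \<i> * v t)" by (auto simp: u_def v_def complex_eq_iff)
    have bu: "LI p u \<le> LI p f" "LI p v \<le> LI p f"
      by (intro Lint_mono_circle L p0; simp add: u_def v_def abs_Re_le_cmod abs_Im_le_cmod)+
    have "LI p (tproj f) = LI p (\<lambda>t. tproj u t + \<i> * tproj v t)"
      by (rule Lint_cong_circle, subst fe) (simp only: tproj_add[OF u trig_scale[OF v]] tproj_scale[OF v])
    also have "\<dots> \<le> 2 powr p * (LI p (tproj u) + LI p (\<lambda>t. \<i> * tproj v t))"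
      by (intro Lspace_add p0 Lspace_scale trig_Lspace trig_tproj u v)
    also have "\<dots> \<le> 2 powr p * (A * LI p f + A * LI p f)"
    proof (intro mult_left_mono add_mono)
      show "LI p (tproj u) \<le> A * LI p f"
        by (rule order_trans[OF re[OF u] mult_left_mono[OF bu(1) A]]) (simp add: u_def)
      have "LI p (tproj v) \<le> A * LI p f"
        by (rule order_trans[OF re[OF v] mult_left_mono[OF bu(2) A]]) (simp add: v_def)
      then show "LI p (\<lambda>t. \<i> * tproj v t) \<le> A * LI p f" by (simp add: Lint_scale)
    qed simp
    finally show "LI p (tproj f) \<le> 2 powr p * (2 * A) * LI p f" by (simp add: algebra_simps)
  qed (use A in simp)
qed

text \<open>For the bilinear pairing the transpose of the projection keeps the coefficients of index
  <= 0; that is the projection conjugated by complex conjugation, which preserves the norm.\<close>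

lemma trig_tproj_adjoint:
  assumes f: "trig f" and h: "trig h"
  shows "(LINT t|circle_measure. tproj f t * h t) = (LINT t|circle_measure. f t * cnj (tproj (\<lambda>t. cnj (h t)) t))"
proof -
  obtain N where N: "finite N" "\<And>n. n \<notin> N \<Longrightarrow> fourier_coeff f n = 0" using trig_fourier[OF f] by metis
  have ch: "trig (\<lambda>t. cnj (h t))" by (rule trig_cnj[OF h])
  have th: "trig (\<lambda>t. cnj (tproj (\<lambda>t. cnj (h t)) t))" by (rule trig_cnj[OF trig_tproj[OF ch]])
  have "(LINT t|circle_measure. tproj f t * h t) = (\<Sum>n\<in>N. fourier_coeff (tproj f) n * fourier_coeff h (-n))"
    by (rule trig_bilinear[OF trig_tproj[OF f] N(1) _ trig_integrable[OF h]]) (simp add: fourier_coeff_tproj f N)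
  also have "\<dots> = (\<Sum>n\<in>N. fourier_coeff f n * fourier_coeff (\<lambda>t. cnj (tproj (\<lambda>t. cnj (h t)) t)) (-n))"
    by (rule sum.cong) (auto simp: fourier_coeff_tproj f fourier_coeff_cnj ch)
  also have "\<dots> = (LINT t|circle_measure. f t * cnj (tproj (\<lambda>t. cnj (h t)) t))"
    by (rule trig_bilinear[OF f N trig_integrable[OF th], symmetric])
  finally show ?thesis .
qed

text \<open>Duality with the extremal function k of g = Pf: g k = |g|^p = |k|^q. As the adjoint
  formula is known for polynomials only, k is replaced by a uniformly close h, the projection is
  moved onto h, and the bound for q <= 2 applies. Letting the distance d tend to 0 leaves I <= F C
  I^(1/q), so I <= C^p times the p-th power integral of f.\<close>

lemma Riesz_ge_2:
  assumes p: "2 < p"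
  obtains K where "0 \<le> K" "\<And>f. trig f \<Longrightarrow> LI p (tproj f) \<le> K * LI p f"
proof -
  let ?M = circle_measure
  have p1: "1 < p" and p0: "0 \<le> p" using p by auto
  define q where "q = 1 / (1 - 1/p)"
  have pq: "1 / p + 1 / q = 1" by (simp add: q_def)
  have q1: "1 < q" by (rule conjugate_exponent_gt_1[OF p1 pq])
  have q0: "0 \<le> q" using q1 by simp
  have q2: "q \<le> 2" using p by (simp add: q_def field_simps)
  have pq': "(p - 1) * q = p" using p pq q1 by (simp add: field_simps)
  obtain A where A: "0 \<le> A" and AQ: "\<And>f. trig f \<Longrightarrow> LI q (tproj f) \<le> A * LI q f"
    using Riesz_le_2[OF q1 q2] by metis
  define C where "C = (A * 2 powr q) powr (1/q)"
  show ?thesis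
  proof (rule that[of "C powr p"])
    fix f assume f: "trig f"
    define g where "g = tproj f"
    have g: "trig g" unfolding g_def by (rule trig_tproj[OF f])
    have gc: "continuous_on circle g" by (rule trig_continuous[OF g])
    define k where "k t = of_real (norm (g t) powr (p - 2)) * cnj (g t)" for t
    have kc: "continuous_on circle k"
      unfolding k_def[abs_def] using p by (intro continuous_intros continuous_on_powr' gc) auto
    have kL: "k \<in> LC q" by (rule continuous_circle_Lspace[OF kc q0])
    have gL: "g \<in> LC p" "f \<in> LC p" by (intro trig_Lspace g f p0)+
    define I where "I = LI p g"
    define F where "F = LI p f powr (1/p)"
    have I0: "0 \<le> I" by (simp add: I_def)
    have nk: "norm (k t) = norm (g t) powr (p - 1)" for t
      using powr_mult_base[of "norm (g t)" "p - 2"] by (simp add: k_def norm_mult mult.commute add.commute)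
    have kI: "LI q k = I" unfolding Lint_def I_def nk by (simp add: powr_powr pq')
    have gk: "(LINT t|?M. g t * k t) = of_real I"
    proof -
      have "g t * k t = of_real (norm (g t) powr p)" for t
      proof -
        have "norm (g t) powr (p - 2) * (norm (g t))\<^sup>2 = norm (g t) powr p"
          using p by (cases "g t = 0") (auto simp: powr_realpow[symmetric] powr_add[symmetric] simp del: powr_numeral)
        moreover have "g t * cnj (g t) = of_real ((norm (g t))\<^sup>2)"
          using complex_norm_square[of "g t"] by simp
        ultimately show ?thesis by (metis k_def mult.left_commute of_real_mult)
      qed
      then show ?thesis by (simp add: I_def Lint_def)
    qed
    have step: "I \<le> F * (A * (2 powr q * (d powr q + I))) powr (1/q) + d * (LINT t|?M. norm (g t))" if d: "0 < d" for d
    proof -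
      obtain h where h: "trig h" "\<And>t. t \<in> circle \<Longrightarrow> norm (k t - h t) < d" using Weierstrass_circle[OF kc d] by metis
      have hL: "h \<in> LC q" by (rule trig_Lspace[OF h(1) q0])
      have hb: "LI q h \<le> 2 powr q * (d powr q + I)"
      proof -
        have "LI q h \<le> 2 powr q * (LI q (\<lambda>t. h t - k t) + LI q k)"
          by (rule Lint_le_Lint_diff[OF q0 hL kL])
        also have "\<dots> \<le> 2 powr q * (d powr q + I)" unfolding kI
          by (intro mult_left_mono add_right_mono Lint_le_sup Lspace_diff hL kL q0)
            (use h(2) in \<open>auto simp: norm_minus_commute intro: less_imp_le\<close>)
        finally show ?thesis .
      qed
      let ?h' = "\<lambda>t. cnj (tproj (\<lambda>t. cnj (h t)) t)"
      have ch: "trig (\<lambda>t. cnj (h t))" by (rule trig_cnj[OF h(1)])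
      have h'L: "?h' \<in> LC q" by (intro Lspace_cnj trig_Lspace trig_tproj ch q0)
      have h'b: "LI q ?h' \<le> A * (2 powr q * (d powr q + I))"
        using AQ[OF ch] mult_left_mono[OF hb A] by simp
      have i1: "integrable ?M (\<lambda>t. g t * h t)" by (intro trig_integrable trig_mult g h)
      have i2: "integrable ?M (\<lambda>t. g t * (k t - h t))"
        by (rule circle.Lspace_integrable1[OF continuous_circle_Lspace
              [OF continuous_on_mult[OF gc continuous_on_diff[OF kc trig_continuous[OF h(1)]]], of 1]]) simp_all
      have "of_real I = (LINT t|?M. g t * h t) + (LINT t|?M. g t * (k t - h t))"
        unfolding gk[symmetric] using i1 i2 by (subst Bochner_Integration.integral_add[symmetric]) (auto simp: algebra_simps)
      then have "I = norm ((LINT t|?M. g t * h t) + (LINT t|?M. g t * (k t - h t)))"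
        using I0 by (metis abs_of_nonneg norm_of_real)
      also have "\<dots> \<le> norm (LINT t|?M. g t * h t) + norm (LINT t|?M. g t * (k t - h t))" by (rule norm_triangle_ineq)
      also have "norm (LINT t|?M. g t * h t) \<le> F * (A * (2 powr q * (d powr q + I))) powr (1/q)"
      proof -
        have "norm (LINT t|?M. g t * h t) = norm (LINT t|?M. f t * ?h' t)"
          unfolding g_def trig_tproj_adjoint[OF f h(1)] ..
        also have "\<dots> \<le> F * LI q ?h' powr (1/q)" unfolding F_def by (rule Holder(2)[OF p1 pq gL(2) h'L])
        also have "\<dots> \<le> F * (A * (2 powr q * (d powr q + I))) powr (1/q)"
          using h'b q1 by (intro mult_left_mono powr_mono2) (auto simp: F_def)
        finally show ?thesis .
      qed
      also have "norm (LINT t|?M. g t * (k t - h t)) \<le> d * (LINT t|?M. norm (g t))"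
      proof -
        have "norm (LINT t|?M. g t * (k t - h t)) \<le> (LINT t|?M. norm (g t * (k t - h t)))" by (rule integral_norm_bound)
        also have "\<dots> \<le> (LINT t|?M. d * norm (g t))"
        proof (rule integral_mono)
          show "integrable ?M (\<lambda>t. norm (g t * (k t - h t)))" using i2 by (rule integrable_norm)
          show "integrable ?M (\<lambda>t. d * norm (g t))" using trig_integrable[OF g] by auto
          show "norm (g t * (k t - h t)) \<le> d * norm (g t)" if "t \<in> space ?M" for t
            unfolding norm_mult using h(2)[of t] that mult_right_mono[of "norm (k t - h t)" d "norm (g t)"]
            by (simp add: mult.commute)
        qed
        finally show ?thesis by simp
      qed
      finally show ?thesis by simp
    qed
    have "I \<le> F * (A * (2 powr q * (0 + I))) powr (1/q) + 0 * (LINT t|?M. norm (g t))"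
    proof (rule tendsto_lowerbound)
      have l: "(\<lambda>n. 1 / real (Suc n)) \<longlonglongrightarrow> 0" by (rule LIMSEQ_Suc[OF lim_1_over_n])
      have l2: "(\<lambda>n. (1 / real (Suc n)) powr q) \<longlonglongrightarrow> 0" by (rule tendsto_powr_0[OF l]) (use q1 in auto)
      show "(\<lambda>n. F * (A * (2 powr q * ((1 / real (Suc n)) powr q + I))) powr (1/q) + 1 / real (Suc n) * (LINT t|?M. norm (g t)))
        \<longlonglongrightarrow> F * (A * (2 powr q * (0 + I))) powr (1/q) + 0 * (LINT t|?M. norm (g t))"
        using q1 A I0 by (intro tendsto_add tendsto_mult tendsto_const l l2 tendsto_powr') auto
      show "\<forall>\<^sub>F n in sequentially. I \<le> F * (A * (2 powr q * ((1 / real (Suc n)) powr q + I))) powr (1/q) + 1 / real (Suc n) * (LINT t|?M. norm (g t))"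
        by (intro always_eventually allI step) simp
    qed simp
    moreover have "(A * (2 powr q * (0 + I))) powr (1/q) = C * I powr (1/q)"
      unfolding C_def using powr_mult[of "A * 2 powr q" I "1/q"] A I0 by (simp only: add_0 mult.assoc)
    ultimately have I1: "I \<le> F * C * I powr (1/q)" by (simp only: mult.assoc)
    have "I \<le> C powr p * LI p f"
    proof (cases "I = 0")
      case False
      then have Ip: "0 < I" using I0 by simp
      have "I powr (1/p) * I powr (1/q) = I" using pq Ip by (simp add: powr_add[symmetric])
      then have "I powr (1/p) * I powr (1/q) \<le> F * C * I powr (1/q)" using I1 by simp
      then have "I powr (1/p) \<le> F * C" using Ip by simp
      then have "(I powr (1/p)) powr p \<le> (F * C) powr p" using p0 by (intro powr_mono2) auto
      also have "\<dots> = LI p f * C powr p" using p by (simp add: F_def C_def powr_mult powr_powr)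
      finally show ?thesis using p Ip by (simp add: powr_powr mult.commute)
    qed simp
    then show "LI p (tproj f) \<le> C powr p * LI p f" by (simp add: I_def g_def)
  qed simp
qed

lemma Riesz_trig:
  assumes "1 < p"
  obtains K where "0 \<le> K" "\<And>f. trig f \<Longrightarrow> LI p (tproj f) \<le> K * LI p f"
  using Riesz_le_2[OF assms] Riesz_ge_2 not_le by metis

lemma trig_seq:
  assumes p: "0 < p" and f: "f \<in> LC p" and e: "\<And>n::nat. 0 < e n"
  obtains r where "\<And>n. trig (r n)" "\<And>n. LI p (\<lambda>t. r n t - f t) < e n"
proof -
  have "\<exists>g. trig g \<and> LI p (\<lambda>t. g t - f t) < e n" for n
    using trig_dense[OF p f e[of n]] by (metis Lint_minus_commute)
  then show ?thesis using that by metis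
qed

text \<open>The projected approximants of f converge by completeness. The limit is described by its
  coefficients, which is the form needed to identify it with the choice made in
  \<open>riesz_proj\<close>.\<close>

theorem M_Riesz:
  assumes p: "1 < p"
  shows "\<exists>K\<ge>0. \<forall>f\<in>LC p. \<exists>g\<in>LC p.
       (\<forall>n. fourier_coeff g n = (if 0 \<le> n then fourier_coeff f n else 0)) \<and>
       LI p g \<le> K * LI p f"
proof -
  let ?M = circle_measure
  have p0: "0 \<le> p" and p0': "0 < p" using p by auto
  obtain A where A: "0 \<le> A" and AP: "\<And>f. trig f \<Longrightarrow> LI p (tproj f) \<le> A * LI p f"
    using Riesz_trig[OF p] by metis
  define B where "B = 2 powr p"
  have B: "0 < B" by (simp add: B_def)
  show ?thesis
  proof (intro exI[of _ "B * A * B"] conjI ballI)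
    show "0 \<le> B * A * B" using A B by simp
    fix f assume f: "f \<in> LC p"
    \<comment> \<open>The rate demanded by \<open>Lspace_complete\<close>; approximants this close
      to f have consecutive differences of the same order.\<close>
    define c where "c = 2 powr (-p) / 2"
    have "2 powr (-p) < 1" using p by (simp add: powr_less_one)
    then have c: "0 < c" "c < 1" by (auto simp: c_def)
    obtain r where r: "\<And>n. trig (r n)" "\<And>n. LI p (\<lambda>t. r n t - f t) < c ^ n"
      using trig_seq[OF p0' f, of "\<lambda>n. c ^ n"] c by auto
    have rL: "r n \<in> LC p" for n by (rule trig_Lspace[OF r(1) p0])
    have dL: "(\<lambda>t. r n t - f t) \<in> LC p" for n by (rule Lspace_diff(1)[OF p0 rL f])
    have r0: "(\<lambda>n. LI p (\<lambda>t. r n t - f t)) \<longlonglongrightarrow> 0"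
    proof (rule Lim_null_comparison)
      show "\<forall>\<^sub>F n in sequentially. norm (LI p (\<lambda>t. r n t - f t)) \<le> c ^ n"
        using r(2) by (intro always_eventually) (auto intro: less_imp_le)
      show "(\<lambda>n. c ^ n) \<longlonglongrightarrow> 0" using c by (intro LIMSEQ_power_zero) auto
    qed
    define s where "s n = tproj (r n)" for n
    have s: "trig (s n)" for n unfolding s_def by (rule trig_tproj[OF r(1)])
    have sL: "s n \<in> LC p" for n by (rule trig_Lspace[OF s p0])
    have "LI p (\<lambda>t. s (Suc n) t - s n t) \<le> (A * (B * 2)) * (2 powr (-p) / 2) ^ n" for n
    proof -
      have "LI p (\<lambda>t. s (Suc n) t - s n t) = LI p (tproj (\<lambda>t. r (Suc n) t - r n t))"
        unfolding s_def by (rule Lint_cong_circle) (simp add: tproj_diff r)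
      also have "\<dots> \<le> A * LI p (\<lambda>t. r (Suc n) t - r n t)" by (intro AP trig_diff r)
      also have "\<dots> = A * LI p (\<lambda>t. (r (Suc n) t - f t) - (r n t - f t))" by simp
      also have "\<dots> \<le> A * (B * (LI p (\<lambda>t. r (Suc n) t - f t) + LI p (\<lambda>t. r n t - f t)))"
        unfolding B_def by (intro mult_left_mono Lspace_diff dL p0 A)
      also have "\<dots> \<le> A * (B * (c ^ Suc n + c ^ n))"
        using A B r(2) by (intro mult_left_mono add_mono less_imp_le[OF r(2)]) auto
      also have "\<dots> \<le> A * (B * (c ^ n + c ^ n))"
        using A B c by (intro mult_left_mono add_right_mono) (auto simp: mult_left_le_one_le)
      finally show ?thesis by (simp add: c_def mult_ac)
    qed
    from Lspace_complete[OF p0' sL this] obtain g where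
      g: "g \<in> LC p" "(\<lambda>n. LI p (\<lambda>t. s n t - g t)) \<longlonglongrightarrow> 0" by blast
    show "\<exists>g\<in>LC p. (\<forall>n. fourier_coeff g n = (if 0 \<le> n then fourier_coeff f n else 0)) \<and>
       LI p g \<le> B * A * B * LI p f"
    proof (intro bexI[OF _ g(1)] conjI allI)
      fix k
      have 1: "(\<lambda>n. fourier_coeff (s n) k) \<longlonglongrightarrow> fourier_coeff g k" by (rule tendsto_fourier_coeff[OF p sL g])
      have 2: "(\<lambda>n. fourier_coeff (r n) k) \<longlonglongrightarrow> fourier_coeff f k" by (rule tendsto_fourier_coeff[OF p rL f r0])
      show "fourier_coeff g k = (if 0 \<le> k then fourier_coeff f k else 0)"
      proof (cases "0 \<le> k")
        case True
        then have "(\<lambda>n. fourier_coeff (s n) k) = (\<lambda>n. fourier_coeff (r n) k)" by (simp add: s_def fourier_coeff_tproj r)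
        with 1 2 True LIMSEQ_unique show ?thesis by auto
      next
        case False
        then have "(\<lambda>n. fourier_coeff (s n) k) = (\<lambda>n. 0)" by (simp add: s_def fourier_coeff_tproj r)
        with 1 False LIMSEQ_unique[OF _ tendsto_const] show ?thesis by auto
      qed
    next
      have "LI p g \<le> B * (LI p (\<lambda>t. s n t - g t) + A * (B * (LI p (\<lambda>t. r n t - f t) + LI p f)))" for n
      proof -
        have "LI p g \<le> B * (LI p (\<lambda>t. g t - s n t) + LI p (s n))"
          unfolding B_def by (rule Lint_le_Lint_diff[OF p0 g(1) sL])
        also have "LI p (s n) \<le> A * LI p (r n)" unfolding s_def by (rule AP[OF r(1)])
        also have "LI p (r n) \<le> B * (LI p (\<lambda>t. r n t - f t) + LI p f)"
          unfolding B_def by (rule Lint_le_Lint_diff[OF p0 rL f])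
        finally show ?thesis using A B by (simp add: Lint_minus_commute[of p ?M g] mult_left_mono)
      qed
      moreover have "(\<lambda>n. B * (LI p (\<lambda>t. s n t - g t) + A * (B * (LI p (\<lambda>t. r n t - f t) + LI p f))))
          \<longlonglongrightarrow> B * (0 + A * (B * (0 + LI p f)))"
        by (intro tendsto_intros g(2) r0)
      ultimately have "LI p g \<le> B * (0 + A * (B * (0 + LI p f)))"
        by (intro tendsto_lowerbound[OF _ always_eventually]) auto
      then show "LI p g \<le> B * A * B * LI p f" by (simp add: mult_ac)
    qed
  qed
qed

section \<open>The Riesz projection, the flip and Hardy spaces\<close>


lemma LC_integrable: "f \<in> LC p \<Longrightarrow> 1 < p \<Longrightarrow> integrable circle_measure f"
  by (rule circle.Lspace_integrable1) auto

lemma ae_eq_refl [simp]: "ae_eq f f"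
  by (simp add: ae_eq_def)

lemma ae_eq_sym: "ae_eq f g \<Longrightarrow> ae_eq g f"
  by (auto simp: ae_eq_def elim!: eventually_mono)

lemma ae_eq_trans [trans]: "ae_eq f g \<Longrightarrow> ae_eq g h \<Longrightarrow> ae_eq f h"
  unfolding ae_eq_def by (elim eventually_elim2) auto

lemma ae_eq_circle: "(\<And>t. t \<in> circle \<Longrightarrow> f t = g t) \<Longrightarrow> ae_eq f g"
  unfolding ae_eq_def by (rule AE_I2) simp

lemma ae_eq_flip: "ae_eq f g \<Longrightarrow> ae_eq (flip f) (flip g)"
  unfolding ae_eq_def flip_def by (drule AE_inverse_circle) (auto elim!: eventually_mono)

lemma ae_eq_add: "ae_eq f f' \<Longrightarrow> ae_eq g g' \<Longrightarrow> ae_eq (\<lambda>t. f t + g t) (\<lambda>t. f' t + g' t)"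
  unfolding ae_eq_def by (elim eventually_elim2) auto

lemma ae_eq_mult: "ae_eq f f' \<Longrightarrow> ae_eq g g' \<Longrightarrow> ae_eq (\<lambda>t. f t * g t) (\<lambda>t. f' t * g' t)"
  unfolding ae_eq_def by (elim eventually_elim2) auto

lemma LC_ae_eqI:
  assumes "f \<in> LC p" "g \<in> LC p" "1 < p" "\<And>n. fourier_coeff f n = fourier_coeff g n"
  shows "ae_eq f g"
  by (rule fourier_unique) (use assms LC_integrable in auto)

lemma fourier_coeff_ae_eq:
  assumes "f \<in> LC p" "g \<in> LC p" "ae_eq f g"
  shows "fourier_coeff f n = fourier_coeff g n"
  by (rule fourier_coeff_cong_AE) (use assms in \<open>auto simp: Lspace_def\<close>)

lemma LI_ae_eq:
  assumes "f \<in> LC p" "g \<in> LC p" "ae_eq f g" shows "LI p f = LI p g"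
  using Lspace_cong_AE(2)[of f p circle_measure g] assms by (auto simp: ae_eq_def Lspace_def)

lemma flip_LC:
  assumes "f \<in> LC p"
  shows "flip f \<in> LC p" and "LI p (flip f) = LI p f"
proof -
  have fm: "f \<in> borel_measurable circle_measure" using assms by (simp add: Lspace_def)
  have inv: "inverse \<in> borel_measurable circle_measure" by (intro borel_measurable_circle_borel) simp
  have m: "flip f \<in> borel_measurable circle_measure"
    unfolding flip_def by (intro borel_measurable_times inv measurable_compose[OF inverse_measurable_circle fm])
  let ?h = "\<lambda>t. norm (f t) powr p"
  have n: "norm (flip f t) powr p = ?h (inverse t)" if "t \<in> circle" for t
    using that by (simp add: flip_def norm_mult norm_inverse)
  have i: "integrable circle_measure (\<lambda>t. ?h (inverse t))"
    by (rule integrable_inverse_circle[of ?h]) (rule Lspace_integrable[OF assms])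
  show "flip f \<in> LC p" by (rule Lspace_dominated[OF m i]) (use n in \<open>auto intro: AE_I2\<close>)
  have "LI p (flip f) = (LINT t|circle_measure. ?h (inverse t))"
    unfolding Lint_def by (rule Bochner_Integration.integral_cong) (use n in auto)
  also have "\<dots> = LI p f"
    unfolding Lint_def by (rule integral_inverse_circle[of ?h]) (use fm in measurable)
  finally show "LI p (flip f) = LI p f" .
qed

lemma fourier_coeff_flip_LC: "f \<in> LC p \<Longrightarrow> fourier_coeff (flip f) n = fourier_coeff f (- n - 1)"
  by (rule fourier_coeff_flip) (auto simp: Lspace_def)

lemma riesz_proj_cong:
  assumes "\<And>n. fourier_coeff f n = fourier_coeff g n"
  shows "riesz_proj f = riesz_proj g"
  unfolding riesz_proj_def using assms by simp

text \<open>The choice promises no more than integrability and the coefficients. By uniqueness it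
  agrees almost everywhere with the function from \<open>M_Riesz\<close>, and thus inherits
  membership in \<open>L^p\<close>.\<close>

lemma riesz_proj:
  assumes p: "1 < p" and f: "f \<in> LC p"
  shows "riesz_proj f \<in> LC p"
    and "fourier_coeff (riesz_proj f) n = (if 0 \<le> n then fourier_coeff f n else 0)"
proof -
  obtain g where g: "g \<in> LC p" "\<forall>n. fourier_coeff g n = (if 0 \<le> n then fourier_coeff f n else 0)"
    using M_Riesz[OF p] f by blast
  have "integrable circle_measure (riesz_proj f) \<and> (\<forall>n. fourier_coeff (riesz_proj f) n = (if 0 \<le> n then fourier_coeff f n else 0))"
    unfolding riesz_proj_def by (rule someI[of _ g]) (use g p LC_integrable in auto)
  then have i: "integrable circle_measure (riesz_proj f)"
    and c: "\<And>n. fourier_coeff (riesz_proj f) n = (if 0 \<le> n then fourier_coeff f n else 0)" by auto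
  show "fourier_coeff (riesz_proj f) n = (if 0 \<le> n then fourier_coeff f n else 0)" by (rule c)
  have "ae_eq g (riesz_proj f)" by (rule fourier_unique) (use g i c p LC_integrable in auto)
  then show "riesz_proj f \<in> LC p"
    using Lspace_cong_AE(1)[OF g(1), of "riesz_proj f"] i by (auto simp: ae_eq_def)
qed

lemma riesz_proj_bounded:
  assumes p: "1 < p"
  shows "\<exists>K\<ge>0. \<forall>f\<in>LC p. LI p (riesz_proj f) \<le> K * LI p f"
proof -
  obtain K where K: "0 \<le> K" "\<forall>f\<in>LC p. \<exists>g\<in>LC p. (\<forall>n. fourier_coeff g n = (if 0 \<le> n then fourier_coeff f n else 0)) \<and> LI p g \<le> K * LI p f"
    using M_Riesz[OF p] by blast
  have "LI p (riesz_proj f) \<le> K * LI p f" if f: "f \<in> LC p" for f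
  proof -
    obtain g where g: "g \<in> LC p" "\<forall>n. fourier_coeff g n = (if 0 \<le> n then fourier_coeff f n else 0)" "LI p g \<le> K * LI p f"
      using K(2) f by blast
    have "ae_eq g (riesz_proj f)" by (rule LC_ae_eqI[OF g(1) riesz_proj(1)[OF p f] p]) (simp add: g riesz_proj[OF p f])
    then show ?thesis using LI_ae_eq[OF g(1) riesz_proj(1)[OF p f]] g by simp
  qed
  then show ?thesis using K(1) by blast
qed

text \<open>For f analytic, Pr - f = P(r - f), so boundedness of P turns approximants r of f into
  analytic approximants Pr.\<close>

lemma analytic_approx:
  assumes p: "1 < p" and f: "f \<in> LC p" "\<And>n. n < 0 \<Longrightarrow> fourier_coeff f n = 0"
  shows "\<exists>r. (\<forall>n::nat. trig (r n) \<and> (\<forall>k<0. fourier_coeff (r n) k = 0)) \<and> (\<lambda>n. LI p (\<lambda>t. r n t - f t)) \<longlonglongrightarrow> 0"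
proof -
  have p0: "0 \<le> p" "0 < p" using p by auto
  obtain K where K: "0 \<le> K" "\<forall>f\<in>LC p. LI p (riesz_proj f) \<le> K * LI p f" using riesz_proj_bounded[OF p] by blast
  have "\<exists>r. (\<forall>n. trig (r n)) \<and> (\<forall>n. LI p (\<lambda>t. r n t - f t) < 1 / real (Suc n))"
    by (rule trig_seq[OF p0(2) f(1), of "\<lambda>n. 1 / real (Suc n)"]) auto
  then obtain r where r: "\<And>n. trig (r n)" "\<And>n. LI p (\<lambda>t. r n t - f t) < 1 / real (Suc n)" by blast
  have b: "LI p (\<lambda>t. tproj (r n) t - f t) \<le> K * (1 / real (Suc n))" for n
  proof -
    have rL: "r n \<in> LC p" "tproj (r n) \<in> LC p" by (intro trig_Lspace trig_tproj r p0)+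
    have dL: "(\<lambda>t. r n t - f t) \<in> LC p" "(\<lambda>t. tproj (r n) t - f t) \<in> LC p" by (intro Lspace_diff p0 rL f)+
    have "ae_eq (\<lambda>t. tproj (r n) t - f t) (riesz_proj (\<lambda>t. r n t - f t))"
      by (rule LC_ae_eqI[OF dL(2) riesz_proj(1)[OF p dL(1)] p])
        (simp add: riesz_proj[OF p dL(1)] fourier_coeff_diff LC_integrable[OF _ p] rL f fourier_coeff_tproj r)
    then have "LI p (\<lambda>t. tproj (r n) t - f t) = LI p (riesz_proj (\<lambda>t. r n t - f t))"
      by (rule LI_ae_eq[OF dL(2) riesz_proj(1)[OF p dL(1)]])
    also have "\<dots> \<le> K * LI p (\<lambda>t. r n t - f t)" using K(2) dL(1) by blast
    also have "\<dots> \<le> K * (1 / real (Suc n))" by (intro mult_left_mono less_imp_le r K)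
    finally show ?thesis .
  qed
  have l: "(\<lambda>n. LI p (\<lambda>t. tproj (r n) t - f t)) \<longlonglongrightarrow> 0"
  proof (rule Lim_null_comparison)
    show "\<forall>\<^sub>F n in sequentially. norm (LI p (\<lambda>t. tproj (r n) t - f t)) \<le> K * (1 / real (Suc n))"
      using b by (intro always_eventually allI) simp
    show "(\<lambda>n. K * (1 / real (Suc n))) \<longlonglongrightarrow> 0"
      by (intro tendsto_mult_right_zero LIMSEQ_Suc[OF lim_1_over_n])
  qed
  show ?thesis
    by (intro exI[of _ "\<lambda>n. tproj (r n)"] conjI allI l impI) (simp_all add: trig_tproj r fourier_coeff_tproj)
qed

text \<open>For a polynomial in place of f this is a finite sum in which every product has a
  vanishing factor; Hoelder carries it to the limit. The product itself is only integrable, which is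
  why the approximation is made in one factor.\<close>

lemma fourier_coeff_mult_analytic:
  assumes p: "1 < p" "1 / p + 1 / q = 1" and f: "f \<in> LC p" "\<And>n. n < 0 \<Longrightarrow> fourier_coeff f n = 0"
    and g: "g \<in> LC q" "\<And>n. n < m \<Longrightarrow> fourier_coeff g n = 0" and n: "n < m"
  shows "fourier_coeff (\<lambda>t. f t * g t) n = 0"
proof -
  have p0: "0 \<le> p" using p by simp
  have q: "1 < q" by (rule conjugate_exponent_gt_1[OF p])
  obtain r where r: "\<And>n. trig (r n)" "\<And>n k. k < 0 \<Longrightarrow> fourier_coeff (r n) k = 0" "(\<lambda>n::nat. LI p (\<lambda>t. r n t - f t)) \<longlonglongrightarrow> 0"
    using analytic_approx[OF p(1) f] by blast
  \<comment> \<open>The shift makes the n-th coefficient of f g the integral of f h, and the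
    coefficients of h at all indices <= 0 vanish because n < m.\<close>
  define h where "h t = t powi (-n) * g t" for t
  have q0: "0 \<le> q" using q by simp
  have h: "h \<in> LC q" unfolding h_def[abs_def]
    by (rule Lspace_mult_bounded(1)[where C=1, OF q0 _ g(1)]) (auto intro: AE_I2)
  have hc: "fourier_coeff h (-j) = 0" if "0 \<le> j" for j
    unfolding h_def[abs_def] fourier_coeff_mult_powi using g(2)[of "-j + n"] that n by simp
  have "(LINT t|circle_measure. r k t * h t) = 0" for k
  proof -
    obtain N where N: "finite N" "\<And>n. n \<notin> N \<Longrightarrow> fourier_coeff (r k) n = 0" using trig_fourier[OF r(1)[of k]] by metis
    have z: "fourier_coeff (r k) j * fourier_coeff h (-j) = 0" for j
      using r(2)[of j k] hc[of j] by (cases "0 \<le> j") auto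
    have "(LINT t|circle_measure. r k t * h t) = (\<Sum>j\<in>N. fourier_coeff (r k) j * fourier_coeff h (-j))"
      by (rule trig_bilinear[OF r(1) N LC_integrable[OF h q]])
    also have "\<dots> = 0" by (rule sum.neutral) (simp only: z, simp)
    finally show ?thesis .
  qed
  then have "(\<lambda>k. LINT t|circle_measure. r k t * h t) \<longlonglongrightarrow> 0" by simp
  moreover have "(\<lambda>k. LINT t|circle_measure. r k t * h t) \<longlonglongrightarrow> (LINT t|circle_measure. f t * h t)"
    by (rule tendsto_Lint_integral[OF p trig_Lspace[OF r(1) p0] f(1) r(3) h])
  ultimately have "(LINT t|circle_measure. f t * h t) = 0" by (rule LIMSEQ_unique[symmetric])
  then show ?thesis by (simp add: fourier_coeff_def h_def mult_ac)
qed

lemma fourier_coeff_mult_coanalytic: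
  assumes p: "1 < p" "1 / p + 1 / q = 1" and f: "f \<in> LC p" "\<And>n. n > 0 \<Longrightarrow> fourier_coeff f n = 0"
    and g: "g \<in> LC q" "\<And>n. n > m \<Longrightarrow> fourier_coeff g n = 0" and n: "n > m"
  shows "fourier_coeff (\<lambda>t. f t * g t) n = 0"
proof -
  have "fourier_coeff (\<lambda>t. cnj (f t) * cnj (g t)) (-n) = 0"
    by (rule fourier_coeff_mult_analytic[OF p Lspace_cnj[OF f(1)] _ Lspace_cnj[OF g(1)], of "-m"])
      (use f g n in \<open>auto simp: fourier_coeff_cnj\<close>)
  then have "fourier_coeff (\<lambda>t. cnj (f t * g t)) (-n) = 0" by simp
  then show ?thesis unfolding fourier_coeff_cnj by simp
qed

section \<open>Hardy spaces and bounded operators in terms of p-th power integrals\<close>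

lemma Hp_iff: "f \<in> Hp p \<longleftrightarrow> f \<in> LC p \<and> (\<forall>n<0. fourier_coeff f n = 0)"
  by (simp add: Hp_def Lp_eq)

lemma cnj_Hp_iff: "f \<in> cnj_Hp p \<longleftrightarrow> f \<in> LC p \<and> (\<forall>n>0. fourier_coeff f n = 0)"
proof -
  have "(\<lambda>t. cnj (f t)) \<in> LC p \<longleftrightarrow> f \<in> LC p"
    using Lspace_cnj[of f p circle_measure] Lspace_cnj[of "\<lambda>t. cnj (f t)" p circle_measure] by auto
  moreover have "(\<forall>n<0. fourier_coeff f (- n) = 0) \<longleftrightarrow> (\<forall>n>0. fourier_coeff f n = 0)"
    by (metis neg_0_less_iff_less neg_less_0_iff_less minus_minus)
  ultimately show ?thesis by (simp add: cnj_Hp_def Hp_iff fourier_coeff_cnj)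
qed

lemma Lp_norm_bound_iff:
  assumes p: "0 < p"
  shows "(\<exists>C. \<forall>f\<in>U. Lp_norm p (A f) \<le> C * Lp_norm p f) \<longleftrightarrow> (\<exists>C\<ge>0. \<forall>f\<in>U. LI p (A f) \<le> C * LI p f)"
proof
  assume "\<exists>C. \<forall>f\<in>U. Lp_norm p (A f) \<le> C * Lp_norm p f"
  then obtain C where C: "\<And>f. f \<in> U \<Longrightarrow> LI p (A f) powr (1/p) \<le> C * LI p f powr (1/p)" by (auto simp: Lp_norm_eq)
  have "LI p (A f) \<le> \<bar>C\<bar> powr p * LI p f" if "f \<in> U" for f
  proof -
    have "LI p (A f) powr (1/p) \<le> \<bar>C\<bar> * LI p f powr (1/p)"
      by (rule order_trans[OF C[OF that] mult_right_mono]) auto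
    then have "(LI p (A f) powr (1/p)) powr p \<le> (\<bar>C\<bar> * LI p f powr (1/p)) powr p"
      using p by (intro powr_mono2) auto
    then show ?thesis using p by (simp add: powr_powr powr_mult)
  qed
  then show "\<exists>C\<ge>0. \<forall>f\<in>U. LI p (A f) \<le> C * LI p f" by (intro exI[of _ "\<bar>C\<bar> powr p"]) auto
next
  assume "\<exists>C\<ge>0. \<forall>f\<in>U. LI p (A f) \<le> C * LI p f"
  then obtain C where C: "0 \<le> C" "\<And>f. f \<in> U \<Longrightarrow> LI p (A f) \<le> C * LI p f" by auto
  have "LI p (A f) powr (1/p) \<le> C powr (1/p) * LI p f powr (1/p)" if "f \<in> U" for f
    using powr_mono2[OF _ _ C(2)[OF that], of "1/p"] p C(1) by (simp add: powr_mult)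
  then show "\<exists>C. \<forall>f\<in>U. Lp_norm p (A f) \<le> C * Lp_norm p f" unfolding Lp_norm_eq by blast
qed

lemma bounded_operator_iff:
  assumes "0 < p"
  shows "bounded_operator p U V A \<longleftrightarrow>
     (\<forall>f\<in>U. A f \<in> V) \<and>
     (\<forall>f\<in>U. \<forall>g\<in>U. ae_eq (A (\<lambda>t. f t + g t)) (\<lambda>t. A f t + A g t)) \<and>
     (\<forall>f\<in>U. \<forall>c. ae_eq (A (\<lambda>t. c * f t)) (\<lambda>t. c * A f t)) \<and>
     (\<exists>C\<ge>0. \<forall>f\<in>U. LI p (A f) \<le> C * LI p f)"
  unfolding bounded_operator_def Lp_norm_bound_iff[OF assms] ..

lemma riesz_proj_add:
  assumes p: "1 < p" and f: "f \<in> LC p" and g: "g \<in> LC p"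
  shows "ae_eq (riesz_proj (\<lambda>t. f t + g t)) (\<lambda>t. riesz_proj f t + riesz_proj g t)"
proof (rule LC_ae_eqI[OF _ _ p])
  have p0: "0 \<le> p" using p by simp
  have fg: "(\<lambda>t. f t + g t) \<in> LC p" by (rule Lspace_add(1)[OF p0 f g])
  show "riesz_proj (\<lambda>t. f t + g t) \<in> LC p" by (rule riesz_proj(1)[OF p fg])
  show "(\<lambda>t. riesz_proj f t + riesz_proj g t) \<in> LC p" by (intro Lspace_add p0 riesz_proj p f g)
  show "fourier_coeff (riesz_proj (\<lambda>t. f t + g t)) n = fourier_coeff (\<lambda>t. riesz_proj f t + riesz_proj g t) n" for n
    by (simp add: riesz_proj[OF p] f g fg fourier_coeff_add LC_integrable[OF _ p])
qed

lemma riesz_proj_scale: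
  assumes p: "1 < p" and f: "f \<in> LC p"
  shows "ae_eq (riesz_proj (\<lambda>t. c * f t)) (\<lambda>t. c * riesz_proj f t)"
  by (rule LC_ae_eqI[OF _ _ p])
    (auto simp: riesz_proj[OF p] f Lspace_scale fourier_coeff_scale)

lemma Linf_mult:
  assumes "\<phi> \<in> Linf" "0 \<le> p"
  shows "\<exists>C\<ge>0. \<forall>f\<in>LC p. (\<lambda>t. \<phi> t * f t) \<in> LC p \<and> LI p (\<lambda>t. \<phi> t * f t) \<le> C * LI p f"
proof -
  obtain C where C: "\<phi> \<in> borel_measurable circle_measure" "AE t in circle_measure. norm (\<phi> t) \<le> C"
    using assms by (auto simp: Linf_def)
  have C': "AE t in circle_measure. norm (\<phi> t) \<le> max C 0" using C(2) by (auto elim!: eventually_mono)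
  show ?thesis
    by (rule exI[of _ "(max C 0) powr p"])
      (use Lspace_mult_bounded[OF assms(2) _ _ C(1) C'] in auto)
qed

lemma flip_add: "flip (\<lambda>t. f t + g t) = (\<lambda>t. flip f t + flip g t)"
  by (simp add: flip_def distrib_left)

lemma flip_scale: "flip (\<lambda>t. c * f t) = (\<lambda>t. c * flip f t)"
  by (simp add: flip_def mult.left_commute)

lemma flip_flip:
  assumes "t \<in> circle" shows "flip (flip f) t = f t"
proof -
  have "t \<noteq> 0" using assms by auto
  then show ?thesis by (simp add: flip_def)
qed

lemma symmetrization_Lp_J:
  assumes "0 \<le> p" "h \<in> LC p"
  shows "(\<lambda>t. h t + flip h t) \<in> Lp_J p"
proof -
  have "ae_eq (flip (\<lambda>t. h t + flip h t)) (\<lambda>t. h t + flip h t)"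
    unfolding flip_add by (rule ae_eq_circle) (simp only: flip_flip add.commute)
  then show ?thesis using Lspace_add(1)[OF assms flip_LC(1)[OF assms(2)]] by (simp add: Lp_J_def Lp_eq)
qed

lemma Lp_J_LC: "g \<in> Lp_J p \<Longrightarrow> g \<in> LC p"
  by (simp add: Lp_J_def Lp_eq)

text \<open>The flip exchanges the indices n and -n-1, so it swaps nonnegative with negative ones
  and fixes none. A flip-invariant function is thus the projection plus its mirror image.\<close>

lemma symmetrization_riesz_proj:
  assumes p: "1 < p" and g: "g \<in> Lp_J p"
  shows "ae_eq (\<lambda>t. riesz_proj g t + flip (riesz_proj g) t) g"
proof (rule LC_ae_eqI[OF _ Lp_J_LC[OF g] p])
  note gL = Lp_J_LC[OF g]
  have p0: "0 \<le> p" using p by simp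
  note P = riesz_proj[OF p gL]
  show "(\<lambda>t. riesz_proj g t + flip (riesz_proj g) t) \<in> LC p" by (intro Lspace_add p0 P flip_LC)
  fix n
  have s: "fourier_coeff g (- n - 1) = fourier_coeff g n"
    using fourier_coeff_ae_eq[OF flip_LC(1)[OF gL] gL] g fourier_coeff_flip_LC[OF gL, of n] by (simp add: Lp_J_def)
  show "fourier_coeff (\<lambda>t. riesz_proj g t + flip (riesz_proj g) t) n = fourier_coeff g n"
    using s by (simp add: fourier_coeff_add LC_integrable[OF _ p] P flip_LC fourier_coeff_flip_LC[OF P(1)])
qed

text \<open>Merges the two independent choices of \<open>riesz_proj\<close> into one projection of
  phi (h + Jh). Later arguments see M(phi) only through these coefficients.\<close>

lemma toeplitz_plus_hankel:
  assumes p: "1 < p" and \<phi>: "\<phi> \<in> Linf" and h: "h \<in> LC p"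
  shows "toeplitz_plus_hankel \<phi> h \<in> Hp p"
    and "0 \<le> n \<Longrightarrow> fourier_coeff (toeplitz_plus_hankel \<phi> h) n = fourier_coeff (\<lambda>t. \<phi> t * (h t + flip h t)) n"
    and "ae_eq (toeplitz_plus_hankel \<phi> h) (riesz_proj (\<lambda>t. \<phi> t * (h t + flip h t)))"
proof -
  have p0: "0 \<le> p" using p by simp
  obtain C where C: "\<And>f. f \<in> LC p \<Longrightarrow> (\<lambda>t. \<phi> t * f t) \<in> LC p" using Linf_mult[OF \<phi> p0] by blast
  have L: "(\<lambda>t. \<phi> t * h t) \<in> LC p" "(\<lambda>t. \<phi> t * flip h t) \<in> LC p" by (intro C h flip_LC)+
  have s: "(\<lambda>t. \<phi> t * (h t + flip h t)) = (\<lambda>t. \<phi> t * h t + \<phi> t * flip h t)" by (simp add: distrib_left)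
  note P = riesz_proj[OF p L(1)] riesz_proj[OF p L(2)]
  have M: "toeplitz_plus_hankel \<phi> h \<in> LC p"
    unfolding toeplitz_plus_hankel_def toeplitz_def hankel_def by (intro Lspace_add p0 P)
  have c: "fourier_coeff (toeplitz_plus_hankel \<phi> h) n = (if 0 \<le> n then fourier_coeff (\<lambda>t. \<phi> t * (h t + flip h t)) n else 0)" for n
    unfolding toeplitz_plus_hankel_def toeplitz_def hankel_def s
    by (simp add: fourier_coeff_add LC_integrable[OF _ p] P L)
  show "toeplitz_plus_hankel \<phi> h \<in> Hp p" using M c by (simp add: Hp_iff)
  show "0 \<le> n \<Longrightarrow> fourier_coeff (toeplitz_plus_hankel \<phi> h) n = fourier_coeff (\<lambda>t. \<phi> t * (h t + flip h t)) n"
    by (simp add: c)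
  have L3: "(\<lambda>t. \<phi> t * (h t + flip h t)) \<in> LC p" by (intro C Lspace_add p0 h flip_LC)
  show "ae_eq (toeplitz_plus_hankel \<phi> h) (riesz_proj (\<lambda>t. \<phi> t * (h t + flip h t)))"
    by (rule LC_ae_eqI[OF M riesz_proj(1)[OF p L3] p]) (simp add: c riesz_proj[OF p L3])
qed

lemma toeplitz_plus_hankel_bounded:
  assumes p: "1 < p" and \<phi>: "\<phi> \<in> Linf"
  shows "bounded_operator p (Hp p) (Hp p) (toeplitz_plus_hankel \<phi>)"
proof -
  have p0: "0 \<le> p" "0 < p" using p by auto
  obtain C where C: "0 \<le> C" "\<And>f. f \<in> LC p \<Longrightarrow> (\<lambda>t. \<phi> t * f t) \<in> LC p"
    "\<And>f. f \<in> LC p \<Longrightarrow> LI p (\<lambda>t. \<phi> t * f t) \<le> C * LI p f" using Linf_mult[OF \<phi> p0(1)] by blast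
  obtain K where K: "0 \<le> K" "\<And>f. f \<in> LC p \<Longrightarrow> LI p (riesz_proj f) \<le> K * LI p f" using riesz_proj_bounded[OF p] by blast
  let ?M = "toeplitz_plus_hankel \<phi>"
  let ?s = "\<lambda>h t. h t + flip h t"
  have sL: "?s h \<in> LC p" "LI p (?s h) \<le> 2 powr p * (LI p h + LI p h)" if "h \<in> LC p" for h
    using Lspace_add[OF p0(1) that flip_LC(1)[OF that]] flip_LC(2)[OF that] by auto
  have phis: "(\<lambda>t. \<phi> t * ?s h t) \<in> LC p" if "h \<in> LC p" for h by (rule C(2)[OF sL(1)[OF that]])
  have M: "ae_eq (?M h) (riesz_proj (\<lambda>t. \<phi> t * ?s h t))" if "h \<in> LC p" for h
    by (rule toeplitz_plus_hankel(3)[OF p \<phi> that])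
  show ?thesis
    unfolding bounded_operator_iff[OF p0(2)]
  proof (intro conjI ballI allI exI[of _ "K * (C * (2 powr p * 2))"])
    fix f assume "f \<in> Hp p"
    then have f: "f \<in> LC p" by (simp add: Hp_iff)
    show "?M f \<in> Hp p" by (rule toeplitz_plus_hankel(1)[OF p \<phi> f])
    then have "?M f \<in> LC p" by (simp add: Hp_iff)
    then have "LI p (?M f) = LI p (riesz_proj (\<lambda>t. \<phi> t * ?s f t))" by (intro LI_ae_eq riesz_proj p phis f M)
    also have "\<dots> \<le> K * LI p (\<lambda>t. \<phi> t * ?s f t)" by (rule K(2)[OF phis[OF f]])
    also have "\<dots> \<le> K * (C * (2 powr p * (LI p f + LI p f)))"
      by (intro mult_left_mono order_trans[OF C(3)[OF sL(1)[OF f]]] K C sL f)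
    finally show "LI p (?M f) \<le> K * (C * (2 powr p * 2)) * LI p f" by (simp add: algebra_simps)
    show "ae_eq (?M (\<lambda>t. c * f t)) (\<lambda>t. c * ?M f t)" for c
    proof -
      have "ae_eq (?M (\<lambda>t. c * f t)) (riesz_proj (\<lambda>t. \<phi> t * (c * f t + flip (\<lambda>t. c * f t) t)))"
        by (rule M[OF Lspace_scale[OF f]])
      also have "(\<lambda>t. \<phi> t * (c * f t + flip (\<lambda>t. c * f t) t)) = (\<lambda>t. c * (\<phi> t * ?s f t))"
        by (simp add: flip_scale algebra_simps)
      also have "ae_eq (riesz_proj (\<lambda>t. c * (\<phi> t * ?s f t))) (\<lambda>t. c * riesz_proj (\<lambda>t. \<phi> t * ?s f t) t)"
        by (rule riesz_proj_scale[OF p phis[OF f]])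
      also have "ae_eq \<dots> (\<lambda>t. c * ?M f t)"
        by (rule ae_eq_mult[OF ae_eq_refl ae_eq_sym[OF M[OF f]]])
      finally show ?thesis .
    qed
    fix g assume "g \<in> Hp p"
    then have g: "g \<in> LC p" by (simp add: Hp_iff)
    show "ae_eq (?M (\<lambda>t. f t + g t)) (\<lambda>t. ?M f t + ?M g t)"
    proof -
      have "ae_eq (?M (\<lambda>t. f t + g t)) (riesz_proj (\<lambda>t. \<phi> t * (f t + g t + flip (\<lambda>t. f t + g t) t)))"
        by (rule M[OF Lspace_add(1)[OF p0(1) f g]])
      also have "(\<lambda>t. \<phi> t * (f t + g t + flip (\<lambda>t. f t + g t) t)) = (\<lambda>t. \<phi> t * ?s f t + \<phi> t * ?s g t)"
        by (simp add: flip_add algebra_simps)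
      also have "ae_eq (riesz_proj (\<lambda>t. \<phi> t * ?s f t + \<phi> t * ?s g t)) (\<lambda>t. riesz_proj (\<lambda>t. \<phi> t * ?s f t) t + riesz_proj (\<lambda>t. \<phi> t * ?s g t) t)"
        by (rule riesz_proj_add[OF p phis[OF f] phis[OF g]])
      also have "ae_eq \<dots> (\<lambda>t. ?M f t + ?M g t)"
        by (rule ae_eq_add[OF ae_eq_sym[OF M[OF f]] ae_eq_sym[OF M[OF g]]])
      finally show ?thesis .
    qed
  qed (use K C in auto)
qed

section \<open>Asymmetric factorization\<close>

text \<open>Measurability of 1/phi_0 has to be recovered from that of |1 + t| / phi_0, and dividing
  by the weight fails at one point only.\<close>

lemma measurable_off_point:
  assumes f: "f \<in> borel_measurable circle_measure" and eq: "\<And>t. t \<in> circle \<Longrightarrow> t \<noteq> a \<Longrightarrow> f t = g t"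
  shows "g \<in> borel_measurable circle_measure"
proof -
  have "{t \<in> space circle_measure. t = a} = {a} \<inter> circle" by auto
  moreover have "{a} \<inter> circle \<in> sets circle_measure"
    unfolding sets_circle sets_restrict_space by (rule image_eqI[of _ _ "{a}"]) auto
  ultimately have "{t \<in> space circle_measure. t = a} \<in> sets circle_measure" by simp
  then have "(\<lambda>t. if t = a then g a else f t) \<in> borel_measurable circle_measure"
    by (intro measurable_If f) auto
  then show ?thesis by (rule measurable_cong[THEN iffD1, rotated]) (use eq in auto)
qed

lemma trig_mult_LC:
  assumes "trig r" "f \<in> LC p" "0 \<le> p" shows "(\<lambda>t. r t * f t) \<in> LC p"
proof -
  have c: "continuous_on circle r" by (rule trig_continuous[OF assms(1)])
  obtain C where C: "0 \<le> C" "\<And>t. t \<in> circle \<Longrightarrow> norm (r t) \<le> C" using continuous_circle_bounded[OF c] by blast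
  show ?thesis
    by (rule Lspace_mult_bounded(1)[OF assms(3) C(1) assms(2) borel_measurable_circle_continuous[OF c]])
      (use C in \<open>auto intro: AE_I2\<close>)
qed

lemma trig_inverse_id: "trig inverse"
  using trig_monom[of 1 "-1"] by (simp add: power_int_minus)

lemma trig_one_plus: "trig (\<lambda>t. 1 + inverse t)"
  by (intro trig_add trig_const trig_inverse_id)

lemma trig_one_minus: "trig (\<lambda>t. 1 - inverse t)"
  by (intro trig_diff trig_const trig_inverse_id)

lemma norm_one_plus_inverse:
  fixes t :: complex
  assumes "t \<in> circle" shows "norm (1 + inverse t) = norm (1 + t)" "norm (1 - inverse t) = norm (1 - t)"
proof -
  have t: "norm t = 1" "t \<noteq> 0" using assms by auto
  have "1 + inverse t = inverse t * (1 + t)" "1 - inverse t = - (inverse t * (1 - t))"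
    using t by (simp_all add: field_simps)
  then show "norm (1 + inverse t) = norm (1 + t)" "norm (1 - inverse t) = norm (1 - t)"
    using t by (simp_all add: norm_mult norm_inverse)
qed

text \<open>The even quotient is the alternating sum t^n - t^(n-1) + ... + t^(-n), obtained by
  e_(n+1) = t^(n+1) + t^(-n-1) - e_n. This is the origin of the factor 1 + 1/t and of the even
  polynomials in \<open>X2\<close>.\<close>

lemma symmetrized_monomial:
  "\<exists>e. trig e \<and> (\<forall>t\<in>circle. e (inverse t) = e t) \<and>
     (\<forall>t\<in>circle. t powi (int n) + t powi (- int n - 1) = (1 + inverse t) * e t)"
proof (induction n)
  case 0
  show ?case by (rule exI[of _ "\<lambda>t. 1"]) (auto simp: trig_const power_int_minus)
next
  case (Suc n)
  then obtain e where e: "trig e" "\<And>t. t \<in> circle \<Longrightarrow> e (inverse t) = e t"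
    "\<And>t. t \<in> circle \<Longrightarrow> t powi (int n) + t powi (- int n - 1) = (1 + inverse t) * e t" by blast
  let ?k = "int (Suc n)"
  let ?e = "\<lambda>t. t powi ?k + t powi (- ?k) - e t"
  have "trig ?e"
    using trig_diff[OF trig_add[OF trig_monom[of 1 ?k] trig_monom[of 1 "- ?k"]] e(1)] by simp
  moreover have "?e (inverse t) = ?e t" if "t \<in> circle" for t
  proof -
    have "inverse t powi k = t powi (- k)" for k by (simp add: power_int_inverse power_int_minus)
    then show ?thesis by (simp only: e(2)[OF that] minus_minus add.commute)
  qed
  moreover have "t powi ?k + t powi (- ?k - 1) = (1 + inverse t) * ?e t" if t: "t \<in> circle" for t
  proof -
    have t0: "t \<noteq> 0" using t by auto
    have 1: "inverse t * t powi ?k = t powi (int n)"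
      using t0 by (simp add: power_int_add power_int_minus)
    have 2: "inverse t * t powi (- ?k) = t powi (- ?k - 1)"
      using t0 power_int_diff[of t "- ?k" 1] by (simp add: field_simps)
    have 3: "- int n - 1 = - ?k" by simp
    have "(1 + inverse t) * ?e t = t powi ?k + t powi (- ?k) + (inverse t * t powi ?k + inverse t * t powi (- ?k)) - (1 + inverse t) * e t"
      by (simp only: distrib_left distrib_right right_diff_distrib mult_1 add.assoc) (simp only: algebra_simps)
    also have "\<dots> = t powi ?k + t powi (- ?k - 1)"
      unfolding 1 2 e(3)[OF t, symmetric] 3 by simp
    finally show ?thesis by simp
  qed
  ultimately show ?case by blast
qed

text \<open>The replacement for dividing by 1 + 1/t: alternation keeps the modulus constant, and a
  constant null sequence is zero.\<close>

lemma alternating_null: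
  fixes c :: "int \<Rightarrow> complex"
  assumes alt: "\<And>n. 0 \<le> n \<Longrightarrow> c n + c (n + 1) = 0" and lim: "(\<lambda>n. c (int n)) \<longlonglongrightarrow> 0" and n: "0 \<le> n"
  shows "c n = 0"
proof -
  have "norm (c (int k)) = norm (c 0)" for k
  proof (induction k)
    case (Suc k)
    have "c (int (Suc k)) = - c (int k)" using alt[of "int k"] by (simp add: add_eq_0_iff add.commute)
    then show ?case using Suc by simp
  qed simp
  note k = this
  have "(\<lambda>k. norm (c (int k))) \<longlonglongrightarrow> 0" using lim by (rule tendsto_norm_zero)
  then have "(\<lambda>k::nat. norm (c 0)) \<longlonglongrightarrow> 0" unfolding k .
  then have "norm (c 0) = 0" by (simp add: LIMSEQ_const_iff)
  then show ?thesis using k[of "nat n"] n by simp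
qed

lemma X1_cases:
  assumes "f \<in> X1"
  obtains r where "trig r" "f = (\<lambda>t. (1 - inverse t) * r t)"
proof -
  obtain r where "r \<in> trig_polys" "f = (\<lambda>t. (1 - inverse t) * r t)" using assms unfolding X1_def by blast
  moreover from this(1) have "trig r" unfolding trig_polys_def trig_def by blast
  ultimately show ?thesis using that by blast
qed

lemma X1_trig: "f \<in> X1 \<Longrightarrow> trig f"
  by (erule X1_cases) (simp add: trig_mult trig_one_minus)

lemma trig_repr:
  assumes "trig r" shows "\<exists>r'\<in>trig_polys. \<forall>t\<in>circle. r' t = r t"
proof -
  obtain N c where "finite N" "\<forall>t\<in>circle. r t = (\<Sum>n\<in>N. c n * t powi n)" using assms unfolding trig_def by blast
  then show ?thesis unfolding trig_polys_def by (intro bexI[of _ "\<lambda>t. \<Sum>n\<in>N. c n * t powi n"]) auto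
qed

section \<open>The symbol, its factors and the operator B on \<open>X1\<close>\<close>

locale symbol =
  fixes p q :: real and \<phi> :: "complex \<Rightarrow> complex"
  assumes p: "1 < p" and pq: "1 / p + 1 / q = 1" and phi_GL: "\<phi> \<in> GLinf"
begin

lemma q: "1 < q" by (rule conjugate_exponent_gt_1[OF p pq])

lemma p0: "0 \<le> p" "0 < p" and q0: "0 \<le> q" "0 < q" using p q by auto

lemma qp: "1 / q + 1 / p = 1" using pq by simp

lemma phi_Linf: "\<phi> \<in> Linf" using phi_GL by (simp add: GLinf_def)

lemma phi_nonzero: "AE t in circle_measure. \<phi> t \<noteq> 0"
proof -
  obtain g where "ae_eq (\<lambda>t. \<phi> t * g t) (\<lambda>t. 1)" using phi_GL by (auto simp: GLinf_def)
  then show ?thesis unfolding ae_eq_def by eventually_elim auto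
qed

lemma phi_mult: "f \<in> LC p \<Longrightarrow> (\<lambda>t. \<phi> t * f t) \<in> LC p" "f \<in> LC q \<Longrightarrow> (\<lambda>t. \<phi> t * f t) \<in> LC q"
  using Linf_mult[OF phi_Linf p0(1)] Linf_mult[OF phi_Linf q0(1)] by blast+

lemma AE_circle: "AE t in circle_measure. t \<in> circle"
  by (rule AE_I2) simp

end

text \<open>Both directions work here: in one the factors are given, in the other they have just
  been constructed and B has to be compared with the inverse of M.\<close>

locale factors = symbol +
  fixes \<phi>\<^sub>m \<phi>\<^sub>0 :: "complex \<Rightarrow> complex"
  assumes fac: "ae_eq \<phi> (\<lambda>t. \<phi>\<^sub>m t * \<phi>\<^sub>0 t)"
    and psi: "(\<lambda>t. (1 + inverse t) * \<phi>\<^sub>m t) \<in> cnj_Hp p"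
    and eta: "(\<lambda>t. (1 - inverse t) * inverse (\<phi>\<^sub>m t)) \<in> cnj_Hp q"
    and even0: "(\<lambda>t. of_real (norm (1 - t)) * \<phi>\<^sub>0 t) \<in> Lp_even q"
    and even1: "(\<lambda>t. of_real (norm (1 + t)) * inverse (\<phi>\<^sub>0 t)) \<in> Lp_even p"
begin

lemma AE_regular: "AE t in circle_measure. t \<in> circle \<and> t \<noteq> 1 \<and> t \<noteq> -1 \<and> \<phi>\<^sub>0 t \<noteq> 0 \<and> \<phi>\<^sub>m t \<noteq> 0 \<and> \<phi> t = \<phi>\<^sub>m t * \<phi>\<^sub>0 t"
  using AE_circle AE_circle_not_singleton[of 1] AE_circle_not_singleton[of "-1"] phi_nonzero fac[unfolded ae_eq_def]
  by eventually_elim auto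

lemma phi0_even: "AE t in circle_measure. \<phi>\<^sub>0 (inverse t) = \<phi>\<^sub>0 t"
proof -
  have "AE t in circle_measure. of_real (norm (1 - t)) * \<phi>\<^sub>0 t = of_real (norm (1 - inverse t)) * \<phi>\<^sub>0 (inverse t)"
    using even0 by (simp add: Lp_even_def ae_eq_def)
  then show ?thesis
    using AE_regular by eventually_elim (auto simp: norm_one_plus_inverse)
qed

lemma inverse_phi0_measurable: "(\<lambda>t. inverse (\<phi>\<^sub>0 t)) \<in> borel_measurable circle_measure"
proof (rule measurable_off_point[where a="-1"])
  have "(\<lambda>t. of_real (norm (1 + t)) * inverse (\<phi>\<^sub>0 t)) \<in> borel_measurable circle_measure"
    using even1 by (simp add: Lp_even_def Lp_def)
  moreover have "(\<lambda>t. complex_of_real (inverse (norm (1 + t)))) \<in> borel_measurable circle_measure"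
    by (intro borel_measurable_circle_borel) simp
  ultimately show "(\<lambda>t. complex_of_real (inverse (norm (1 + t))) * (of_real (norm (1 + t)) * inverse (\<phi>\<^sub>0 t))) \<in> borel_measurable circle_measure"
    by (rule borel_measurable_times[rotated])
  show "complex_of_real (inverse (norm (1 + t))) * (of_real (norm (1 + t)) * inverse (\<phi>\<^sub>0 t)) = inverse (\<phi>\<^sub>0 t)" if "t \<noteq> -1" for t
  proof -
    have "norm (1 + t) \<noteq> 0" using that by (simp add: add_eq_0_iff)
    then show ?thesis by simp
  qed
qed

lemma G_LC: "(\<lambda>t. (1 + inverse t) * inverse (\<phi>\<^sub>0 t)) \<in> LC p"
proof (rule Lspace_norm_cong)
  show "(\<lambda>t. of_real (norm (1 + t)) * inverse (\<phi>\<^sub>0 t)) \<in> LC p" using even1 by (simp add: Lp_even_def Lp_eq)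
  show "(\<lambda>t. (1 + inverse t) * inverse (\<phi>\<^sub>0 t)) \<in> borel_measurable circle_measure"
    by (intro borel_measurable_times inverse_phi0_measurable borel_measurable_circle_borel) simp
  show "AE t in circle_measure. norm ((1 + inverse t) * inverse (\<phi>\<^sub>0 t)) = norm (of_real (norm (1 + t)) * inverse (\<phi>\<^sub>0 t))"
    using AE_circle by eventually_elim (simp add: norm_mult norm_one_plus_inverse)
qed

text \<open>For f = (1 - 1/t) r, the function u = f / phi_- is r times an antianalytic function, so
  its projection T is a polynomial. Then T + JT = (1 + 1/t) e with e even, which puts Bf into
  \<open>X2\<close>; integrability comes from the weighted bound on 1/phi_0.\<close>

lemma B_op_X1:
  assumes f: "f \<in> X1"
  shows "\<exists>b\<in>X2 \<phi>\<^sub>0. ae_eq (B_op \<phi>\<^sub>m \<phi>\<^sub>0 f) b \<and> b \<in> Lp_J p \<and> (\<forall>n\<ge>0. fourier_coeff (\<lambda>t. \<phi> t * b t) n = fourier_coeff f n)"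
proof -
  obtain r where r: "trig r" and fr: "f = (\<lambda>t. (1 - inverse t) * r t)" using X1_cases[OF f] .
  have ft: "trig f" by (rule X1_trig[OF f])
  define y where "y t = (1 - inverse t) * inverse (\<phi>\<^sub>m t)" for t
  define \<psi> where "\<psi> t = (1 + inverse t) * \<phi>\<^sub>m t" for t
  define u where "u t = inverse (\<phi>\<^sub>m t) * f t" for t
  have y: "y \<in> LC q" "\<And>n. n > 0 \<Longrightarrow> fourier_coeff y n = 0" using eta by (auto simp: cnj_Hp_iff y_def[abs_def])
  have \<psi>: "\<psi> \<in> LC p" "\<And>n. n > 0 \<Longrightarrow> fourier_coeff \<psi> n = 0" using psi by (auto simp: cnj_Hp_iff \<psi>_def[abs_def])
  have uy: "u = (\<lambda>t. r t * y t)" by (auto simp: u_def y_def fr)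
  have uL: "u \<in> LC q" unfolding uy by (rule trig_mult_LC[OF r y(1) q0(1)])
  obtain N where N: "finite N" "\<And>n. n \<notin> N \<Longrightarrow> fourier_coeff r n = 0" using trig_fourier[OF r] by metis
  obtain d where d: "\<And>n. n \<in> N \<Longrightarrow> n \<le> d" using bdd_above_finite[OF N(1)] by (auto simp: bdd_above_def)
  have rd: "fourier_coeff r n = 0" if "n > d" for n
    by (rule N(2)) (use d[of n] that in auto)
  \<comment> \<open>Here d bounds the degree of r, and the antianalytic factor y adds no positive
    index.\<close>
  have ud: "fourier_coeff u n = 0" if "n > d" for n
  proof -
    have "fourier_coeff (\<lambda>t. y t * r t) n = 0"
      by (rule fourier_coeff_mult_coanalytic[OF q qp y trig_Lspace[OF r p0(1)] rd that])
    then show ?thesis by (simp add: uy mult.commute)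
  qed
  define T where "T t = (\<Sum>n\<in>{0..d}. fourier_coeff u n * t powi n)" for t
  have T: "trig T" unfolding T_def[abs_def] by (rule trig_sum_powi) simp
  have Tc: "fourier_coeff T n = (if 0 \<le> n then fourier_coeff u n else 0)" for n
    unfolding T_def[abs_def] using ud by (subst fourier_coeff_trig_sum) auto
  have TL: "T \<in> LC q" by (rule trig_Lspace[OF T q0(1)])
  have gT: "ae_eq (riesz_proj u) T"
    by (rule LC_ae_eqI[OF riesz_proj(1)[OF q uL] TL q]) (simp add: riesz_proj[OF q uL] Tc)
  have "\<forall>n. \<exists>e. trig e \<and> (\<forall>t\<in>circle. e (inverse t) = e t) \<and>
     (\<forall>t\<in>circle. t powi (int n) + t powi (- int n - 1) = (1 + inverse t) * e t)"
    using symmetrized_monomial by blast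
  then obtain E where E: "\<And>n. trig (E n)" "\<And>n t. t \<in> circle \<Longrightarrow> E n (inverse t) = E n t"
     "\<And>n t. t \<in> circle \<Longrightarrow> t powi (int n) + t powi (- int n - 1) = (1 + inverse t) * E n t"
    by metis
  define e where "e t = (\<Sum>n\<in>{0..d}. fourier_coeff u n * E (nat n) t)" for t
  have e: "trig e" unfolding e_def[abs_def] by (intro trig_sum trig_scale E)
  have ee: "e (inverse t) = e t" if "t \<in> circle" for t unfolding e_def by (simp only: E(2)[OF that])
  have we: "T t + flip T t = (1 + inverse t) * e t" if t: "t \<in> circle" for t
  proof -
    have t0: "t \<noteq> 0" using t by auto
    have "flip T t = (\<Sum>n\<in>{0..d}. fourier_coeff u n * t powi (- n - 1))"
      unfolding flip_def T_def sum_distrib_left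
    proof (rule sum.cong[OF refl])
      fix n
      have "t powi (- n - 1) = inverse t powi n * inverse t"
        using power_int_diff[of t "-n" 1] t0 by (simp add: power_int_minus power_int_inverse field_simps)
      then show "inverse t * (fourier_coeff u n * inverse t powi n) = fourier_coeff u n * t powi (- n - 1)" by simp
    qed
    then have "T t + flip T t = (\<Sum>n\<in>{0..d}. fourier_coeff u n * (t powi n + t powi (- n - 1)))"
      by (simp add: T_def sum.distrib distrib_left)
    also have "\<dots> = (\<Sum>n\<in>{0..d}. (1 + inverse t) * (fourier_coeff u n * E (nat n) t))"
    proof (rule sum.cong[OF refl])
      fix n assume "n \<in> {0..d}"
      then have "t powi n + t powi (- n - 1) = (1 + inverse t) * E (nat n) t" using E(3)[OF t, of "nat n"] by simp
      then show "fourier_coeff u n * (t powi n + t powi (- n - 1)) = (1 + inverse t) * (fourier_coeff u n * E (nat n) t)"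
        by (simp only: mult.left_commute)
    qed
    finally show ?thesis by (simp only: e_def sum_distrib_left)
  qed
  obtain e' where e': "e' \<in> trig_polys" "\<And>t. t \<in> circle \<Longrightarrow> e' t = e t" using trig_repr[OF e] by blast
  define b where "b t = (1 + inverse t) * inverse (\<phi>\<^sub>0 t) * e' t" for t
  have bX2: "b \<in> X2 \<phi>\<^sub>0"
    unfolding X2_def b_def[abs_def] using e' ee by (auto simp: norm_inverse intro!: exI[of _ e'])
  have bw: "b t = inverse (\<phi>\<^sub>0 t) * (T t + flip T t)" if "t \<in> circle" for t
    using we[OF that] e'(2)[OF that] by (simp add: b_def mult_ac)
  have Bb: "ae_eq (B_op \<phi>\<^sub>m \<phi>\<^sub>0 f) b"
  proof -
    have "ae_eq (\<lambda>t. inverse (\<phi>\<^sub>0 t) * (riesz_proj u t + flip (riesz_proj u) t)) (\<lambda>t. inverse (\<phi>\<^sub>0 t) * (T t + flip T t))"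
      by (intro ae_eq_mult ae_eq_refl ae_eq_add gT ae_eq_flip)
    also have "ae_eq \<dots> b" by (rule ae_eq_circle) (simp add: bw)
    finally show ?thesis by (simp add: B_op_def Let_def u_def[abs_def])
  qed
  have e't: "trig e'" by (rule trig_cong[OF e]) (simp add: e')
  have bL: "b \<in> LC p"
    using trig_mult_LC[OF e't G_LC p0(1)] by (simp add: b_def[abs_def] mult_ac)
  have "ae_eq (flip b) b"
    unfolding ae_eq_def using phi0_even AE_circle
  proof eventually_elim
    case (elim t)
    have "t \<noteq> 0" using elim by auto
    moreover have "e' (inverse t) = e' t" using elim ee e' by (simp add: norm_inverse)
    ultimately show "flip b t = b t" using elim by (simp add: flip_def b_def field_simps)
  qed
  then have bJ: "b \<in> Lp_J p" using bL by (simp add: Lp_J_def Lp_eq)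
  define D where "D t = \<phi> t * b t - f t" for t
  have \<phi>bL: "(\<lambda>t. \<phi> t * b t) \<in> LC p" by (rule phi_mult(1)[OF bL])
  have fL: "f \<in> LC p" by (rule trig_Lspace[OF ft p0(1)])
  have DL: "D \<in> LC p" unfolding D_def[abs_def] by (rule Lspace_diff(1)[OF p0(1) \<phi>bL fL])
  \<comment> \<open>T cancels the coefficients of u at indices >= 0, and the flip of T lives on
    indices <= -1. So v starts at -1, and so does its product with the antianalytic psi.\<close>
  define v where "v t = T t + flip T t - u t" for t
  have vL: "v \<in> LC q" unfolding v_def[abs_def] by (intro Lspace_diff Lspace_add q0 TL flip_LC uL)
  have vc: "fourier_coeff v n = 0" if "n > -1" for n
    using that unfolding v_def[abs_def]
    by (simp add: fourier_coeff_diff fourier_coeff_add LC_integrable[OF _ q] TL flip_LC uL Lspace_add(1)[OF q0(1)] fourier_coeff_flip_LC[OF TL] Tc)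
  have Dv: "ae_eq (\<lambda>t. (1 + inverse t) * D t) (\<lambda>t. \<psi> t * v t)"
    unfolding ae_eq_def using AE_regular
    by eventually_elim (simp add: D_def \<psi>_def v_def bw u_def field_simps)
  \<comment> \<open>The coefficient of (1 + 1/t) D at n is the sum of those of D at n and n +
    1.\<close>
  have DD: "fourier_coeff D n + fourier_coeff D (n + 1) = 0" if "0 \<le> n" for n
  proof -
    have "fourier_coeff (\<lambda>t. (1 + inverse t) * D t) n = fourier_coeff (\<lambda>t. \<psi> t * v t) n"
      using Holder(1)[OF p pq \<psi>(1) vL] trig_mult_LC[OF trig_one_plus DL p0(1)] Dv
      by (intro fourier_coeff_cong_AE) (auto simp: Lspace_def)
    also have "\<dots> = 0" by (rule fourier_coeff_mult_coanalytic[OF p pq \<psi> vL vc]) (use that in auto)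
    finally have "fourier_coeff (\<lambda>t. (1 + inverse t) * D t) n = 0" .
    moreover have "(\<lambda>t. (1 + inverse t) * D t) = (\<lambda>t. D t + t powi (-1) * D t)"
      by (simp add: power_int_minus distrib_right)
    moreover have "(\<lambda>t. t powi (-1) * D t) \<in> LC p"
      using trig_mult_LC[OF trig_inverse_id DL p0(1)] by (simp add: power_int_minus)
    ultimately show ?thesis
      using fourier_coeff_add[OF LC_integrable[OF DL p] LC_integrable[OF _ p], of "\<lambda>t. t powi (-1) * D t" n]
        fourier_coeff_mult_powi[of "-1" D n] by simp
  qed
  have "fourier_coeff D n = 0" if "0 \<le> n" for n
    by (rule alternating_null[OF DD Riemann_Lebesgue[OF LC_integrable[OF DL p]] that])
  then have "\<forall>n\<ge>0. fourier_coeff (\<lambda>t. \<phi> t * b t) n = fourier_coeff f n"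
    unfolding D_def[abs_def] using fourier_coeff_diff[OF LC_integrable[OF \<phi>bL p] LC_integrable[OF fL p]] by simp
  with bX2 Bb bJ show ?thesis by blast
qed

end

lemma riesz_proj_ae: "f \<in> LC p \<Longrightarrow> g \<in> LC p \<Longrightarrow> ae_eq f g \<Longrightarrow> riesz_proj f = riesz_proj g"
  by (rule riesz_proj_cong) (rule fourier_coeff_ae_eq)

lemma Hp_LC: "f \<in> Hp p \<Longrightarrow> f \<in> LC p"
  by (simp add: Hp_iff)

lemma Hp_add:
  assumes p: "1 < p" and "f \<in> Hp p" "g \<in> Hp p" shows "(\<lambda>t. f t + g t) \<in> Hp p"
  using assms by (simp add: Hp_iff Lspace_add fourier_coeff_add LC_integrable[OF _ p])

lemma Hp_scale: "f \<in> Hp p \<Longrightarrow> (\<lambda>t. c * f t) \<in> Hp p"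
  by (simp add: Hp_iff Lspace_scale fourier_coeff_scale)

lemma riesz_proj_Hp: "1 < p \<Longrightarrow> f \<in> LC p \<Longrightarrow> riesz_proj f \<in> Hp p"
  by (simp add: Hp_iff riesz_proj)

lemma ae_eq_diff: "ae_eq f f' \<Longrightarrow> ae_eq g g' \<Longrightarrow> ae_eq (\<lambda>t. f t - g t) (\<lambda>t. f' t - g' t)"
  unfolding ae_eq_def by (elim eventually_elim2) auto

lemma bounded_operator_diff:
  assumes A: "bounded_operator p U V A" and f: "f \<in> U" and g: "g \<in> U" "(\<lambda>t. - 1 * g t) \<in> U"
  shows "ae_eq (A (\<lambda>t. f t - g t)) (\<lambda>t. A f t - A g t)"
proof -
  have add: "\<forall>f\<in>U. \<forall>g\<in>U. ae_eq (A (\<lambda>t. f t + g t)) (\<lambda>t. A f t + A g t)"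
    and scale: "\<forall>f\<in>U. \<forall>c. ae_eq (A (\<lambda>t. c * f t)) (\<lambda>t. c * A f t)"
    using A unfolding bounded_operator_def by auto
  have "ae_eq (A (\<lambda>t. f t + - 1 * g t)) (\<lambda>t. A f t + A (\<lambda>t. - 1 * g t) t)"
    by (rule add[rule_format, OF f g(2)])
  also have "ae_eq \<dots> (\<lambda>t. A f t + - 1 * A g t)"
    by (rule ae_eq_add[OF ae_eq_refl scale[rule_format, OF g(1)]])
  finally show ?thesis by simp
qed

text \<open>Operators act on functions, not on classes. Additivity and homogeneity reduce the claim
  to the difference, whose image has norm zero by the bound.\<close>

lemma bounded_operator_ae_eq:
  assumes p: "0 < p" and A: "bounded_operator p U V A" and U: "U \<subseteq> LC p" and V: "V \<subseteq> LC p"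
    and f: "f \<in> U" and g: "g \<in> U" "(\<lambda>t. - 1 * g t) \<in> U" and d: "(\<lambda>t. f t - g t) \<in> U" and e: "ae_eq f g"
  shows "ae_eq (A f) (A g)"
proof -
  let ?d = "\<lambda>t. f t - g t"
  obtain C where C: "\<forall>f\<in>U. LI p (A f) \<le> C * LI p f" using A unfolding bounded_operator_iff[OF p] by blast
  have z: "(\<lambda>t. 0) \<in> LC p" using Lspace_scale[of f p circle_measure 0] f U by auto
  have "LI p ?d = LI p (\<lambda>t. 0)"
    by (rule LI_ae_eq) (use d U z e in \<open>auto simp: ae_eq_def elim!: eventually_mono\<close>)
  then have "LI p (A ?d) \<le> 0" using C d p by (fastforce simp: Lint_def)
  then have "LI p (A ?d) = 0" by (intro antisym) auto
  moreover have Ad: "A ?d \<in> LC p" using A d V unfolding bounded_operator_def by blast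
  ultimately have "AE t in circle_measure. A ?d t = 0" using Lint_eq_0_AE by blast
  then show ?thesis
    using bounded_operator_diff[OF A f g] unfolding ae_eq_def by eventually_elim simp
qed

text \<open>The relation \<open>m(1/t) = - t\<^sup>2 m(t)\<close> holds for products of a \<open>J\<close>-symmetric and a \<open>J\<close>-antisymmetric function.\<close>

lemma fourier_coeff_antisymmetric:
  assumes m: "m \<in> borel_measurable circle_measure" and s: "AE t in circle_measure. m (inverse t) = - (t\<^sup>2 * m t)"
  shows "fourier_coeff m (- n) = - fourier_coeff m (n - 2)"
proof -
  have "fourier_coeff m (- n) = fourier_coeff (\<lambda>t. m (inverse t)) n" by (rule fourier_coeff_inverse[OF m, symmetric])
  also have "\<dots> = fourier_coeff (\<lambda>t. - 1 * (t powi 2 * m t)) n"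
  proof (rule fourier_coeff_cong_AE)
    show "(\<lambda>t. m (inverse t)) \<in> borel_measurable circle_measure"
      by (rule measurable_compose[OF inverse_measurable_circle m])
    show "(\<lambda>t. - 1 * (t powi 2 * m t)) \<in> borel_measurable circle_measure"
      by (intro borel_measurable_times borel_measurable_const powi_measurable_circle m)
    show "ae_eq (\<lambda>t. m (inverse t)) (\<lambda>t. - 1 * (t powi 2 * m t))"
      using s unfolding ae_eq_def by eventually_elim simp
  qed
  also have "\<dots> = - fourier_coeff m (n - 2)"
    unfolding fourier_coeff_scale fourier_coeff_mult_powi by simp
  finally show ?thesis .
qed

text \<open>The averages \<open>a n\<close> of the powers of 1/t tend to 0 off t = 1 and are bounded
  by 1, while 1 - \<open>a n\<close> vanishes at t = 1 and is therefore divisible by 1 - 1/t. Hence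
  (1 - \<open>a n\<close>) r lies in \<open>X1\<close> up to its values off the circle, and
  converges to r by dominated convergence.\<close>

lemma X1_dense:
  assumes p: "0 < p" and f: "f \<in> LC p"
  shows "\<exists>s. (\<forall>n::nat. s n \<in> X1) \<and> (\<lambda>n. LI p (\<lambda>t. s n t - f t)) \<longlonglongrightarrow> 0"
proof -
  have p0: "0 \<le> p" using p by simp
  have trigX: "\<exists>s\<in>X1. LI p (\<lambda>t. s t - r t) < e" if r: "trig r" and e: "0 < e" for r e
  proof -
    define a where "a n t = (1 / of_nat (Suc n)) * (\<Sum>j<Suc n. inverse t ^ j)" for n and t :: complex
    \<comment> \<open>The quotient of 1 - \<open>a n\<close> by 1 - 1/t, written out by summing the
      finite geometric series for each power.\<close>
    define h where "h n t = (1 / of_nat (Suc n)) * (\<Sum>j<Suc n. \<Sum>i<j. inverse t ^ i)" for n and t :: complex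
    have tp: "trig (\<lambda>t. inverse t ^ j)" for j
      by (rule trig_cong[OF trig_monom[of 1 "- int j"]]) (simp add: power_int_minus power_inverse)
    have h: "trig (h n)" for n unfolding h_def[abs_def] by (intro trig_scale trig_sum tp)
    have ah: "1 - a n t = (1 - inverse t) * h n t" for n t
    proof -
      have "(1 - inverse t) * h n t = (1 / of_nat (Suc n)) * (\<Sum>j<Suc n. (1 - inverse t) * (\<Sum>i<j. inverse t ^ i))"
        unfolding h_def sum_distrib_left[symmetric] by (simp only: mult.left_commute)
      also have "\<dots> = (1 / of_nat (Suc n)) * (\<Sum>j<Suc n. 1 - inverse t ^ j)"
        by (simp only: one_diff_power_eq)
      also have "\<dots> = 1 - a n t"
        unfolding a_def sum_subtractf right_diff_distrib by (simp del: sum.lessThan_Suc of_nat_Suc)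
      finally show ?thesis by simp
    qed
    have an: "norm (a n t) \<le> 1" if "t \<in> circle" for n t
    proof -
      have "norm (\<Sum>j<Suc n. inverse t ^ j) \<le> (\<Sum>j<Suc n. norm (inverse t ^ j))" by (rule norm_sum)
      also have "\<dots> = real (Suc n)" using that by (simp add: norm_power norm_inverse)
      finally show ?thesis unfolding a_def norm_mult by (simp add: norm_divide divide_le_eq del: sum.lessThan_Suc of_nat_Suc)
    qed
    have a0: "(\<lambda>n. a n t) \<longlonglongrightarrow> 0" if t: "t \<in> circle" "t \<noteq> 1" for t
    proof (rule Lim_null_comparison)
      have t1: "1 - inverse t \<noteq> 0" using t by (metis eq_iff_diff_eq_0 inverse_eq_1_iff)
      have "norm (a n t) \<le> (2 / norm (1 - inverse t)) * (1 / real (Suc n))" for n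
      proof -
        have "(1 - inverse t) * (\<Sum>j<Suc n. inverse t ^ j) = 1 - inverse t ^ Suc n" by (rule one_diff_power_eq[symmetric])
        then have "norm (1 - inverse t) * norm (\<Sum>j<Suc n. inverse t ^ j) = norm (1 - inverse t ^ Suc n)"
          by (simp only: norm_mult[symmetric])
        also have "\<dots> \<le> norm (1::complex) + norm (inverse t ^ Suc n)" by (rule norm_triangle_ineq4)
        also have "\<dots> = 2" using t by (simp add: norm_power norm_inverse del: power_Suc)
        finally have "norm (\<Sum>j<Suc n. inverse t ^ j) \<le> 2 / norm (1 - inverse t)"
          using t1 by (simp add: le_divide_eq mult.commute)
        then have "(1 / real (Suc n)) * norm (\<Sum>j<Suc n. inverse t ^ j) \<le> (1 / real (Suc n)) * (2 / norm (1 - inverse t))"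
          by (rule mult_left_mono) simp
        then show ?thesis unfolding a_def norm_mult
          by (simp only: norm_divide norm_one norm_of_nat mult.commute)
      qed
      then show "\<forall>\<^sub>F n in sequentially. norm (a n t) \<le> (2 / norm (1 - inverse t)) * (1 / real (Suc n))" by simp
      show "(\<lambda>n. (2 / norm (1 - inverse t)) * (1 / real (Suc n))) \<longlonglongrightarrow> 0"
        by (intro tendsto_mult_right_zero LIMSEQ_Suc[OF lim_1_over_n])
    qed
    define s where "s n t = (1 - a n t) * r t" for n t
    have hr: "trig (\<lambda>t. h n t * r t)" for n by (rule trig_mult[OF h r])
    have sh: "s n = (\<lambda>t. (1 - inverse t) * (h n t * r t))" for n by (auto simp: s_def ah mult.assoc)
    have st: "trig (s n)" for n unfolding sh by (intro trig_mult trig_one_minus h r)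
    have l0: "(\<lambda>n. LI p (\<lambda>t. s n t - r t)) \<longlonglongrightarrow> 0"
    proof (rule Lint_dominated_convergence(1)[OF p trig_Lspace[OF r p0]])
      show "s n \<in> borel_measurable circle_measure" for n by (intro borel_measurable_circle_continuous trig_continuous st)
      show "AE t in circle_measure. (\<lambda>n. s n t) \<longlonglongrightarrow> r t"
        using AE_circle_not_singleton[of 1] AE_space
      proof eventually_elim
        case (elim t)
        then have "(\<lambda>n. (1 - a n t) * r t) \<longlonglongrightarrow> (1 - 0) * r t" by (intro tendsto_intros a0) auto
        then show ?case by (simp add: s_def)
      qed
      show "AE t in circle_measure. norm (s n t) \<le> 2 * norm (r t)" for n
      proof (rule AE_I2)
        fix t assume "t \<in> space circle_measure"
        then have "norm (1 - a n t) \<le> 2" using an[of t n] norm_triangle_ineq4[of 1 "a n t"] by simp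
        then show "norm (s n t) \<le> 2 * norm (r t)" unfolding s_def norm_mult by (rule mult_right_mono) simp
      qed
    qed
    obtain n where n: "LI p (\<lambda>t. s n t - r t) < e"
      using order_tendstoD(2)[OF l0 e] by (auto simp: eventually_sequentially)
    obtain g where g: "g \<in> trig_polys" "\<And>t. t \<in> circle \<Longrightarrow> g t = h n t * r t" using trig_repr[OF hr[of n]] by blast
    have "(\<lambda>t. (1 - inverse t) * g t) \<in> X1" unfolding X1_def using g by blast
    moreover have "LI p (\<lambda>t. (1 - inverse t) * g t - r t) = LI p (\<lambda>t. s n t - r t)"
      by (rule Lint_cong_circle) (simp add: g sh)
    ultimately show ?thesis using n by metis
  qed
  have "\<exists>s\<in>X1. LI p (\<lambda>t. s t - f t) < e" if e: "0 < e" for e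
  proof -
    let ?d = "e / (2 powr p * 2)"
    have d: "0 < ?d" using e by simp
    obtain r where r: "trig r" "LI p (\<lambda>t. f t - r t) < ?d" by (rule trig_dense[OF p f d])
    obtain s where s: "s \<in> X1" "LI p (\<lambda>t. s t - r t) < ?d" using trigX[OF r(1) d] by blast
    have L: "s \<in> LC p" "r \<in> LC p" by (intro trig_Lspace p0 X1_trig s r)+
    have "LI p (\<lambda>t. s t - f t) = LI p (\<lambda>t. (s t - r t) - (f t - r t))" by simp
    also have "\<dots> \<le> 2 powr p * (LI p (\<lambda>t. s t - r t) + LI p (\<lambda>t. f t - r t))"
      by (intro Lspace_diff p0 L f)
    also have "\<dots> < 2 powr p * (?d + ?d)" using r s by (intro mult_strict_left_mono add_strict_mono) auto
    also have "\<dots> = e" by (simp add: field_simps)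
    finally show ?thesis using s by blast
  qed
  then have "\<forall>n::nat. \<exists>s. s \<in> X1 \<and> LI p (\<lambda>t. s t - f t) < 1 / real (Suc n)" by (simp add: Bex_def)
  then obtain s where s: "\<And>n::nat. s n \<in> X1" "\<And>n. LI p (\<lambda>t. s n t - f t) < 1 / real (Suc n)" by metis
  have "(\<lambda>n. LI p (\<lambda>t. s n t - f t)) \<longlonglongrightarrow> 0"
  proof (rule Lim_null_comparison)
    show "\<forall>\<^sub>F n in sequentially. norm (LI p (\<lambda>t. s n t - f t)) \<le> 1 / real (Suc n)"
      using s(2) by (intro always_eventually allI) (simp add: less_imp_le del: of_nat_Suc)
    show "(\<lambda>n. 1 / real (Suc n)) \<longlonglongrightarrow> 0" by (rule LIMSEQ_Suc[OF lim_1_over_n])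
  qed
  then show ?thesis using s by blast
qed

section \<open>Factorization implies invertibility\<close>

context factors
begin

lemma toeplitz_plus_hankel_injective:
  assumes d: "d \<in> Hp p" and z: "ae_eq (toeplitz_plus_hankel \<phi> d) (\<lambda>t. 0)"
  shows "ae_eq d (\<lambda>t. 0)"
proof -
  have dL: "d \<in> LC p" by (rule Hp_LC[OF d])
  define g where "g t = d t + flip d t" for t
  have gL: "g \<in> LC p" unfolding g_def[abs_def] by (intro Lspace_add p0 dL flip_LC)
  have gi: "g (inverse t) = t * g t" if "t \<in> circle" for t
  proof -
    have "t \<noteq> 0" using that by auto
    then show ?thesis by (simp add: g_def flip_def field_simps)
  qed
  define k where "k t = \<phi> t * g t" for t
  have kL: "k \<in> LC p" unfolding k_def[abs_def] by (rule phi_mult(1)[OF gL])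
  have zL: "(\<lambda>t. 0) \<in> LC r" for r using Lspace_scale[OF trig_Lspace[OF trig_const[of 1]], of r 0] by (cases "0 \<le> r") (auto simp: Lspace_def)
  have z0: "fourier_coeff (\<lambda>t. 0) n = 0" for n by (simp add: fourier_coeff_def)
  have kc: "fourier_coeff k n = 0" if "n > -1" for n
    using toeplitz_plus_hankel(2)[OF p phi_Linf dL, of n] that z0
      fourier_coeff_ae_eq[OF Hp_LC[OF toeplitz_plus_hankel(1)[OF p phi_Linf dL]] zL z]
    by (simp add: k_def[abs_def] g_def)
  define y where "y t = (1 - inverse t) * inverse (\<phi>\<^sub>m t)" for t
  have y: "y \<in> LC q" "\<And>n. n > 0 \<Longrightarrow> fourier_coeff y n = 0" using eta by (auto simp: cnj_Hp_iff y_def[abs_def])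
  define m where "m t = y t * k t" for t
  have mi: "integrable circle_measure m" unfolding m_def[abs_def] by (rule Holder(1)[OF q qp y(1) kL])
  have m0: "fourier_coeff m n = 0" if "n > -1" for n
    unfolding m_def[abs_def] by (rule fourier_coeff_mult_coanalytic[OF q qp y kL kc that])
  have mt: "AE t in circle_measure. m t = (1 - inverse t) * \<phi>\<^sub>0 t * g t"
    using AE_regular by eventually_elim (simp add: m_def y_def k_def)
  have ms: "AE t in circle_measure. m (inverse t) = - (t\<^sup>2 * m t)"
    using mt AE_inverse_circle[OF mt] AE_regular phi0_even
  proof eventually_elim
    case (elim t)
    have t0: "t \<noteq> 0" using elim by auto
    have "m (inverse t) = (1 - t) * \<phi>\<^sub>0 t * (t * g t)" using elim gi[of t] by simp
    also have "\<dots> = - (t\<^sup>2 * ((1 - inverse t) * \<phi>\<^sub>0 t * g t))" using t0 by (simp add: field_simps power2_eq_square)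
    finally show ?case using elim by simp
  qed
  have anti: "fourier_coeff m (- n) = - fourier_coeff m (n - 2)" for n
    by (rule fourier_coeff_antisymmetric[OF _ ms]) (use mi in auto)
  have "fourier_coeff m n = 0" for n
  proof -
    \<comment> \<open>The reflection n -> -n-2 sends indices <= -2 to indices >= 0, where m has no
      coefficients; at its fixed point -1 the coefficient is its own negative.\<close>
    consider "n > -1" | "n = -1" | "n \<le> -2" by linarith
    then show ?thesis
    proof cases
      case 2
      have "fourier_coeff m (- 1) + fourier_coeff m (- 1) = 0"
        using anti[of 1] by (simp add: eq_neg_iff_add_eq_0)
      then have "2 * fourier_coeff m (- 1) = 0" by (simp only: mult_2)
      with 2 show ?thesis by simp
    next
      case 3
      then show ?thesis using anti[of "-n"] m0[of "- n - 2"] by simp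
    qed (rule m0)
  qed
  then have "AE t in circle_measure. m t = 0" by (rule fourier_zero[OF mi])
  then have gz: "ae_eq g (\<lambda>t. 0)"
    using mt AE_regular unfolding ae_eq_def by eventually_elim auto
  show ?thesis
  proof (rule LC_ae_eqI[OF dL zL p])
    fix n
    show "fourier_coeff d n = fourier_coeff (\<lambda>t. 0) n"
    proof (cases "0 \<le> n")
      case True
      \<comment> \<open>The flip of an analytic function has only negative indices, so d is
        recovered from g = d + Jd on the nonnegative ones.\<close>
      then have "fourier_coeff g n = fourier_coeff d n"
        using d unfolding g_def[abs_def]
        by (simp add: fourier_coeff_add LC_integrable[OF _ p] dL flip_LC fourier_coeff_flip_LC[OF dL] Hp_iff)
      then show ?thesis using fourier_coeff_ae_eq[OF gL zL gz] by simp
    next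
      case False
      then show ?thesis using d by (simp add: Hp_iff z0)
    qed
  qed
qed

text \<open>The inverse is S = PA. That it is a right inverse comes from density of
  \<open>X1\<close>; that it is a left inverse follows, since M(SMh - h) = 0 and M is
  injective.\<close>

lemma invertible_of_extension:
  assumes A: "bounded_operator p (Lp p) (Lp_J p) A" and AB: "\<And>f. f \<in> X1 \<Longrightarrow> ae_eq (A f) (B_op \<phi>\<^sub>m \<phi>\<^sub>0 f)"
  shows "invertible_operator p (Hp p) (toeplitz_plus_hankel \<phi>)"
proof -
  let ?M = "toeplitz_plus_hankel \<phi>"
  have A': "A f \<in> Lp_J p" "A f \<in> LC p" if "f \<in> LC p" for f
    using A that Lp_J_LC unfolding bounded_operator_def Lp_eq by blast+
  have Aadd: "ae_eq (A (\<lambda>t. f t + g t)) (\<lambda>t. A f t + A g t)" if "f \<in> LC p" "g \<in> LC p" for f g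
    using A that unfolding bounded_operator_def Lp_eq by blast
  have Ascale: "ae_eq (A (\<lambda>t. c * f t)) (\<lambda>t. c * A f t)" if "f \<in> LC p" for f c
    using A that unfolding bounded_operator_def Lp_eq by blast
  obtain C where C: "0 \<le> C" "\<And>f. f \<in> LC p \<Longrightarrow> LI p (A f) \<le> C * LI p f"
    using A unfolding bounded_operator_iff[OF p0(2)] Lp_eq by blast
  obtain C' where C': "0 \<le> C'" "\<And>f. f \<in> LC p \<Longrightarrow> LI p (\<lambda>t. \<phi> t * f t) \<le> C' * LI p f"
    using Linf_mult[OF phi_Linf p0(1)] by blast
  obtain K where K: "0 \<le> K" "\<And>f. f \<in> LC p \<Longrightarrow> LI p (riesz_proj f) \<le> K * LI p f"
    using riesz_proj_bounded[OF p] by blast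
  \<comment> \<open>Both sides depend continuously on f in \<open>L^p\<close>, and on
    \<open>X1\<close> the identity is \<open>B_op_X1\<close>.\<close>
  have key: "fourier_coeff (\<lambda>t. \<phi> t * A f t) n = fourier_coeff f n" if f: "f \<in> LC p" and n: "0 \<le> n" for f n
  proof -
    obtain s where s: "\<And>k::nat. s k \<in> X1" "(\<lambda>k. LI p (\<lambda>t. s k t - f t)) \<longlonglongrightarrow> 0" using X1_dense[OF p0(2) f] by blast
    have sL: "s k \<in> LC p" for k by (intro trig_Lspace X1_trig s p0)
    have e: "fourier_coeff (\<lambda>t. \<phi> t * A (s k) t) n = fourier_coeff (s k) n" for k
    proof -
      obtain b where b: "ae_eq (B_op \<phi>\<^sub>m \<phi>\<^sub>0 (s k)) b" "b \<in> Lp_J p" "\<forall>n\<ge>0. fourier_coeff (\<lambda>t. \<phi> t * b t) n = fourier_coeff (s k) n"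
        using B_op_X1[OF s(1)[of k]] by blast
      have "ae_eq (\<lambda>t. \<phi> t * A (s k) t) (\<lambda>t. \<phi> t * b t)"
        by (intro ae_eq_mult ae_eq_refl ae_eq_trans[OF AB[OF s(1)] b(1)])
      from fourier_coeff_ae_eq[OF phi_mult(1)[OF A'(2)[OF sL]] phi_mult(1)[OF Lp_J_LC[OF b(2)]] this]
      show ?thesis using b(3) n by simp
    qed
    have bd: "LI p (\<lambda>t. \<phi> t * A (s k) t - \<phi> t * A f t) \<le> C' * (C * LI p (\<lambda>t. s k t - f t))" for k
    proof -
      have dL: "(\<lambda>t. s k t - f t) \<in> LC p" by (intro Lspace_diff p0 sL f)
      have AdL: "(\<lambda>t. A (s k) t - A f t) \<in> LC p" by (intro Lspace_diff p0 A' sL f)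
      have "ae_eq (A (\<lambda>t. s k t - f t)) (\<lambda>t. A (s k) t - A f t)"
        by (rule bounded_operator_diff[OF A]) (auto simp: Lp_eq sL f Lspace_scale[OF f] Lspace_uminus[OF f])
      then have "LI p (\<lambda>t. A (s k) t - A f t) = LI p (A (\<lambda>t. s k t - f t))"
        by (rule LI_ae_eq[OF AdL A'(2)[OF dL] ae_eq_sym])
      also have "\<dots> \<le> C * LI p (\<lambda>t. s k t - f t)" by (rule C(2)[OF dL])
      finally have "C' * LI p (\<lambda>t. A (s k) t - A f t) \<le> C' * (C * LI p (\<lambda>t. s k t - f t))" using C' by (intro mult_left_mono)
      then show ?thesis using C'(2)[OF AdL] by (simp add: right_diff_distrib)
    qed
    have l: "(\<lambda>k. LI p (\<lambda>t. \<phi> t * A (s k) t - \<phi> t * A f t)) \<longlonglongrightarrow> 0"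
    proof (rule Lim_null_comparison)
      show "\<forall>\<^sub>F k in sequentially. norm (LI p (\<lambda>t. \<phi> t * A (s k) t - \<phi> t * A f t)) \<le> C' * (C * LI p (\<lambda>t. s k t - f t))"
        using bd by (intro always_eventually allI) simp
      show "(\<lambda>k. C' * (C * LI p (\<lambda>t. s k t - f t))) \<longlonglongrightarrow> 0" by (intro tendsto_mult_right_zero s(2))
    qed
    have "(\<lambda>k. fourier_coeff (\<lambda>t. \<phi> t * A (s k) t) n) \<longlonglongrightarrow> fourier_coeff (\<lambda>t. \<phi> t * A f t) n"
      by (rule tendsto_fourier_coeff[OF p phi_mult(1)[OF A'(2)[OF sL]] phi_mult(1)[OF A'(2)[OF f]] l])
    moreover have "(\<lambda>k. fourier_coeff (s k) n) \<longlonglongrightarrow> fourier_coeff f n"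
      by (rule tendsto_fourier_coeff[OF p sL f s(2)])
    ultimately show ?thesis unfolding e by (rule LIMSEQ_unique)
  qed
  define S where "S h = riesz_proj (A h)" for h
  have SH: "S h \<in> Hp p" if "h \<in> LC p" for h unfolding S_def by (rule riesz_proj_Hp[OF p A'(2)[OF that]])
  have Sb: "bounded_operator p (Hp p) (Hp p) S"
    unfolding bounded_operator_iff[OF p0(2)]
  proof (intro conjI ballI allI exI[of _ "K * C"])
    fix f assume "f \<in> Hp p"
    then have f: "f \<in> LC p" by (rule Hp_LC)
    show "S f \<in> Hp p" by (rule SH[OF f])
    show "LI p (S f) \<le> K * C * LI p f"
      using order_trans[OF K(2)[OF A'(2)[OF f]] mult_left_mono[OF C(2)[OF f] K(1)]] by (simp add: S_def mult.assoc)
    show "ae_eq (S (\<lambda>t. c * f t)) (\<lambda>t. c * S f t)" for c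
      unfolding S_def riesz_proj_ae[OF A'(2)[OF Lspace_scale[OF f]] Lspace_scale[OF A'(2)[OF f]] Ascale[OF f]]
      by (rule riesz_proj_scale[OF p A'(2)[OF f]])
    fix g assume "g \<in> Hp p"
    then have g: "g \<in> LC p" by (rule Hp_LC)
    show "ae_eq (S (\<lambda>t. f t + g t)) (\<lambda>t. S f t + S g t)"
      unfolding S_def riesz_proj_ae[OF A'(2)[OF Lspace_add(1)[OF p0(1) f g]] Lspace_add(1)[OF p0(1) A'(2)[OF f] A'(2)[OF g]] Aadd[OF f g]]
      by (rule riesz_proj_add[OF p A'(2)[OF f] A'(2)[OF g]])
  qed (use K C in auto)
  have Mb: "bounded_operator p (Hp p) (Hp p) ?M" by (rule toeplitz_plus_hankel_bounded[OF p phi_Linf])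
  have MH: "?M h \<in> Hp p" if "h \<in> LC p" for h by (rule toeplitz_plus_hankel(1)[OF p phi_Linf that])
  have MS: "ae_eq (?M (S h)) h" if h: "h \<in> Hp p" for h
  proof (rule LC_ae_eqI[OF Hp_LC[OF MH[OF Hp_LC[OF SH]]] _ p])
    show hL: "h \<in> LC p" "h \<in> LC p" by (intro Hp_LC h)+
    have SL: "S h \<in> LC p" by (rule Hp_LC[OF SH[OF hL(1)]])
    fix n
    show "fourier_coeff (?M (S h)) n = fourier_coeff h n"
    proof (cases "0 \<le> n")
      case True
      have "ae_eq (\<lambda>t. \<phi> t * (S h t + flip (S h) t)) (\<lambda>t. \<phi> t * A h t)"
        unfolding S_def by (rule ae_eq_mult[OF ae_eq_refl symmetrization_riesz_proj[OF p A'(1)[OF hL(1)]]])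
      from fourier_coeff_ae_eq[OF phi_mult(1)[OF Lspace_add(1)[OF p0(1) SL flip_LC(1)[OF SL]]] phi_mult(1)[OF A'(2)[OF hL(1)]] this]
      show ?thesis using toeplitz_plus_hankel(2)[OF p phi_Linf SL True] key[OF hL(1) True] by simp
    next
      case False
      then show ?thesis using MH[OF SL] h by (simp add: Hp_iff)
    qed
  qed
  have SM: "ae_eq (S (?M h)) h" if h: "h \<in> Hp p" for h
  proof -
    have 1: "?M h \<in> Hp p" by (rule MH[OF Hp_LC[OF h]])
    have 2: "S (?M h) \<in> Hp p" by (rule SH[OF Hp_LC[OF 1]])
    have dH: "(\<lambda>t. S (?M h) t - h t) \<in> Hp p" using Hp_add[OF p 2 Hp_scale[OF h, of "-1"]] by simp
    have "ae_eq (?M (\<lambda>t. S (?M h) t - h t)) (\<lambda>t. ?M (S (?M h)) t - ?M h t)"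
      by (rule bounded_operator_diff[OF Mb 2 h Hp_scale[OF h]])
    also have "ae_eq \<dots> (\<lambda>t. ?M h t - ?M h t)" by (rule ae_eq_diff[OF MS[OF 1] ae_eq_refl])
    finally have "ae_eq (?M (\<lambda>t. S (?M h) t - h t)) (\<lambda>t. 0)" by simp
    from toeplitz_plus_hankel_injective[OF dH this] show ?thesis
      unfolding ae_eq_def by eventually_elim simp
  qed
  show ?thesis unfolding invertible_operator_def using Mb Sb MS SM by blast
qed

end

section \<open>Invertibility implies factorization\<close>

context symbol
begin

text \<open>The factors come from the solutions of \<open>M(\<phi>) s = 1\<close> and of the adjoint equation; the latter is
  solved by representing a functional on \<open>L\<^sup>p\<close>.\<close>

lemma factorization_of_inverse:
  assumes S: "bounded_operator p (Hp p) (Hp p) S"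
    and inv: "\<And>f. f \<in> Hp p \<Longrightarrow> ae_eq (S (toeplitz_plus_hankel \<phi> f)) f"
      "\<And>f. f \<in> Hp p \<Longrightarrow> ae_eq (toeplitz_plus_hankel \<phi> (S f)) f"
  shows "asymmetric_factorization p q \<phi> 0"
proof -
  let ?M = "toeplitz_plus_hankel \<phi>"
  have SH: "S f \<in> Hp p" if "f \<in> Hp p" for f using S that unfolding bounded_operator_def by blast
  have Sae: "ae_eq (S f) (S g)" if "f \<in> Hp p" "g \<in> Hp p" "ae_eq f g" for f g
    by (rule bounded_operator_ae_eq[OF p0(2) S _ _ that(1,2) Hp_scale[OF that(2)] _ that(3)])
      (use Hp_LC Hp_add[OF p that(1) Hp_scale[OF that(2), of "-1"]] in auto)
  have Sadd: "ae_eq (S (\<lambda>t. f t + g t)) (\<lambda>t. S f t + S g t)" if "f \<in> Hp p" "g \<in> Hp p" for f g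
    using S that unfolding bounded_operator_def by blast
  have Sscale: "ae_eq (S (\<lambda>t. c * f t)) (\<lambda>t. c * S f t)" if "f \<in> Hp p" for f c
    using S that unfolding bounded_operator_def by blast
  obtain C where C: "0 \<le> C" "\<And>f. f \<in> Hp p \<Longrightarrow> LI p (S f) \<le> C * LI p f"
    using S unfolding bounded_operator_iff[OF p0(2)] by blast
  obtain K where K: "0 \<le> K" "\<And>f. f \<in> LC p \<Longrightarrow> LI p (riesz_proj f) \<le> K * LI p f"
    using riesz_proj_bounded[OF p] by blast
  obtain C' where C': "0 \<le> C'" "\<And>f. f \<in> LC p \<Longrightarrow> LI p (\<lambda>t. \<phi> t * f t) \<le> C' * LI p f"
    using Linf_mult[OF phi_Linf p0(1)] by blast
  \<comment> \<open>R = (I + J) S P, defined on all of \<open>L^p\<close>. It will turn out to be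
    the bounded extension of B.\<close>
  define R where "R f = (\<lambda>t. S (riesz_proj f) t + flip (S (riesz_proj f)) t)" for f
  have SPH: "S (riesz_proj f) \<in> Hp p" if "f \<in> LC p" for f by (rule SH[OF riesz_proj_Hp[OF p that]])
  have SPL: "S (riesz_proj f) \<in> LC p" if "f \<in> LC p" for f by (rule Hp_LC[OF SPH[OF that]])
  have RJ: "R f \<in> Lp_J p" if "f \<in> LC p" for f
    unfolding R_def by (rule symmetrization_Lp_J[OF p0(1) SPL[OF that]])
  have RL: "R f \<in> LC p" if "f \<in> LC p" for f by (rule Lp_J_LC[OF RJ[OF that]])
  have Rb: "LI p (R f) \<le> 2 powr p * (2 * (C * K)) * LI p f" if f: "f \<in> LC p" for f
  proof -
    have "LI p (R f) \<le> 2 powr p * (LI p (S (riesz_proj f)) + LI p (S (riesz_proj f)))"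
      using Lspace_add(2)[OF p0(1) SPL[OF f] flip_LC(1)[OF SPL[OF f]]] flip_LC(2)[OF SPL[OF f]] by (simp add: R_def)
    also have "\<dots> \<le> 2 powr p * (C * (K * LI p f) + C * (K * LI p f))"
      by (intro mult_left_mono add_mono order_trans[OF C(2)[OF riesz_proj_Hp[OF p f]]] K f C) auto
    finally show ?thesis by (simp add: algebra_simps)
  qed
  have Radd: "ae_eq (R (\<lambda>t. f t + g t)) (\<lambda>t. R f t + R g t)" if f: "f \<in> LC p" and g: "g \<in> LC p" for f g
  proof -
    have PH: "riesz_proj f \<in> Hp p" "riesz_proj g \<in> Hp p" by (intro riesz_proj_Hp p f g)+
    have "ae_eq (S (riesz_proj (\<lambda>t. f t + g t))) (S (\<lambda>t. riesz_proj f t + riesz_proj g t))"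
      by (rule Sae[OF riesz_proj_Hp[OF p Lspace_add(1)[OF p0(1) f g]] Hp_add[OF p PH] riesz_proj_add[OF p f g]])
    also have "ae_eq \<dots> (\<lambda>t. S (riesz_proj f) t + S (riesz_proj g) t)" by (rule Sadd[OF PH])
    finally have e: "ae_eq (S (riesz_proj (\<lambda>t. f t + g t))) (\<lambda>t. S (riesz_proj f) t + S (riesz_proj g) t)" .
    from ae_eq_add[OF e ae_eq_flip[OF e]] show ?thesis by (simp add: R_def flip_add add_ac)
  qed
  have Rscale: "ae_eq (R (\<lambda>t. c * f t)) (\<lambda>t. c * R f t)" if f: "f \<in> LC p" for f c
  proof -
    have PH: "riesz_proj f \<in> Hp p" by (intro riesz_proj_Hp p f)
    have "ae_eq (S (riesz_proj (\<lambda>t. c * f t))) (S (\<lambda>t. c * riesz_proj f t))"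
      by (rule Sae[OF riesz_proj_Hp[OF p Lspace_scale[OF f]] Hp_scale[OF PH] riesz_proj_scale[OF p f]])
    also have "ae_eq \<dots> (\<lambda>t. c * S (riesz_proj f) t)" by (rule Sscale[OF PH])
    finally have e: "ae_eq (S (riesz_proj (\<lambda>t. c * f t))) (\<lambda>t. c * S (riesz_proj f) t)" .
    from ae_eq_add[OF e ae_eq_flip[OF e]] show ?thesis by (simp add: R_def flip_scale distrib_left)
  qed
  \<comment> \<open>A characterization of R: flip-invariance of k and P(phi k) = Pf determine k. All
    later values of R are computed through it.\<close>
  have Rk: "ae_eq (R f) k"
    if k: "k \<in> Lp_J p" and f: "f \<in> LC p" and c: "\<And>n. 0 \<le> n \<Longrightarrow> fourier_coeff (\<lambda>t. \<phi> t * k t) n = fourier_coeff f n" for k f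
  proof -
    note kL = Lp_J_LC[OF k]
    note Pk = riesz_proj(1)[OF p kL]
    have PH: "riesz_proj k \<in> Hp p" by (rule riesz_proj_Hp[OF p kL])
    have MH: "?M (riesz_proj k) \<in> Hp p" by (rule toeplitz_plus_hankel(1)[OF p phi_Linf Pk])
    have e: "ae_eq (\<lambda>t. \<phi> t * (riesz_proj k t + flip (riesz_proj k) t)) (\<lambda>t. \<phi> t * k t)"
      by (rule ae_eq_mult[OF ae_eq_refl symmetrization_riesz_proj[OF p k]])
    have Mk: "ae_eq (?M (riesz_proj k)) (riesz_proj f)"
    proof (rule LC_ae_eqI[OF Hp_LC[OF MH] riesz_proj(1)[OF p f] p])
      fix n
      show "fourier_coeff (?M (riesz_proj k)) n = fourier_coeff (riesz_proj f) n"
      proof (cases "0 \<le> n")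
        case True
        then show ?thesis
          using toeplitz_plus_hankel(2)[OF p phi_Linf Pk True] c[OF True] riesz_proj(2)[OF p f]
            fourier_coeff_ae_eq[OF phi_mult(1)[OF Lspace_add(1)[OF p0(1) Pk flip_LC(1)[OF Pk]]] phi_mult(1)[OF kL] e]
          by simp
      next
        case False
        then show ?thesis using MH riesz_proj(2)[OF p f] by (simp add: Hp_iff)
      qed
    qed
    have "ae_eq (S (riesz_proj f)) (S (?M (riesz_proj k)))"
      by (rule Sae[OF riesz_proj_Hp[OF p f] MH ae_eq_sym[OF Mk]])
    also have "ae_eq \<dots> (riesz_proj k)" by (rule inv(1)[OF PH])
    finally have s: "ae_eq (S (riesz_proj f)) (riesz_proj k)" .
    have "ae_eq (R f) (\<lambda>t. riesz_proj k t + flip (riesz_proj k) t)"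
      unfolding R_def by (rule ae_eq_add[OF s ae_eq_flip[OF s]])
    also have "ae_eq \<dots> k" by (rule symmetrization_riesz_proj[OF p k])
    finally show ?thesis .
  qed
  have one: "(\<lambda>t. 1) \<in> Hp p" using fourier_coeff_monom[of 1 0] trig_Lspace[OF trig_const[of 1] p0(1)] by (simp add: Hp_iff)
  have onec: "fourier_coeff (\<lambda>t. 1) n = (if n = 0 then 1 else 0)" for n using fourier_coeff_monom[of 1 0 n] by simp
  define s where "s = S (\<lambda>t. 1)"
  have sH: "s \<in> Hp p" unfolding s_def by (rule SH[OF one])
  note sL = Hp_LC[OF sH]
  define g where "g t = s t + flip s t" for t
  have gL: "g \<in> LC p" unfolding g_def[abs_def] by (intro Lspace_add p0 sL flip_LC)
  have gi: "g (inverse t) = t * g t" if "t \<in> circle" for t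
  proof -
    have "t \<noteq> 0" using that by auto
    then show ?thesis by (simp add: g_def flip_def field_simps)
  qed
  define \<psi> where "\<psi> t = \<phi> t * g t" for t
  have \<psi>L: "\<psi> \<in> LC p" unfolding \<psi>_def[abs_def] by (rule phi_mult(1)[OF gL])
  have \<psi>c: "fourier_coeff \<psi> n = (if n = 0 then 1 else 0)" if "0 \<le> n" for n
  proof -
    have "fourier_coeff \<psi> n = fourier_coeff (?M s) n"
      using toeplitz_plus_hankel(2)[OF p phi_Linf sL that] by (simp add: \<psi>_def[abs_def] g_def)
    also have "\<dots> = fourier_coeff (\<lambda>t. 1) n"
      using inv(2)[OF one] by (intro fourier_coeff_ae_eq[OF Hp_LC[OF toeplitz_plus_hankel(1)[OF p phi_Linf sL]] Hp_LC[OF one]]) (simp add: s_def)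
    finally show ?thesis by (simp add: onec)
  qed
  \<comment> \<open>Chosen so that f = phi k with Jk = k, where Rf = k, gives minus the integral of
    phi k t. Representing the functional by Y makes phi (Y + t) orthogonal to every such k, and Y +
    t is t eta.\<close>
  define \<Lambda> where "\<Lambda> f = - fourier_coeff (\<lambda>t. \<phi> t * R f t) (- 1)" for f
  have \<Lambda>ae: "\<Lambda> f = - fourier_coeff (\<lambda>t. \<phi> t * k t) (- 1)" if "f \<in> LC p" "k \<in> LC p" "ae_eq (R f) k" for f k
    unfolding \<Lambda>_def using fourier_coeff_ae_eq[OF phi_mult(1)[OF RL[OF that(1)]] phi_mult(1)[OF that(2)] ae_eq_mult[OF ae_eq_refl that(3)]] by simp
  have "\<exists>Y\<in>LC q. \<forall>f\<in>LC p. \<Lambda> f = (LINT t|circle_measure. f t * Y t)"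
  proof (rule circle.Lspace_dual[OF p pq])
    fix f g assume f: "f \<in> LC p" and g: "g \<in> LC p"
    have "\<Lambda> (\<lambda>t. f t + g t) = - fourier_coeff (\<lambda>t. \<phi> t * (R f t + R g t)) (- 1)"
      by (rule \<Lambda>ae[OF Lspace_add(1)[OF p0(1) f g] Lspace_add(1)[OF p0(1) RL[OF f] RL[OF g]] Radd[OF f g]])
    also have "\<dots> = \<Lambda> f + \<Lambda> g"
      unfolding \<Lambda>_def distrib_left
      by (subst fourier_coeff_add[OF LC_integrable[OF phi_mult(1)[OF RL[OF f]] p] LC_integrable[OF phi_mult(1)[OF RL[OF g]] p]]) simp
    finally show "\<Lambda> (\<lambda>t. f t + g t) = \<Lambda> f + \<Lambda> g" .
  next
    fix f c assume f: "f \<in> LC p"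
    have "\<Lambda> (\<lambda>t. c * f t) = - fourier_coeff (\<lambda>t. \<phi> t * (c * R f t)) (- 1)"
      by (rule \<Lambda>ae[OF Lspace_scale[OF f] Lspace_scale[OF RL[OF f]] Rscale[OF f]])
    also have "(\<lambda>t. \<phi> t * (c * R f t)) = (\<lambda>t. c * (\<phi> t * R f t))" by (simp add: mult.left_commute)
    finally show "\<Lambda> (\<lambda>t. c * f t) = c * \<Lambda> f" unfolding \<Lambda>_def fourier_coeff_scale by simp
  next
    let ?K = "(C' * (2 powr p * (2 * (C * K)))) powr (1/p)"
    fix f assume f: "f \<in> LC p"
    have "norm (\<Lambda> f) powr p \<le> LI p (\<lambda>t. \<phi> t * R f t)"
      unfolding \<Lambda>_def using fourier_coeff_Lint_bound[OF p phi_mult(1)[OF RL[OF f]], of "-1"] by simp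
    also have "\<dots> \<le> C' * (2 powr p * (2 * (C * K)) * LI p f)"
      by (rule order_trans[OF C'(2)[OF RL[OF f]] mult_left_mono[OF Rb[OF f] C'(1)]])
    finally have "(norm (\<Lambda> f) powr p) powr (1/p) \<le> (C' * (2 powr p * (2 * (C * K))) * LI p f) powr (1/p)"
      using p by (intro powr_mono2) (auto simp: mult.assoc)
    then show "norm (\<Lambda> f) \<le> ?K * LI p f powr (1/p)"
      using p C C' K by (simp add: powr_powr powr_mult)
  qed
  then obtain Y where Y: "Y \<in> LC q" "\<And>f. f \<in> LC p \<Longrightarrow> \<Lambda> f = (LINT t|circle_measure. f t * Y t)" by blast
  have zL: "(\<lambda>t. 0) \<in> LC p" using Lspace_scale[OF gL, of 0] by simp
  have zJ: "(\<lambda>t. 0) \<in> Lp_J p" using zL by (simp add: Lp_J_def Lp_eq flip_def)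
  have z0: "fourier_coeff (\<lambda>t. 0) n = 0" for n by (simp add: fourier_coeff_def)
  have mon: "(\<lambda>t. t powi n) \<in> LC r" if "0 \<le> r" for n r using trig_Lspace[OF trig_monom[of 1 n] that] by simp
  have monc: "fourier_coeff (\<lambda>t. t powi k) n = (if n = k then 1 else 0)" for k n using fourier_coeff_monom[of 1 k n] by simp
  \<comment> \<open>For n > 0 the monomial t^(-n) has projection zero, so R and the functional
    vanish on it.\<close>
  have Yc: "fourier_coeff Y n = 0" if "n > 0" for n
  proof -
    have "ae_eq (R (\<lambda>t. t powi - n)) (\<lambda>t. 0)"
      by (rule Rk[OF zJ mon[OF p0(1)]]) (use that in \<open>simp add: monc z0\<close>)
    from \<Lambda>ae[OF mon[OF p0(1)] zL this] have "\<Lambda> (\<lambda>t. t powi - n) = 0" by (simp add: z0)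
    then show ?thesis using Y(2)[OF mon[OF p0(1)], of "-n"] by (simp add: fourier_coeff_def mult.commute)
  qed
  define \<eta> where "\<eta> t = 1 + t powi (-1) * Y t" for t
  have YL: "(\<lambda>t. t powi (-1) * Y t) \<in> LC q"
    using trig_mult_LC[OF trig_inverse_id Y(1) q0(1)] by (simp add: power_int_minus)
  have oneq: "(\<lambda>t. 1) \<in> LC q" by (rule trig_Lspace[OF trig_const q0(1)])
  have \<eta>L: "\<eta> \<in> LC q" unfolding \<eta>_def[abs_def] by (rule Lspace_add(1)[OF q0(1) oneq YL])
  have \<eta>c: "fourier_coeff \<eta> n = (if n = 0 then 1 else 0)" if "0 \<le> n" for n
    unfolding \<eta>_def[abs_def]
    using fourier_coeff_add[OF LC_integrable[OF oneq q] LC_integrable[OF YL q], of n] Yc[of "n + 1"] that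
      fourier_coeff_mult_powi[of "-1" Y n]
    by (simp add: onec)
  define x where "x t = \<phi> t * \<eta> t" for t
  have xL: "x \<in> LC q" unfolding x_def[abs_def] by (rule phi_mult(2)[OF \<eta>L])
  \<comment> \<open>The orthogonality is tested on k = (I + J) t^(-n); the factor t in t eta shifts
    both indices by one. The outcome is Jx = - x.\<close>
  have xs': "fourier_coeff x (n - 1) + fourier_coeff x (- n) = 0" for n
  proof -
    let ?j = "\<lambda>t. t powi - n"
    have jL: "?j \<in> LC p" by (rule mon[OF p0(1)])
    define k where "k t = ?j t + flip ?j t" for t
    have kJ: "k \<in> Lp_J p" unfolding k_def[abs_def] by (rule symmetrization_Lp_J[OF p0(1) jL])
    note kL = Lp_J_LC[OF kJ]
    have pkL: "(\<lambda>t. \<phi> t * k t) \<in> LC p" by (rule phi_mult(1)[OF kL])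
    have kt: "k t = t powi - n + t powi (n - 1)" if "t \<in> circle" for t
    proof -
      have "t \<noteq> 0" using that by auto
      then have "t powi (n - 1) = inverse t * inverse t powi - n"
        using power_int_diff[of t n 1] by (simp add: power_int_minus power_int_inverse field_simps)
      then show ?thesis by (simp add: k_def flip_def)
    qed
    have "ae_eq (R (\<lambda>t. \<phi> t * k t)) k" by (rule Rk[OF kJ pkL refl])
    from \<Lambda>ae[OF pkL kL this] have "(LINT t|circle_measure. \<phi> t * k t * Y t) = - fourier_coeff (\<lambda>t. \<phi> t * k t) (- 1)"
      using Y(2)[OF pkL] by simp
    then have 0: "(LINT t|circle_measure. \<phi> t * k t * Y t) + (LINT t|circle_measure. \<phi> t * k t * t powi 1) = 0"
      by (simp add: fourier_coeff_def)
    have i: "integrable circle_measure (\<lambda>t. \<phi> t * k t * Y t)" by (rule Holder(1)[OF p pq pkL Y(1)])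
    have i2: "integrable circle_measure (\<lambda>t. \<phi> t * k t * t powi 1)" by (rule integrable_mult_powi[OF LC_integrable[OF pkL p]])
    have ix: "integrable circle_measure (\<lambda>t. x t * t powi m)" for m by (rule integrable_mult_powi[OF LC_integrable[OF xL q]])
    have "0 = (LINT t|circle_measure. \<phi> t * k t * Y t + \<phi> t * k t * t powi 1)"
      using 0 i i2 by simp
    also have "\<dots> = (LINT t|circle_measure. x t * t powi - (n - 1) + x t * t powi - (- n))"
    proof (rule Bochner_Integration.integral_cong[OF refl])
      fix t assume "t \<in> space circle_measure"
      then have t: "t \<in> circle" "t \<noteq> 0" by auto
      have "t powi - (n - 1) = t powi - n * t" "t powi - (- n) = t powi (n - 1) * t"
        using t power_int_diff[of t "-n" "-1"] power_int_diff[of t n 1] by (simp_all add: power_int_minus field_simps)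
      moreover have "x t * t = \<phi> t * (Y t + t)" using t by (simp add: x_def \<eta>_def power_int_minus field_simps)
      ultimately have "x t * t powi - (n - 1) + x t * t powi - (- n) = \<phi> t * (Y t + t) * k t"
        using kt[OF t(1)] by (metis (no_types, opaque_lifting) distrib_left mult.assoc mult.commute)
      then show "\<phi> t * k t * Y t + \<phi> t * k t * t powi 1 = x t * t powi - (n - 1) + x t * t powi - (- n)"
        by (simp add: algebra_simps)
    qed
    also have "\<dots> = fourier_coeff x (n - 1) + fourier_coeff x (- n)"
      unfolding fourier_coeff_def by (rule Bochner_Integration.integral_add[OF ix ix])
    finally show ?thesis by simp
  qed
  have xs: "fourier_coeff (flip x) n = fourier_coeff (\<lambda>t. - 1 * x t) n" for n
    unfolding fourier_coeff_scale fourier_coeff_flip_LC[OF xL]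
    using xs'[of "n + 1"] by (simp add: add_eq_0_iff)
  have xJ: "ae_eq (flip x) (\<lambda>t. - 1 * x t)"
    by (rule LC_ae_eqI[OF flip_LC(1)[OF xL] Lspace_scale[OF xL] q xs])
  have xi: "AE t in circle_measure. x (inverse t) = - t * x t"
    using xJ AE_circle unfolding ae_eq_def
  proof eventually_elim
    case (elim t)
    then have "t \<noteq> 0" by auto
    then show ?case using elim by (simp add: flip_def field_simps)
  qed
  define m where "m t = g t * x t" for t
  have mi: "integrable circle_measure m" unfolding m_def[abs_def] by (rule Holder(1)[OF p pq gL xL])
  have m\<psi>: "m t = \<psi> t * \<eta> t" for t by (simp add: m_def \<psi>_def x_def)
  have ms: "AE t in circle_measure. m (inverse t) = - (t\<^sup>2 * m t)"
    using xi AE_circle by eventually_elim (simp add: m_def gi power2_eq_square)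
  have anti: "fourier_coeff m (- n) = - fourier_coeff m (n - 2)" for n
    by (rule fourier_coeff_antisymmetric[OF _ ms]) (use mi in auto)
  have mc: "fourier_coeff m n = (if n = 0 then 1 else 0)" if n: "0 \<le> n" for n
  proof -
    have onep: "(\<lambda>t. 1) \<in> LC p" by (rule Hp_LC[OF one])
    have dL: "(\<lambda>t. \<psi> t - 1) \<in> LC p" by (rule Lspace_diff(1)[OF p0(1) \<psi>L onep])
    have dc: "fourier_coeff (\<lambda>t. \<psi> t - 1) k = 0" if "k > -1" for k
      using that \<psi>c[of k] by (simp add: fourier_coeff_diff LC_integrable[OF _ p] \<psi>L onep onec)
    \<comment> \<open>Since psi has mean one, psi - 1 starts at index -1, and so does its product
      with eta; at indices >= 0 the product psi eta has therefore the coefficients of eta.\<close>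
    have "fourier_coeff (\<lambda>t. \<eta> t * (\<psi> t - 1)) n = 0"
      by (rule fourier_coeff_mult_coanalytic[OF q qp \<eta>L _ dL dc]) (use \<eta>c n in auto)
    moreover have "m = (\<lambda>t. \<eta> t * (\<psi> t - 1) + \<eta> t)" by (auto simp: m\<psi> algebra_simps)
    ultimately show ?thesis
      using fourier_coeff_add[OF Holder(1)[OF q qp \<eta>L dL] LC_integrable[OF \<eta>L q], of n] \<eta>c[OF n] by simp
  qed
  have mcoeff: "fourier_coeff m n = fourier_coeff (\<lambda>t. 1 - t powi (-2)) n" for n
  proof -
    have r: "fourier_coeff (\<lambda>t. 1 - t powi (-2)) n = (if n = 0 then 1 else 0) - (if n = -2 then 1 else 0)"
      using fourier_coeff_diff[OF trig_integrable[OF trig_const[of 1]] LC_integrable[OF mon[OF p0(1)] p], of "-2" n]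
      by (simp add: onec monc)
    consider "n \<ge> 0" | "n = -1" | "n \<le> -2" by linarith
    then show ?thesis unfolding r
    proof cases
      case 2
      have "fourier_coeff m (- 1) + fourier_coeff m (- 1) = 0"
        using anti[of 1] by (simp add: eq_neg_iff_add_eq_0)
      then have "2 * fourier_coeff m (- 1) = 0" by (simp only: mult_2)
      then show "fourier_coeff m n = (if n = 0 then 1 else 0) - (if n = -2 then 1 else 0)" using 2 by simp
    next
      case 3
      then show "fourier_coeff m n = (if n = 0 then 1 else 0) - (if n = -2 then 1 else 0)"
        using anti[of "-n"] mc[of "- n - 2"] by auto
    qed (simp add: mc)
  qed
  have mt: "ae_eq m (\<lambda>t. 1 - t powi (-2))"
    by (rule fourier_unique[OF mi _ mcoeff])
      (intro Bochner_Integration.integrable_diff trig_integrable[OF trig_const] LC_integrable[OF mon[OF p0(1)] p])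
  \<comment> \<open>As 1 - 1/t^2 vanishes only at 1 and -1, the product identity shows that g and
    psi are nonzero almost everywhere, which justifies the quotients below.\<close>
  have reg: "AE t in circle_measure. t \<in> circle \<and> t \<noteq> 1 \<and> t \<noteq> -1 \<and> t \<noteq> 0 \<and> g t \<noteq> 0 \<and> \<phi> t \<noteq> 0 \<and> \<psi> t \<noteq> 0 \<and> 1 + inverse t \<noteq> 0
      \<and> \<psi> t * \<eta> t = (1 - inverse t) * (1 + inverse t) \<and> g t * x t = (1 - inverse t) * (1 + inverse t)"
    using mt[unfolded ae_eq_def] AE_circle AE_circle_not_singleton[of 1] AE_circle_not_singleton[of "-1"] phi_nonzero
  proof eventually_elim
    case (elim t)
    then have t0: "t \<noteq> 0" by auto
    have e: "m t = (1 - inverse t) * (1 + inverse t)"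
      using elim t0 by (simp add: power_int_minus power2_eq_square algebra_simps)
    have n1: "1 + inverse t \<noteq> 0" using elim t0 by (auto simp: field_simps add_eq_0_iff)
    have n2: "1 - inverse t \<noteq> 0" using elim t0 by (auto simp: field_simps)
    have "m t \<noteq> 0" unfolding e using n1 n2 by simp
    then have "g t \<noteq> 0" "\<psi> t \<noteq> 0" by (auto simp: m_def \<psi>_def x_def)
    then show ?case using elim t0 n1 e m\<psi>[of t] by (simp add: m_def)
  qed
  define \<phi>\<^sub>m where "\<phi>\<^sub>m t = \<psi> t / (1 + inverse t)" for t
  define \<phi>\<^sub>0 where "\<phi>\<^sub>0 t = (1 + inverse t) / g t" for t
  have [measurable]: "g \<in> borel_measurable circle_measure" "\<psi> \<in> borel_measurable circle_measure"
    "\<eta> \<in> borel_measurable circle_measure" "x \<in> borel_measurable circle_measure"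
    using gL \<psi>L \<eta>L xL by (auto simp: Lspace_def)
  have im: "(\<lambda>t. inverse t) \<in> borel_measurable circle_measure"
    by (intro borel_measurable_circle_borel) simp
  have \<phi>mm[measurable]: "\<phi>\<^sub>m \<in> borel_measurable circle_measure"
    unfolding \<phi>\<^sub>m_def[abs_def] divide_inverse
    by (intro borel_measurable_times borel_measurable_inverse borel_measurable_add im) auto
  have \<phi>0m[measurable]: "\<phi>\<^sub>0 \<in> borel_measurable circle_measure"
    unfolding \<phi>\<^sub>0_def[abs_def] divide_inverse
    by (intro borel_measurable_times borel_measurable_inverse borel_measurable_add im) auto
  have even: "AE t in circle_measure. \<phi>\<^sub>0 (inverse t) = \<phi>\<^sub>0 t"
    using reg
  proof eventually_elim
    case (elim t)
    then show ?case using gi[of t] by (simp add: \<phi>\<^sub>0_def field_simps)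
  qed
  have fac: "ae_eq \<phi> (\<lambda>t. \<phi>\<^sub>m t * \<phi>\<^sub>0 t)"
    unfolding ae_eq_def using reg by eventually_elim (auto simp: \<phi>\<^sub>m_def \<phi>\<^sub>0_def \<psi>_def)
  have cong_cnj: "f \<in> cnj_Hp r"
    if "h \<in> LC r" "\<And>n. n > 0 \<Longrightarrow> fourier_coeff h n = 0" "f \<in> borel_measurable circle_measure" "ae_eq h f" for f h r
  proof -
    have "f \<in> LC r" using Lspace_cong_AE(1)[OF that(1,3)] that(4) by (simp add: ae_eq_def)
    then show ?thesis using that fourier_coeff_ae_eq[OF that(1) _ that(4)] by (simp add: cnj_Hp_iff)
  qed
  have c1: "(\<lambda>t. (1 + inverse t) * \<phi>\<^sub>m t) \<in> cnj_Hp p"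
  proof (rule cong_cnj[OF \<psi>L])
    show "(\<lambda>t. (1 + inverse t) * \<phi>\<^sub>m t) \<in> borel_measurable circle_measure"
      by (intro borel_measurable_times borel_measurable_add im \<phi>mm) auto
    show "ae_eq \<psi> (\<lambda>t. (1 + inverse t) * \<phi>\<^sub>m t)"
      unfolding ae_eq_def using reg by eventually_elim (simp add: \<phi>\<^sub>m_def)
  qed (simp add: \<psi>c)
  have c2: "(\<lambda>t. (1 - inverse t) * inverse (\<phi>\<^sub>m t)) \<in> cnj_Hp q"
  proof (rule cong_cnj[OF \<eta>L])
    show "(\<lambda>t. (1 - inverse t) * inverse (\<phi>\<^sub>m t)) \<in> borel_measurable circle_measure"
      by (intro borel_measurable_times borel_measurable_diff borel_measurable_inverse im \<phi>mm) auto
    show "ae_eq \<eta> (\<lambda>t. (1 - inverse t) * inverse (\<phi>\<^sub>m t))"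
      unfolding ae_eq_def using reg
    proof eventually_elim
      case (elim t)
      then have "\<eta> t = (1 - inverse t) * (1 + inverse t) / \<psi> t" by (simp add: eq_divide_eq mult.commute)
      then show ?case by (simp add: \<phi>\<^sub>m_def divide_inverse mult.assoc)
    qed
  qed (simp add: \<eta>c)
  have inv_circle: "norm (1 - inverse t) = norm (1 - t)" "norm (1 + inverse t) = norm (1 + t)" if "t \<in> circle" for t :: complex
    using norm_one_plus_inverse[OF that] by auto
  have c3: "(\<lambda>t. of_real (norm (1 - t)) * \<phi>\<^sub>0 t) \<in> Lp_even q"
  proof -
    have "(\<lambda>t. of_real (norm (1 - t)) * \<phi>\<^sub>0 t) \<in> LC q"
    \<comment> \<open>The relation g x = (1 - 1/t)(1 + 1/t) gives x = (1 - 1/t) phi_0, so x supplies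
      the integrability to the power q, just as g does to the power p for 1/phi_0.\<close>
    proof (rule Lspace_norm_cong[OF xL])
      show "(\<lambda>t. of_real (norm (1 - t)) * \<phi>\<^sub>0 t) \<in> borel_measurable circle_measure"
        by (intro borel_measurable_times \<phi>0m borel_measurable_circle_borel) simp
      show "AE t in circle_measure. norm (of_real (norm (1 - t)) * \<phi>\<^sub>0 t) = norm (x t)"
        using reg
      proof eventually_elim
        case (elim t)
        then have "x t = (1 - inverse t) * \<phi>\<^sub>0 t" by (simp add: \<phi>\<^sub>0_def eq_divide_eq mult.commute)
        then show ?case using inv_circle[of t] elim by (simp add: norm_mult)
      qed
    qed
    moreover have "ae_eq (\<lambda>t. of_real (norm (1 - t)) * \<phi>\<^sub>0 t) (\<lambda>t. of_real (norm (1 - inverse t)) * \<phi>\<^sub>0 (inverse t))"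
      unfolding ae_eq_def using even AE_circle by eventually_elim (simp add: inv_circle)
    ultimately show ?thesis by (simp add: Lp_even_def Lp_eq)
  qed
  have c4: "(\<lambda>t. of_real (norm (1 + t)) * inverse (\<phi>\<^sub>0 t)) \<in> Lp_even p"
  proof -
    have "(\<lambda>t. of_real (norm (1 + t)) * inverse (\<phi>\<^sub>0 t)) \<in> LC p"
    proof (rule Lspace_norm_cong[OF gL])
      show "(\<lambda>t. of_real (norm (1 + t)) * inverse (\<phi>\<^sub>0 t)) \<in> borel_measurable circle_measure"
        by (intro borel_measurable_times borel_measurable_inverse \<phi>0m borel_measurable_circle_borel) simp
      show "AE t in circle_measure. norm (of_real (norm (1 + t)) * inverse (\<phi>\<^sub>0 t)) = norm (g t)"
        using reg
      proof eventually_elim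
        case (elim t)
        then have "g t = (1 + inverse t) * inverse (\<phi>\<^sub>0 t)" by (simp add: \<phi>\<^sub>0_def)
        then show ?case using inv_circle[of t] elim by (simp add: norm_mult)
      qed
    qed
    moreover have "ae_eq (\<lambda>t. of_real (norm (1 + t)) * inverse (\<phi>\<^sub>0 t)) (\<lambda>t. of_real (norm (1 + inverse t)) * inverse (\<phi>\<^sub>0 (inverse t)))"
      unfolding ae_eq_def using even AE_circle by eventually_elim (simp add: inv_circle)
    ultimately show ?thesis by (simp add: Lp_even_def Lp_eq)
  qed
  interpret factors p q \<phi> \<phi>\<^sub>m \<phi>\<^sub>0
    by unfold_locales (fact fac c1 c2 c3 c4)+
  have Bf: "\<exists>b\<in>X2 \<phi>\<^sub>0. ae_eq (B_op \<phi>\<^sub>m \<phi>\<^sub>0 f) b" if "f \<in> X1" for f using B_op_X1[OF that] by blast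
  \<comment> \<open>By \<open>B_op_X1\<close> the function Bf is flip-invariant and has P(phi Bf) =
    Pf up to null sets, which is what \<open>Rk\<close> asks for.\<close>
  have RB: "ae_eq (R f) (B_op \<phi>\<^sub>m \<phi>\<^sub>0 f)" if f: "f \<in> X1" for f
  proof -
    obtain b where b: "ae_eq (B_op \<phi>\<^sub>m \<phi>\<^sub>0 f) b" "b \<in> Lp_J p" "\<forall>n\<ge>0. fourier_coeff (\<lambda>t. \<phi> t * b t) n = fourier_coeff f n"
      using B_op_X1[OF f] by blast
    have "ae_eq (R f) b" by (rule Rk[OF b(2) trig_Lspace[OF X1_trig[OF f] p0(1)]]) (use b(3) in blast)
    then show ?thesis using ae_eq_trans ae_eq_sym[OF b(1)] by blast
  qed
  have "bounded_operator p (Lp p) (Lp_J p) R"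
    unfolding bounded_operator_iff[OF p0(2)] Lp_eq
    using RJ Radd Rscale Rb C K by (intro conjI ballI allI exI[of _ "2 powr p * (2 * (C * K))"]) auto
  then show ?thesis
    unfolding asymmetric_factorization_def
    using fac c1 c2 c3 c4 Bf RB by (intro exI[of _ \<phi>\<^sub>m] exI[of _ \<phi>\<^sub>0] conjI ballI) (auto intro!: exI[of _ R])
qed

end

theorem theorem5p3:
  fixes p q :: real and \<phi> :: "complex \<Rightarrow> complex"
  assumes "1 < p" and "1 / p + 1 / q = 1"
    and "\<phi> \<in> GLinf"
  shows "invertible_operator p (Hp p) (toeplitz_plus_hankel \<phi>)
           \<longleftrightarrow> asymmetric_factorization p q \<phi> 0"
proof -
  interpret symbol p q \<phi> by unfold_locales (fact assms)+
  show ?thesis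
  proof
    assume "invertible_operator p (Hp p) (toeplitz_plus_hankel \<phi>)"
    then show "asymmetric_factorization p q \<phi> 0"
      unfolding invertible_operator_def using factorization_of_inverse by blast
  next
    assume "asymmetric_factorization p q \<phi> 0"
    then obtain \<phi>\<^sub>m \<phi>\<^sub>0 A where f: "ae_eq \<phi> (\<lambda>t. \<phi>\<^sub>m t * \<phi>\<^sub>0 t)"
      "(\<lambda>t. (1 + inverse t) * \<phi>\<^sub>m t) \<in> cnj_Hp p"
      "(\<lambda>t. (1 - inverse t) * inverse (\<phi>\<^sub>m t)) \<in> cnj_Hp q"
      "(\<lambda>t. of_real (norm (1 - t)) * \<phi>\<^sub>0 t) \<in> Lp_even q"
      "(\<lambda>t. of_real (norm (1 + t)) * inverse (\<phi>\<^sub>0 t)) \<in> Lp_even p"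
      and A: "bounded_operator p (Lp p) (Lp_J p) A" "\<forall>f\<in>X1. ae_eq (A f) (B_op \<phi>\<^sub>m \<phi>\<^sub>0 f)"
      unfolding asymmetric_factorization_def by auto
    interpret factors p q \<phi> \<phi>\<^sub>m \<phi>\<^sub>0 by unfold_locales (fact f)+
    show "invertible_operator p (Hp p) (toeplitz_plus_hankel \<phi>)"
      by (rule invertible_of_extension[OF A(1)]) (use A(2) in blast)
  qed
qed

end
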